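(* Let $A_1$, $A_2$ be $K^*$-algebras. Then: (1) $A_1\hat{\otimes}_{\varepsilon}A_2$ is the direct sum (coproduct) of $A_1$ and $A_2$ in the category of $K^*$-algebras. (2) The algebras $A_1\bar{\otimes}_{\pi^*}A_2$ and $A_1\hat{\otimes}_{\varepsilon}A_2$ are topologically hermitian isomorphic, i.e. isomorphic as topological involutive algebras.
   Context: "Algebra" means commutative associative algebra over $\mathbb{C}$ with unit (the zero algebra is allowed). An involutive algebra is an algebra with a conjugate-linear map $x\mapsto x^*$ satisfying $(x^* )^*=x$, $(xy)^*=y^*x^*$. A $C^*$-seminorm is a seminorm $p$ with $p(xx^* )=p(x)^2$ for all $x$. An $LC^*$-algebra is an involutive algebra with a topology defined by a family of $C^*$-seminorms; a $K^*$-algebra is a complete Hausdorff $LC^*$-algebra. Morphisms of $K^*$-algebras are the continuous unit-preserving algebra homomorphisms $u$ with $u(x^* )=u(x)^*$. The algebraic tensor product $A_1\otimes A_2$ is an involutive algebra with $(x_1\otimes x_2)(y_1\otimes y_2)=x_1y_1\otimes x_2y_2$ and $(x_1\otimes x_2)^*=x_1^*\otimes x_2^*$. The projective topology $\pi$ on it is the strongest locally convex topology for which the canonical bilinear map $\otimes\colon A_1\times A_2\to A_1\otimes A_2$ is continuous. The topology $\pi^*$ is the one defined by all $\pi$-continuous $C^*$-seminorms on $A_1\otimes A_2$; $A_1\bar{\otimes}_{\pi^*}A_2$ is the Hausdorff completion of $(A_1\otimes A_2,\pi^* )$. The injective topology $\varepsilon$ on $A_1\otimes A_2$ is generated by the seminorms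 $$(p_1\otimes_{\varepsilon}p_2)\Bigl(\sum_j a_{1j}\otimes a_{2j}\Bigr)=\sup\Bigl\{\Bigl|\sum_j w_1(a_{1j})w_2(a_{2j})\Bigr| : w_i \text{ a linear functional on } A_i,\ |w_i|\le p_i,\ i=1,2\Bigr\},$$ where $p_i$ ranges over a family of $C^*$-seminorms directed upward and defining the topology of $A_i$. It is a Hausdorff $LC^*$-topology, and $A_1\hat{\otimes}_{\varepsilon}A_2$, the completion of $(A_1\otimes A_2,\varepsilon)$, is a $K^*$-algebra. The canonical morphisms of the coproduct are $a_1\mapsto a_1\otimes 1$ and $a_2\mapsto 1\otimes a_2$. *)

theory Defs
  imports
    "HOL-Analysis.Analysis"
    "HOL-Library.Poly_Mapping"
    "HOL-Algebra.Module"
    "HOL-Algebra.QuotRing"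
begin

section \<open>Involutive algebras and their morphisms\<close>

definition complex_ring :: "complex ring" where
  "complex_ring = \<lparr>carrier = UNIV, mult = (*), one = 1, zero = 0, add = (+)\<rparr>"

record 'a star_alg = "(complex, 'a) module" +
  star :: "'a \<Rightarrow> 'a"

record 'a top_star_alg = "'a star_alg" +
  topol :: "'a topology"

text \<open>The locale \<^locale>\<open>algebra\<close> is that of commutative unital algebras; the zero algebra
  is an instance.\<close>

locale star_algebra = algebra complex_ring A for A :: "('a, 'm) star_alg_scheme" (structure) +
  assumes star_closed: "x \<in> carrier A \<Longrightarrow> star A x \<in> carrier A"
    and star_add: "\<lbrakk>x \<in> carrier A; y \<in> carrier A\<rbrakk> \<Longrightarrow> star A (x \<oplus> y) = star A x \<oplus> star A y"
    and star_smult: "x \<in> carrier A \<Longrightarrow> star A (c \<odot> x) = cnj c \<odot> star A x"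
    and star_star: "x \<in> carrier A \<Longrightarrow> star A (star A x) = x"
    and star_mult: "\<lbrakk>x \<in> carrier A; y \<in> carrier A\<rbrakk> \<Longrightarrow> star A (x \<otimes> y) = star A y \<otimes> star A x"

definition with_topology :: "('a, 'm) star_alg_scheme \<Rightarrow> 'a topology \<Rightarrow> 'a top_star_alg" where
  "with_topology A X = \<lparr>carrier = carrier A, mult = mult A, one = one A, zero = zero A,
     add = add A, smult = smult A, star = star A, topol = X\<rparr>"

definition star_morphisms ::
    "('a, 'm) top_star_alg_scheme \<Rightarrow> ('b, 'n) top_star_alg_scheme \<Rightarrow> ('a \<Rightarrow> 'b) set" where
  "star_morphisms A B = {u \<in> ring_hom A B.
     (\<forall>c. \<forall>x\<in>carrier A. u (c \<odot>\<^bsub>A\<^esub> x) = c \<odot>\<^bsub>B\<^esub> u x) \<and>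
     (\<forall>x\<in>carrier A. u (star A x) = star B (u x)) \<and>
     continuous_map (topol A) (topol B) u}"

definition topologically_star_isomorphic ::
    "('a, 'm) top_star_alg_scheme \<Rightarrow> ('b, 'n) top_star_alg_scheme \<Rightarrow> bool" where
  "topologically_star_isomorphic A B \<longleftrightarrow>
     (\<exists>u \<in> star_morphisms A B. bij_betw u (carrier A) (carrier B) \<and>
        homeomorphic_map (topol A) (topol B) u)"


section \<open>Seminorms and the topologies they define\<close>

definition seminorm :: "('a, 'm) star_alg_scheme \<Rightarrow> ('a \<Rightarrow> real) \<Rightarrow> bool" where
  "seminorm A p \<longleftrightarrow>
     (\<forall>x\<in>carrier A. 0 \<le> p x) \<and>
     (\<forall>x\<in>carrier A. \<forall>y\<in>carrier A. p (x \<oplus>\<^bsub>A\<^esub> y) \<le> p x + p y) \<and>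
     (\<forall>c. \<forall>x\<in>carrier A. p (c \<odot>\<^bsub>A\<^esub> x) = cmod c * p x)"

definition cstar_seminorm :: "('a, 'm) star_alg_scheme \<Rightarrow> ('a \<Rightarrow> real) \<Rightarrow> bool" where
  "cstar_seminorm A p \<longleftrightarrow>
     seminorm A p \<and> (\<forall>x\<in>carrier A. p (x \<otimes>\<^bsub>A\<^esub> star A x) = (p x)\<^sup>2)"

text \<open>The carrier is added to the subbase so that the empty family yields the indiscrete
  topology on the carrier.\<close>

definition seminorm_topology ::
    "('a, 'm) star_alg_scheme \<Rightarrow> ('a \<Rightarrow> real) set \<Rightarrow> 'a topology" where
  "seminorm_topology A P = topology_generated_by
     (insert (carrier A)
        {{y \<in> carrier A. p (y \<ominus>\<^bsub>A\<^esub> x) < e} | p x e. p \<in> P \<and> x \<in> carrier A \<and> 0 < e})"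

definition locally_convex_topology :: "('a, 'm) star_alg_scheme \<Rightarrow> 'a topology \<Rightarrow> bool" where
  "locally_convex_topology A X \<longleftrightarrow>
     (\<exists>P. (\<forall>p\<in>P. seminorm A p) \<and> X = seminorm_topology A P)"

definition directed_upward :: "('a, 'm) star_alg_scheme \<Rightarrow> ('a \<Rightarrow> real) set \<Rightarrow> bool" where
  "directed_upward A P \<longleftrightarrow> P \<noteq> {} \<and>
     (\<forall>p\<in>P. \<forall>q\<in>P. \<exists>r\<in>P. \<forall>x\<in>carrier A. p x \<le> r x \<and> q x \<le> r x)"

definition LC_star_algebra :: "('a, 'm) top_star_alg_scheme \<Rightarrow> bool" where
  "LC_star_algebra A \<longleftrightarrow> star_algebra A \<and>
     (\<exists>P. (\<forall>p\<in>P. cstar_seminorm A p) \<and> topol A = seminorm_topology A P)"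


section \<open>Completeness and completion\<close>

text \<open>Uniform notions refer to the additive uniformity. \<open>uniformly_close A F G\<close> says that
  \<open>x - y\<close> tends to \<open>0\<close> along \<open>F \<times>\<^sub>F G\<close>; for \<open>F = G\<close> it is the Cauchy condition.\<close>

definition uniformly_close ::
    "('a, 'm) top_star_alg_scheme \<Rightarrow> 'a filter \<Rightarrow> 'a filter \<Rightarrow> bool" where
  "uniformly_close A F G \<longleftrightarrow>
     (\<forall>U. openin (topol A) U \<and> \<zero>\<^bsub>A\<^esub> \<in> U \<longrightarrow>
        (\<forall>\<^sub>F (x, y) in F \<times>\<^sub>F G. x \<ominus>\<^bsub>A\<^esub> y \<in> U))"

definition cauchy_filters :: "('a, 'm) top_star_alg_scheme \<Rightarrow> 'a filter set" where
  "cauchy_filters A =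
     {F. F \<noteq> bot \<and> (\<forall>\<^sub>F x in F. x \<in> carrier A) \<and> uniformly_close A F F}"

definition complete_algebra :: "('a, 'm) top_star_alg_scheme \<Rightarrow> bool" where
  "complete_algebra A \<longleftrightarrow> (\<forall>F \<in> cauchy_filters A. \<exists>l. limitin (topol A) (\<lambda>x. x) l F)"

definition K_star_algebra :: "('a, 'm) top_star_alg_scheme \<Rightarrow> bool" where
  "K_star_algebra A \<longleftrightarrow>
     LC_star_algebra A \<and> Hausdorff_space (topol A) \<and> complete_algebra A"

definition cauchy_rel :: "('a, 'm) top_star_alg_scheme \<Rightarrow> 'a filter rel" where
  "cauchy_rel A =
     {(F, G). F \<in> cauchy_filters A \<and> G \<in> cauchy_filters A \<and> uniformly_close A F G}"

abbreviation cauchy_class :: "('a, 'm) top_star_alg_scheme \<Rightarrow> 'a filter \<Rightarrow> 'a filter set" where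
  "cauchy_class A F \<equiv> cauchy_rel A `` {F}"

text \<open>The Hausdorff completion: Cauchy filters modulo \<^const>\<open>cauchy_rel\<close>. The entourage attached to
  a neighbourhood \<open>U\<close> of \<open>0\<close> consists of the pairs of classes having representatives whose
  difference eventually lies in \<open>U\<close>.\<close>

definition completion_nbhd ::
    "('a, 'm) top_star_alg_scheme \<Rightarrow> 'a set \<Rightarrow> 'a filter set \<Rightarrow> 'a filter set set" where
  "completion_nbhd A U X = {Y \<in> cauchy_filters A // cauchy_rel A.
     \<exists>F\<in>X. \<exists>G\<in>Y. \<forall>\<^sub>F (x, y) in F \<times>\<^sub>F G. x \<ominus>\<^bsub>A\<^esub> y \<in> U}"

definition completion_open ::
    "('a, 'm) top_star_alg_scheme \<Rightarrow> 'a filter set set \<Rightarrow> bool" where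
  "completion_open A W \<longleftrightarrow> W \<subseteq> cauchy_filters A // cauchy_rel A \<and>
     (\<forall>X\<in>W. \<exists>U. openin (topol A) U \<and> \<zero>\<^bsub>A\<^esub> \<in> U \<and> completion_nbhd A U X \<subseteq> W)"

definition hausdorff_completion ::
    "('a, 'm) top_star_alg_scheme \<Rightarrow> 'a filter set top_star_alg" where
  "hausdorff_completion A = \<lparr>
     carrier = cauchy_filters A // cauchy_rel A,
     mult = (\<lambda>X Y. \<Union>F\<in>X. \<Union>G\<in>Y.
        cauchy_class A (filtermap (\<lambda>(x, y). x \<otimes>\<^bsub>A\<^esub> y) (F \<times>\<^sub>F G))),
     one = cauchy_class A (principal {\<one>\<^bsub>A\<^esub>}),
     zero = cauchy_class A (principal {\<zero>\<^bsub>A\<^esub>}),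
     add = (\<lambda>X Y. \<Union>F\<in>X. \<Union>G\<in>Y.
        cauchy_class A (filtermap (\<lambda>(x, y). x \<oplus>\<^bsub>A\<^esub> y) (F \<times>\<^sub>F G))),
     smult = (\<lambda>c X. \<Union>F\<in>X. cauchy_class A (filtermap (\<lambda>x. c \<odot>\<^bsub>A\<^esub> x) F)),
     star = (\<lambda>X. \<Union>F\<in>X. cauchy_class A (filtermap (star A) F)),
     topol = topology (completion_open A)\<rparr>"

definition completion_map :: "('a, 'm) top_star_alg_scheme \<Rightarrow> 'a \<Rightarrow> 'a filter set" where
  "completion_map A x = cauchy_class A (principal {x})"

lemma completion_nbhd_mono:
  assumes "U \<subseteq> V"
  shows "completion_nbhd A U X \<subseteq> completion_nbhd A V X"
proof -
  have "\<forall>\<^sub>F (x, y) in F \<times>\<^sub>F G. x \<ominus>\<^bsub>A\<^esub> y \<in> V"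
    if "\<forall>\<^sub>F (x, y) in F \<times>\<^sub>F G. x \<ominus>\<^bsub>A\<^esub> y \<in> U" for F G
    using that by (rule eventually_mono) (use assms in auto)
  then show ?thesis
    unfolding completion_nbhd_def by blast
qed

lemma istopology_completion_open: "istopology (completion_open A)"
  unfolding istopology_def
proof (intro conjI allI impI)
  fix S T assume S: "completion_open A S" and T: "completion_open A T"
  have "\<exists>U. openin (topol A) U \<and> \<zero>\<^bsub>A\<^esub> \<in> U \<and> completion_nbhd A U X \<subseteq> S \<inter> T"
    if X: "X \<in> S \<inter> T" for X
  proof -
    obtain V W where V: "openin (topol A) V" "\<zero>\<^bsub>A\<^esub> \<in> V" "completion_nbhd A V X \<subseteq> S"
      and W: "openin (topol A) W" "\<zero>\<^bsub>A\<^esub> \<in> W" "completion_nbhd A W X \<subseteq> T"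
      using S T X unfolding completion_open_def by blast
    have "completion_nbhd A (V \<inter> W) X \<subseteq> S \<inter> T"
      using V(3) W(3) completion_nbhd_mono[of "V \<inter> W" V A X]
        completion_nbhd_mono[of "V \<inter> W" W A X] by blast
    then show ?thesis
      using V W by (intro exI[of _ "V \<inter> W"]) auto
  qed
  then show "completion_open A (S \<inter> T)"
    using S unfolding completion_open_def by blast
next
  fix \<K> assume "\<forall>K\<in>\<K>. completion_open A K"
  then show "completion_open A (\<Union>\<K>)"
    unfolding completion_open_def by (meson Sup_le_iff Sup_upper UnionE order_trans)
qed


section \<open>The algebraic tensor product\<close>

text \<open>The free vector space on \<open>carrier A \<times> carrier B\<close>, with product and involution extended
  (conjugate-)linearly from \<open>(a, b) (a', b') = (a a', b b')\<close> and \<open>(a, b)\<^sup>* = (a\<^sup>*, b\<^sup>*)\<close>.\<close>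

definition free_algebra :: "('a, 'm) star_alg_scheme \<Rightarrow> ('b, 'n) star_alg_scheme \<Rightarrow>
    ('a \<times> 'b \<Rightarrow>\<^sub>0 complex) star_alg" where
  "free_algebra A B = \<lparr>
     carrier = {f. Poly_Mapping.keys f \<subseteq> carrier A \<times> carrier B},
     mult = (\<lambda>f g. \<Sum>u\<in>Poly_Mapping.keys f. \<Sum>v\<in>Poly_Mapping.keys g.
        Poly_Mapping.single (fst u \<otimes>\<^bsub>A\<^esub> fst v, snd u \<otimes>\<^bsub>B\<^esub> snd v)
          (Poly_Mapping.lookup f u * Poly_Mapping.lookup g v)),
     one = Poly_Mapping.single (\<one>\<^bsub>A\<^esub>, \<one>\<^bsub>B\<^esub>) 1,
     zero = 0,
     add = (+),
     smult = (\<lambda>c. Poly_Mapping.map ((*) c)),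
     star = (\<lambda>f. \<Sum>u\<in>Poly_Mapping.keys f.
        Poly_Mapping.single (star A (fst u), star B (snd u)) (cnj (Poly_Mapping.lookup f u)))\<rparr>"

definition bilinear_relations :: "('a, 'm) star_alg_scheme \<Rightarrow> ('b, 'n) star_alg_scheme \<Rightarrow>
    ('a \<times> 'b \<Rightarrow>\<^sub>0 complex) set" where
  "bilinear_relations A B =
     {Poly_Mapping.single (a \<oplus>\<^bsub>A\<^esub> a', b) 1 - Poly_Mapping.single (a, b) 1
        - Poly_Mapping.single (a', b) 1 | a a' b.
        a \<in> carrier A \<and> a' \<in> carrier A \<and> b \<in> carrier B} \<union>
     {Poly_Mapping.single (a, b \<oplus>\<^bsub>B\<^esub> b') 1 - Poly_Mapping.single (a, b) 1
        - Poly_Mapping.single (a, b') 1 | a b b'.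
        a \<in> carrier A \<and> b \<in> carrier B \<and> b' \<in> carrier B} \<union>
     {Poly_Mapping.single (c \<odot>\<^bsub>A\<^esub> a, b) 1 - Poly_Mapping.single (a, b) c | c a b.
        a \<in> carrier A \<and> b \<in> carrier B} \<union>
     {Poly_Mapping.single (a, c \<odot>\<^bsub>B\<^esub> b) 1 - Poly_Mapping.single (a, b) c | c a b.
        a \<in> carrier A \<and> b \<in> carrier B}"

definition tensor_kernel :: "('a, 'm) star_alg_scheme \<Rightarrow> ('b, 'n) star_alg_scheme \<Rightarrow>
    ('a \<times> 'b \<Rightarrow>\<^sub>0 complex) set" where
  "tensor_kernel A B =
     (\<lambda>H. submodule H complex_ring (free_algebra A B)) hull bilinear_relations A B"

text \<open>The linear span of the relations is a \<open>star\<close>-invariant ideal of the free algebra, so the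
  quotient by it carries the ring operations of \<^const>\<open>FactRing\<close>.\<close>

definition tensor_algebra :: "('a, 'm) star_alg_scheme \<Rightarrow> ('b, 'n) star_alg_scheme \<Rightarrow>
    ('a \<times> 'b \<Rightarrow>\<^sub>0 complex) set star_alg" where
  "tensor_algebra A B = (let F = free_algebra A B; N = tensor_kernel A B; Q = F Quot N in
     \<lparr>carrier = carrier Q, mult = mult Q, one = one Q, zero = zero Q, add = add Q,
      smult = (\<lambda>c X. \<Union>f\<in>X. N +>\<^bsub>F\<^esub> (c \<odot>\<^bsub>F\<^esub> f)),
      star = (\<lambda>X. \<Union>f\<in>X. N +>\<^bsub>F\<^esub> star F f)\<rparr>)"

definition pure_tensor :: "('a, 'm) star_alg_scheme \<Rightarrow> ('b, 'n) star_alg_scheme \<Rightarrow>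
    'a \<Rightarrow> 'b \<Rightarrow> ('a \<times> 'b \<Rightarrow>\<^sub>0 complex) set" where
  "pure_tensor A B a b =
     tensor_kernel A B +>\<^bsub>free_algebra A B\<^esub> Poly_Mapping.single (a, b) 1"


section \<open>Topologies on the tensor product\<close>

definition projective_topology ::
    "('a, 'm) top_star_alg_scheme \<Rightarrow> ('b, 'n) top_star_alg_scheme \<Rightarrow>
      ('a \<times> 'b \<Rightarrow>\<^sub>0 complex) set topology" where
  "projective_topology A B =
     (let adm = (\<lambda>X. locally_convex_topology (tensor_algebra A B) X \<and>
            continuous_map (prod_topology (topol A) (topol B)) X (\<lambda>(a, b). pure_tensor A B a b))
      in THE X. adm X \<and> (\<forall>Y. adm Y \<longrightarrow> (\<forall>W. openin Y W \<longrightarrow> openin X W)))"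

definition pi_star_topology ::
    "('a, 'm) top_star_alg_scheme \<Rightarrow> ('b, 'n) top_star_alg_scheme \<Rightarrow>
      ('a \<times> 'b \<Rightarrow>\<^sub>0 complex) set topology" where
  "pi_star_topology A B = seminorm_topology (tensor_algebra A B)
     {p. cstar_seminorm (tensor_algebra A B) p \<and>
         continuous_map (projective_topology A B) euclideanreal p}"

definition bounded_functionals ::
    "('a, 'm) star_alg_scheme \<Rightarrow> ('a \<Rightarrow> real) \<Rightarrow> ('a \<Rightarrow> complex) set" where
  "bounded_functionals A p = {w.
     (\<forall>x\<in>carrier A. \<forall>y\<in>carrier A. w (x \<oplus>\<^bsub>A\<^esub> y) = w x + w y) \<and>
     (\<forall>c. \<forall>x\<in>carrier A. w (c \<odot>\<^bsub>A\<^esub> x) = c * w x) \<and>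
     (\<forall>x\<in>carrier A. cmod (w x) \<le> p x)}"

text \<open>Here \<open>f\<close> runs over the representations of the tensor \<open>X\<close> as a finite linear combination of
  pure tensors; the value of \<open>w\<^sub>1 \<otimes> w\<^sub>2\<close> does not depend on the choice of \<open>f\<close>.\<close>

definition injective_seminorm :: "('a, 'm) star_alg_scheme \<Rightarrow> ('b, 'n) star_alg_scheme \<Rightarrow>
    ('a \<Rightarrow> real) \<Rightarrow> ('b \<Rightarrow> real) \<Rightarrow> ('a \<times> 'b \<Rightarrow>\<^sub>0 complex) set \<Rightarrow> real" where
  "injective_seminorm A B p q X =
     Sup {cmod (\<Sum>(a, b)\<in>Poly_Mapping.keys f. Poly_Mapping.lookup f (a, b) * (w\<^sub>1 a * w\<^sub>2 b)) |
       f w\<^sub>1 w\<^sub>2. f \<in> X \<and> w\<^sub>1 \<in> bounded_functionals A p \<and> w\<^sub>2 \<in> bounded_functionals B q}"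

definition injective_topology :: "('a, 'm) star_alg_scheme \<Rightarrow> ('b, 'n) star_alg_scheme \<Rightarrow>
    ('a \<Rightarrow> real) set \<Rightarrow> ('b \<Rightarrow> real) set \<Rightarrow> ('a \<times> 'b \<Rightarrow>\<^sub>0 complex) set topology" where
  "injective_topology A B P Q = seminorm_topology (tensor_algebra A B)
     {injective_seminorm A B p q | p q. p \<in> P \<and> q \<in> Q}"

definition tensor_pi_star ::
    "('a, 'm) top_star_alg_scheme \<Rightarrow> ('b, 'n) top_star_alg_scheme \<Rightarrow>
      ('a \<times> 'b \<Rightarrow>\<^sub>0 complex) set top_star_alg" where
  "tensor_pi_star A B = with_topology (tensor_algebra A B) (pi_star_topology A B)"

definition tensor_injective :: "('a, 'm) star_alg_scheme \<Rightarrow> ('b, 'n) star_alg_scheme \<Rightarrow>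
    ('a \<Rightarrow> real) set \<Rightarrow> ('b \<Rightarrow> real) set \<Rightarrow> ('a \<times> 'b \<Rightarrow>\<^sub>0 complex) set top_star_alg" where
  "tensor_injective A B P Q = with_topology (tensor_algebra A B) (injective_topology A B P Q)"


section \<open>Coproducts of \<open>K\<^sup>*\<close>-algebras\<close>

text \<open>The type argument is the type of elements of the test objects \<open>C\<close>; it occurs as a free
  type variable in theorems about this predicate and is thereby universally quantified.
  Morphisms are identified when they agree on the carrier.\<close>

definition is_coproduct :: "'c itself \<Rightarrow>
    ('a, 'm) top_star_alg_scheme \<Rightarrow> ('b, 'n) top_star_alg_scheme \<Rightarrow>
    ('k, 'l) top_star_alg_scheme \<Rightarrow> ('a \<Rightarrow> 'k) \<Rightarrow> ('b \<Rightarrow> 'k) \<Rightarrow> bool" where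
  "is_coproduct (_ :: 'c itself) A B K i j \<longleftrightarrow>
     K_star_algebra K \<and> i \<in> star_morphisms A K \<and> j \<in> star_morphisms B K \<and>
     (\<forall>C :: 'c top_star_alg. K_star_algebra C \<longrightarrow>
        (\<forall>u \<in> star_morphisms A C. \<forall>v \<in> star_morphisms B C.
           \<exists>w \<in> star_morphisms K C.
             (\<forall>a\<in>carrier A. w (i a) = u a) \<and> (\<forall>b\<in>carrier B. w (j b) = v b) \<and>
             (\<forall>w' \<in> star_morphisms K C.
                (\<forall>a\<in>carrier A. w' (i a) = u a) \<and> (\<forall>b\<in>carrier B. w' (j b) = v b) \<longrightarrow>
                (\<forall>x\<in>carrier K. w' x = w x))))"

end

theory Submission
  imports Defs
begin

text \<open>A \<open>C\<^sup>*\<close>-seminorm \<open>p\<close> on a commutative star algebra is the supremum of \<open>\<bar>w\<bar>\<close> over the star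
  characters \<open>w\<close> with \<open>\<bar>w\<bar> \<le> p\<close>. Hence, in the definition of \<open>p\<^sub>1 \<otimes>\<^sub>\<epsilon> p\<^sub>2\<close>, functionals may be replaced
  by characters, which makes it a \<open>C\<^sup>*\<close>-seminorm. Conversely, a \<open>C\<^sup>*\<close>-seminorm \<open>r\<close> on the tensor product
  whose restrictions to both factors are dominated by \<open>p\<^sub>1\<close> and \<open>p\<^sub>2\<close> is dominated by \<open>p\<^sub>1 \<otimes>\<^sub>\<epsilon> p\<^sub>2\<close>,
  since every character of the tensor product is a product of characters of the factors. This
  gives the continuity of the morphism induced by two morphisms, hence the coproduct property of
  the completion, and it shows that \<open>\<pi>\<^sup>*\<close> and \<open>\<epsilon>\<close> are the same topology.\<close>

section \<open>Star algebras and \<open>C\<^sup>*\<close>-seminorms\<close>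

text \<open>The definition of a C*-seminorm assumes neither submultiplicativity nor invariance under
  the involution; on a commutative algebra both follow from the C*-identity. The main obstacle is to
  find enough characters without completeness: Neumann series need not converge, and maximal ideals
  need not be closed for the seminorm. Minimality takes over the role of spectral theory. For a
  self-adjoint h with \<open>p h > 0\<close>, Zorn's lemma gives a minimal C*-seminorm q below p
  with \<open>q h = p h\<close>. Localizing q where a self-adjoint element is largest yields a
  C*-seminorm again, and minimality then forces q to be multiplicative. A multiplicative C*-seminorm
  with \<open>q \<one> = 1\<close> is the modulus of a character, by a Gelfand-Mazur argument that
  uses no inverses.\<close>

context star_algebra begin

lemma scale_closed [simp, intro]: "x \<in> carrier A \<Longrightarrow> c \<odot> x \<in> carrier A"
  using smult_closed by (simp add: complex_ring_def)

lemma scale_add_left: "x \<in> carrier A \<Longrightarrow> (c + d) \<odot> x = c \<odot> x \<oplus> d \<odot> x"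
  using smult_l_distr[of c d x] by (simp add: complex_ring_def)

lemma scale_add_right: "x \<in> carrier A \<Longrightarrow> y \<in> carrier A \<Longrightarrow> c \<odot> (x \<oplus> y) = c \<odot> x \<oplus> c \<odot> y"
  using smult_r_distr[of c x y] by (simp add: complex_ring_def)

lemma scale_scale: "x \<in> carrier A \<Longrightarrow> c \<odot> (d \<odot> x) = (c * d) \<odot> x"
  using smult_assoc1[of c d x] by (simp add: complex_ring_def)

lemma scale_one [simp]: "x \<in> carrier A \<Longrightarrow> 1 \<odot> x = x"
  using smult_one[of x] by (simp add: complex_ring_def)

lemma scale_mult_left: "x \<in> carrier A \<Longrightarrow> y \<in> carrier A \<Longrightarrow> (c \<odot> x) \<otimes> y = c \<odot> (x \<otimes> y)"
  using smult_assoc2[of c x y] by (simp add: complex_ring_def)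

lemma scale_mult_right: "x \<in> carrier A \<Longrightarrow> y \<in> carrier A \<Longrightarrow> x \<otimes> (c \<odot> y) = c \<odot> (x \<otimes> y)"
  using scale_mult_left[of y x c] by (simp add: m_comm)

lemma scale_zero_left [simp]: "x \<in> carrier A \<Longrightarrow> 0 \<odot> x = \<zero>"
  using smult_l_null[of x] by (simp add: complex_ring_def)

lemma scale_zero_right [simp]: "c \<odot> \<zero> = \<zero>"
  using smult_r_null[of c] by (simp add: complex_ring_def)

lemma scale_minus_left: "x \<in> carrier A \<Longrightarrow> (- c) \<odot> x = \<ominus> (c \<odot> x)"
  by (metis M.minus_equality ab_left_minus scale_add_left scale_closed scale_zero_left)

lemma scale_minus_right: "x \<in> carrier A \<Longrightarrow> c \<odot> (\<ominus> x) = \<ominus> (c \<odot> x)"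
  by (metis M.a_inv_closed M.minus_equality M.l_neg scale_add_right scale_closed scale_zero_right)

lemma minus_eq_scale: "x \<in> carrier A \<Longrightarrow> \<ominus> x = (- 1) \<odot> x"
  by (simp add: scale_minus_left)

lemma scale_diff_right: "x \<in> carrier A \<Longrightarrow> y \<in> carrier A \<Longrightarrow> c \<odot> (x \<ominus> y) = c \<odot> x \<ominus> c \<odot> y"
  by (simp add: M.minus_eq scale_add_right scale_minus_right)

lemma scale_diff_left: "x \<in> carrier A \<Longrightarrow> (c - d) \<odot> x = c \<odot> x \<ominus> d \<odot> x"
  using scale_add_left[of x c "- d"] by (simp add: M.minus_eq scale_minus_left)

lemma diff_add_diff: "\<lbrakk>x \<in> carrier A; y \<in> carrier A; z \<in> carrier A\<rbrakk> \<Longrightarrow> (x \<ominus> y) \<oplus> (y \<ominus> z) = x \<ominus> z"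
  by (simp add: M.minus_eq M.a_assoc M.r_neg1)

lemma add_diff_add: "\<lbrakk>x \<in> carrier A; y \<in> carrier A; z \<in> carrier A; w \<in> carrier A\<rbrakk>
   \<Longrightarrow> (x \<oplus> y) \<ominus> (z \<oplus> w) = (x \<ominus> z) \<oplus> (y \<ominus> w)"
  by (simp add: M.minus_eq M.a_ac M.minus_add)

lemma diff_diff_diff: "\<lbrakk>x \<in> carrier A; y \<in> carrier A; z \<in> carrier A; w \<in> carrier A\<rbrakk>
   \<Longrightarrow> (x \<ominus> y) \<ominus> (z \<ominus> w) = (x \<ominus> z) \<ominus> (y \<ominus> w)"
  by (simp add: M.minus_eq M.a_ac M.minus_add)

lemma mult_diff_mult: "\<lbrakk>x \<in> carrier A; y \<in> carrier A; z \<in> carrier A; w \<in> carrier A\<rbrakk>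
   \<Longrightarrow> x \<otimes> y \<ominus> z \<otimes> w = x \<otimes> (y \<ominus> w) \<oplus> (x \<ominus> z) \<otimes> w"
  by (simp add: M.minus_eq l_distr r_distr l_minus r_minus M.a_assoc M.r_neg1)

lemma diff_self: "x \<in> carrier A \<Longrightarrow> x \<ominus> x = \<zero>"
  by (simp add: M.minus_eq M.r_neg)

lemma diff_zero [simp]: "x \<in> carrier A \<Longrightarrow> x \<ominus> \<zero> = x"
  by (simp add: M.minus_eq)

lemma diff_add_cancel: "\<lbrakk>x \<in> carrier A; y \<in> carrier A\<rbrakk> \<Longrightarrow> (x \<ominus> y) \<oplus> y = x"
  by (simp add: M.minus_eq M.a_assoc M.l_neg)

lemma diff_eq_zeroD: "\<lbrakk>x \<in> carrier A; y \<in> carrier A; x \<ominus> y = \<zero>\<rbrakk> \<Longrightarrow> x = y"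
  using diff_add_cancel[of x y] by simp

lemma star_zero [simp]: "star A \<zero> = \<zero>"
  using star_smult[of \<zero> 0] by (simp add: star_closed)

lemma star_minus: "x \<in> carrier A \<Longrightarrow> star A (\<ominus> x) = \<ominus> star A x"
  by (simp add: minus_eq_scale star_smult star_closed)

lemma star_diff: "x \<in> carrier A \<Longrightarrow> y \<in> carrier A \<Longrightarrow> star A (x \<ominus> y) = star A x \<ominus> star A y"
  by (simp add: M.minus_eq star_add star_minus)

lemma star_one [simp]: "star A \<one> = \<one>"
  using star_mult[of "\<one>" "star A \<one>"] by (simp add: star_closed star_star)

lemma star_pow: "x \<in> carrier A \<Longrightarrow> star A (x [^] (n::nat)) = star A x [^] n"
  by (induction n) (auto simp: star_mult star_closed m_comm)

lemma star_mult_star: "x \<in> carrier A \<Longrightarrow> star A (x \<otimes> star A x) = x \<otimes> star A x"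
  by (simp add: star_mult star_closed star_star m_comm)

lemma mult_star_mult: "\<lbrakk>x \<in> carrier A; y \<in> carrier A\<rbrakk> \<Longrightarrow>
    (x \<otimes> y) \<otimes> star A (x \<otimes> y) = (x \<otimes> star A x) \<otimes> (y \<otimes> star A y)"
  by (simp add: star_mult star_closed m_ac)

end


locale seminormed = star_algebra A for A :: "('a, 'm) star_alg_scheme" (structure) +
  fixes p :: "'a \<Rightarrow> real"
  assumes is_seminorm: "seminorm A p"
begin

lemma nonneg [simp]: "x \<in> carrier A \<Longrightarrow> 0 \<le> p x"
  and triangle: "x \<in> carrier A \<Longrightarrow> y \<in> carrier A \<Longrightarrow> p (x \<oplus> y) \<le> p x + p y"
  and scale: "x \<in> carrier A \<Longrightarrow> p (c \<odot> x) = cmod c * p x"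
  using is_seminorm by (auto simp: seminorm_def)

lemma zero [simp]: "p \<zero> = 0"
  using scale[of \<zero> 0] by simp

lemma minus: "x \<in> carrier A \<Longrightarrow> p (\<ominus> x) = p x"
  by (simp add: minus_eq_scale scale)

lemma triangle_diff: "x \<in> carrier A \<Longrightarrow> y \<in> carrier A \<Longrightarrow> p (x \<ominus> y) \<le> p x + p y"
  using triangle[of x "\<ominus> y"] by (simp add: M.minus_eq minus)

text \<open>Makes any domination constant positive, so that the radius of a ball may be divided by
  it.\<close>

lemma le_max_scaled: "x \<in> carrier A \<Longrightarrow> t \<le> k * p x \<Longrightarrow> t \<le> max k 1 * p x"
  using mult_right_mono[of k "max k 1" "p x"] by simp

lemma diff_commute: "x \<in> carrier A \<Longrightarrow> y \<in> carrier A \<Longrightarrow> p (x \<ominus> y) = p (y \<ominus> x)"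
  using minus[of "x \<ominus> y"] by (simp add: M.minus_eq M.minus_add M.a_comm)

lemma diff_triangle: "\<lbrakk>x \<in> carrier A; y \<in> carrier A; z \<in> carrier A\<rbrakk>
    \<Longrightarrow> p (x \<ominus> z) \<le> p (x \<ominus> y) + p (y \<ominus> z)"
  using triangle[of "x \<ominus> y" "y \<ominus> z"] by (simp add: diff_add_diff)

lemma reverse_triangle: "\<lbrakk>x \<in> carrier A; y \<in> carrier A\<rbrakk> \<Longrightarrow> \<bar>p x - p y\<bar> \<le> p (x \<ominus> y)"
  using triangle[of "x \<ominus> y" y] triangle[of "y \<ominus> x" x] diff_commute[of x y]
  by (simp add: diff_add_cancel abs_le_iff)

end


section \<open>Submultiplicativity of C*-seminorms on commutative algebras\<close>

lemma le_one_if_powers_bounded: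
  fixes t C :: real
  assumes "\<And>n. t ^ (2 ^ n) \<le> C"
  shows "t \<le> 1"
proof (rule ccontr)
  assume "\<not> t \<le> 1"
  then have t: "t > 1" by simp
  obtain n where n: "C < t ^ n" using real_arch_pow[OF t] by blast
  have "t ^ n \<le> t ^ (2 ^ n)" using t by (intro power_increasing) (auto intro: less_imp_le)
  then show False using n assms[of n] by simp
qed

locale cstar_seminormed = star_algebra A for A :: "('a, 'm) star_alg_scheme" (structure) +
  fixes p :: "'a \<Rightarrow> real"
  assumes cstar_p: "cstar_seminorm A p"
begin

sublocale seminormed A p
  by unfold_locales (use cstar_p in \<open>simp add: cstar_seminorm_def\<close>)

lemma cstar: "x \<in> carrier A \<Longrightarrow> p (x \<otimes> star A x) = (p x)\<^sup>2"
  using cstar_p by (simp add: cstar_seminorm_def)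

text \<open>By commutativity, \<open>x \<otimes> star A x\<close> is also the product that belongs
  to \<open>star A x\<close>, so the C*-identity evaluates it as both squares.\<close>

lemma star_eq: "x \<in> carrier A \<Longrightarrow> p (star A x) = p x"
  using cstar[of x] cstar[of "star A x"]
  by (simp add: star_closed star_star m_comm)

text \<open>The powers \<open>x [^] (2 ^ n)\<close>, given by recursion so that one induction step
  matches one use of the C*-identity.\<close>

primrec sq_iter :: "nat \<Rightarrow> 'a \<Rightarrow> 'a" where
  "sq_iter 0 x = x"
| "sq_iter (Suc n) x = sq_iter n x \<otimes> sq_iter n x"

lemma sq_iter_closed [simp, intro]: "x \<in> carrier A \<Longrightarrow> sq_iter n x \<in> carrier A"
  by (induction n) auto

lemma sq_iter_star: "x \<in> carrier A \<Longrightarrow> star A x = x \<Longrightarrow> star A (sq_iter n x) = sq_iter n x"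
  by (induction n) (auto simp: star_mult)

lemma sq_iter_mult: "x \<in> carrier A \<Longrightarrow> y \<in> carrier A \<Longrightarrow> sq_iter n (x \<otimes> y) = sq_iter n x \<otimes> sq_iter n y"
  by (induction n) (auto simp: m_ac)

lemma sq_iter_pow: "x \<in> carrier A \<Longrightarrow> sq_iter n x = x [^] (2 ^ n :: nat)"
  by (induction n) (auto simp: nat_pow_mult mult_2)

lemma self_adjoint_sq: "x \<in> carrier A \<Longrightarrow> star A x = x \<Longrightarrow> p (x \<otimes> x) = (p x)\<^sup>2"
  using cstar[of x] by simp

lemma self_adjoint_sq_iter: "x \<in> carrier A \<Longrightarrow> star A x = x \<Longrightarrow> p (sq_iter n x) = p x ^ (2 ^ n)"
  by (induction n) (auto simp: self_adjoint_sq sq_iter_star power2_eq_square power_add mult_2)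

text \<open>Polarization: \<open>4 h k\<close> is the difference of the squares of
  \<open>h + k\<close> and \<open>h - k\<close>, and the C*-identity evaluates the square of a
  self-adjoint element.\<close>

lemma self_adjoint_mult_le:
  assumes h: "h \<in> carrier A" "star A h = h" and k: "k \<in> carrier A" "star A k = k"
  shows "2 * p (h \<otimes> k) \<le> (p h + p k)\<^sup>2"
proof -
  have eq: "(h \<oplus> k) \<otimes> (h \<oplus> k) \<ominus> (h \<ominus> k) \<otimes> (h \<ominus> k) = 4 \<odot> (h \<otimes> k)"
  proof -
    have four: "4 \<odot> (h \<otimes> k) = (h \<otimes> k \<oplus> h \<otimes> k) \<oplus> (h \<otimes> k \<oplus> h \<otimes> k)"
    proof -
      have "(4::complex) = (1 + 1) + (1 + 1)" by simp
      then show ?thesis using h k by (simp only: scale_add_left m_closed scale_one)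
    qed
    have "(h \<oplus> k) \<ominus> (h \<ominus> k) = k \<oplus> k"
      using h k by (simp add: M.minus_eq M.minus_add M.a_assoc M.a_lcomm[of k] M.r_neg1 M.r_neg2)
    then have "(h \<oplus> k) \<otimes> (h \<oplus> k) \<ominus> (h \<ominus> k) \<otimes> (h \<ominus> k)
        = (k \<oplus> k) \<otimes> ((h \<oplus> k) \<oplus> (h \<ominus> k))"
      using h k mult_diff_mult[of "h \<oplus> k" "h \<oplus> k" "h \<ominus> k" "h \<ominus> k"]
        r_distr[of "h \<oplus> k" "h \<ominus> k" "k \<oplus> k"] m_comm[of "h \<oplus> k" "k \<oplus> k"] by simp
    also have "(h \<oplus> k) \<oplus> (h \<ominus> k) = h \<oplus> h"
      using h k by (simp add: M.minus_eq M.a_assoc M.a_lcomm[of k] M.r_neg)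
    finally show ?thesis unfolding four using h k
      by (simp add: l_distr r_distr m_comm)
  qed
  have sum: "p ((h \<oplus> k) \<otimes> (h \<oplus> k)) \<le> (p h + p k)\<^sup>2"
    using h k by (simp add: self_adjoint_sq star_add triangle power_mono)
  have diff: "p ((h \<ominus> k) \<otimes> (h \<ominus> k)) \<le> (p h + p k)\<^sup>2"
    using h k by (simp add: self_adjoint_sq star_diff triangle_diff power_mono)
  have "p (4 \<odot> (h \<otimes> k)) \<le> 2 * (p h + p k)\<^sup>2"
    unfolding eq[symmetric] using sum diff h k
      triangle_diff[of "(h \<oplus> k) \<otimes> (h \<oplus> k)" "(h \<ominus> k) \<otimes> (h \<ominus> k)"] by simp
  then show ?thesis using h k by (simp add: scale)
qed

lemma self_adjoint_mult_lt:
  assumes h: "h \<in> carrier A" "star A h = h" and k: "k \<in> carrier A" "star A k = k"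
    and a: "p h < a" and b: "p k < b"
  shows "p (h \<otimes> k) \<le> a * b"
proof -
  \<comment> \<open>After rescaling, both factors have seminorm at most 1, and polarization gives
    the bound (1 + 1)^2 / 2 = 2.\<close>
  have crude: "p (h' \<otimes> k') \<le> 2 * (a' * b')"
    if "h' \<in> carrier A" "star A h' = h'" "k' \<in> carrier A" "star A k' = k'"
      "p h' \<le> a'" "p k' \<le> b'" "0 < a'" "0 < b'" for h' k' a' b'
  proof -
    let ?h = "complex_of_real (1 / a') \<odot> h'" and ?k = "complex_of_real (1 / b') \<odot> k'"
    have "2 * p (?h \<otimes> ?k) \<le> (p ?h + p ?k)\<^sup>2"
      using that by (intro self_adjoint_mult_le) (auto simp: star_smult)
    also have "p ?h \<le> 1" "p ?k \<le> 1" using that by (simp_all add: scale norm_divide)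
    then have "(p ?h + p ?k)\<^sup>2 \<le> 2\<^sup>2"
      using that by (intro power_mono) auto
    finally have "p (?h \<otimes> ?k) \<le> 2" by simp
    moreover have "?h \<otimes> ?k = complex_of_real (1 / (a' * b')) \<odot> (h' \<otimes> k')"
      using that by (simp add: scale_mult_left scale_mult_right scale_scale mult.commute)
    moreover have "cmod (complex_of_real (1 / (a' * b'))) = 1 / (a' * b')"
      using that by (simp add: norm_divide norm_mult)
    ultimately have "1 / (a' * b') * p (h' \<otimes> k') \<le> 2" using that by (simp only: scale m_closed)
    then show ?thesis using that by (simp add: field_simps)
  qed
  have pos: "0 < a" "0 < b" using a b h k nonneg[of h] nonneg[of k] by linarith+
  have "(p (h \<otimes> k) / (a * b)) ^ (2 ^ n) \<le> 2" for n
  proof -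
    have "p (h \<otimes> k) ^ (2 ^ n) = p (sq_iter n h \<otimes> sq_iter n k)"
      using h k self_adjoint_sq_iter[of "h \<otimes> k" n] by (simp add: star_mult m_comm sq_iter_mult)
    also have "\<dots> \<le> 2 * (a ^ (2 ^ n) * b ^ (2 ^ n))"
      using h k a b pos by (intro crude) (auto simp: sq_iter_star self_adjoint_sq_iter intro!: power_mono)
    finally show ?thesis using pos by (simp add: power_divide power_mult_distrib field_simps)
  qed
  then have "p (h \<otimes> k) / (a * b) \<le> 1" by (rule le_one_if_powers_bounded)
  then show ?thesis using pos by (simp add: field_simps)
qed

lemma self_adjoint_submult:
  assumes h: "h \<in> carrier A" "star A h = h" and k: "k \<in> carrier A" "star A k = k"
  shows "p (h \<otimes> k) \<le> p h * p k"
proof -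
  have "((\<lambda>e. (p h + e) * (p k + e)) \<longlongrightarrow> (p h + 0) * (p k + 0)) (at_right (0::real))"
    by (intro tendsto_intros)
  moreover have "\<forall>\<^sub>F e in at_right 0. p (h \<otimes> k) \<le> (p h + e) * (p k + e)"
    using assms by (auto simp: eventually_at_right_less intro!: self_adjoint_mult_lt
        eventually_mono[OF eventually_at_right_less[of 0]])
  ultimately show ?thesis
    using tendsto_lowerbound[of _ "(p h + 0) * (p k + 0)" "at_right (0::real)"] by simp
qed

text \<open>Passing to \<open>x \<otimes> star A x\<close> and \<open>y \<otimes> star A y\<close>
  reduces the claim to self-adjoint factors; by the C*-identity this merely squares both
  sides.\<close>

lemma submult:
  assumes x: "x \<in> carrier A" and y: "y \<in> carrier A"
  shows "p (x \<otimes> y) \<le> p x * p y"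
proof -
  have "(p (x \<otimes> y))\<^sup>2 = p ((x \<otimes> star A x) \<otimes> (y \<otimes> star A y))"
    using x y by (simp flip: cstar add: mult_star_mult)
  also have "\<dots> \<le> p (x \<otimes> star A x) * p (y \<otimes> star A y)"
    using x y by (intro self_adjoint_submult) (auto simp: star_mult_star star_closed)
  also have "\<dots> = (p x * p y)\<^sup>2" using x y by (simp add: cstar power_mult_distrib)
  finally show ?thesis by (rule power2_le_imp_le) (use x y in auto)
qed

text \<open>By the C*-identity at the unit, \<open>p \<one>\<close> equals its own square, so it is
  0 or 1.\<close>

lemma one_le: "p \<one> \<le> 1"
  using cstar[of \<one>] by (auto simp: power2_eq_square)

end

lemma (in star_algebra) cstar_seminormedI: "cstar_seminorm A p \<Longrightarrow> cstar_seminormed A p"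
  by unfold_locales

lemma (in star_algebra) seminormedI: "seminorm A p \<Longrightarrow> seminormed A p"
  by unfold_locales

section \<open>Characters of commutative star algebras\<close>

text \<open>The zero functional is a character, so that the set is nonempty even for \<open>p = 0\<close>.\<close>

definition characters :: "('a, 'm) star_alg_scheme \<Rightarrow> ('a \<Rightarrow> real) \<Rightarrow> ('a \<Rightarrow> complex) set" where
  "characters A p = {w \<in> bounded_functionals A p.
     (\<forall>x\<in>carrier A. \<forall>y\<in>carrier A. w (x \<otimes>\<^bsub>A\<^esub> y) = w x * w y) \<and>
     (\<forall>x\<in>carrier A. w (star A x) = cnj (w x))}"

text \<open>Provides the bounds for Zorn's lemma. An infimum of seminorms need not be subadditive;
  in a chain it is, because of two members that nearly attain the infima at x and at y the smaller
  one serves for both.\<close>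

lemma (in star_algebra) seminorm_INF_chain:
  assumes "Q \<noteq> {}" and sn: "\<And>q. q \<in> Q \<Longrightarrow> cstar_seminorm A q"
    and chain: "\<And>q r. q \<in> Q \<Longrightarrow> r \<in> Q \<Longrightarrow> q \<le> r \<or> r \<le> q"
  shows "cstar_seminorm A (\<lambda>x. INF q\<in>Q. q x)"
proof -
  let ?I = "\<lambda>x. INF q\<in>Q. q x"
  have nn: "0 \<le> q x" if "q \<in> Q" "x \<in> carrier A" for q x
    using sn[OF that(1)] that(2) by (simp add: cstar_seminorm_def seminorm_def)
  have bdd: "bdd_below ((\<lambda>q. q x) ` Q)" if "x \<in> carrier A" for x
    using nn[OF _ that] by (intro bdd_belowI2[of _ 0]) auto
  have le: "?I x \<le> q x" if "q \<in> Q" "x \<in> carrier A" for q x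
    using that bdd by (intro cINF_lower) auto
  have I0: "0 \<le> ?I x" if "x \<in> carrier A" for x
    using assms(1) nn[OF _ that] by (intro cINF_greatest) auto
  have approx: "\<exists>q\<in>Q. q x < ?I x + e" if "0 < e" "x \<in> carrier A" for x e
    using that bdd[OF that(2)] assms(1) cINF_less_iff[of Q "\<lambda>q. q x" "?I x + e"] by auto
  have tri: "?I (x \<oplus> y) \<le> ?I x + ?I y" if xy: "x \<in> carrier A" "y \<in> carrier A" for x y
  proof (rule field_le_epsilon)
    fix e :: real assume "e > 0"
    then obtain q r where q: "q \<in> Q" "q x < ?I x + e / 2" and r: "r \<in> Q" "r y < ?I y + e / 2"
      using approx[of "e / 2"] xy by (meson half_gt_zero)
    obtain s where s: "s \<in> Q" "s \<le> q" "s \<le> r"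
      using chain[OF q(1) r(1)] q r by auto
    have "?I (x \<oplus> y) \<le> s (x \<oplus> y)" using le s xy by simp
    also have "\<dots> \<le> s x + s y" using sn[OF s(1)] xy by (simp add: cstar_seminorm_def seminorm_def)
    also have "\<dots> \<le> q x + r y" using s by (intro add_mono) (auto simp: le_fun_def)
    finally show "?I (x \<oplus> y) \<le> ?I x + ?I y + e" using q r by simp
  qed
  have sc: "?I (c \<odot> x) = cmod c * ?I x" if x: "x \<in> carrier A" for c x
  proof -
    have "?I (c \<odot> x) = (INF q\<in>Q. cmod c * q x)"
      using sn x by (intro INF_cong) (auto simp: cstar_seminorm_def seminorm_def)
    also have "\<dots> = cmod c * ?I x"
    proof (cases "c = 0")
      case True then show ?thesis using assms(1) by simp
    next
      case False
      show ?thesis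
      proof (rule antisym)
        have "(INF q\<in>Q. cmod c * q x) / cmod c \<le> ?I x"
        proof (rule cINF_greatest[OF assms(1)])
          fix q assume q: "q \<in> Q"
          have "(INF q\<in>Q. cmod c * q x) \<le> cmod c * q x"
            using q nn[OF _ x] by (intro cINF_lower bdd_belowI2[of _ 0]) auto
          then show "(INF q\<in>Q. cmod c * q x) / cmod c \<le> q x"
            using False by (simp add: field_simps)
        qed
        then show "(INF q\<in>Q. cmod c * q x) \<le> cmod c * ?I x" using False by (simp add: field_simps)
        show "cmod c * ?I x \<le> (INF q\<in>Q. cmod c * q x)"
          using le[OF _ x] by (intro cINF_greatest[OF assms(1)] mult_left_mono) auto
      qed
    qed
    finally show ?thesis .
  qed
  have cs: "?I (x \<otimes> star A x) = (?I x)\<^sup>2" if x: "x \<in> carrier A" for x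
  proof -
    have eq: "q (x \<otimes> star A x) = (q x)\<^sup>2" if "q \<in> Q" for q
      using sn[OF that] x by (simp add: cstar_seminorm_def)
    have xx: "x \<otimes> star A x \<in> carrier A" using x by (simp add: star_closed)
    show ?thesis
    proof (rule antisym)
      have "sqrt (?I (x \<otimes> star A x)) \<le> ?I x"
      proof (rule cINF_greatest[OF assms(1)])
        fix q assume q: "q \<in> Q"
        have "?I (x \<otimes> star A x) \<le> (q x)\<^sup>2" using le[OF q xx] eq[OF q] by simp
        then show "sqrt (?I (x \<otimes> star A x)) \<le> q x" using nn[OF q x] by (simp add: real_le_lsqrt)
      qed
      then show "?I (x \<otimes> star A x) \<le> (?I x)\<^sup>2" using I0[OF x] I0[OF xx] sqrt_le_D by blast
      show "(?I x)\<^sup>2 \<le> ?I (x \<otimes> star A x)"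
        using le[OF _ x] I0[OF x] by (intro cINF_greatest[OF assms(1)]) (simp add: eq power_mono)
    qed
  qed
  show ?thesis unfolding cstar_seminorm_def seminorm_def using I0 tri sc cs by simp
qed

section \<open>Peaks and minimal C*-seminorms\<close>

context cstar_seminormed begin

text \<open>For \<open>p b = 1\<close> and functions on a compact space, this is the supremum of \<open>\<bar>x\<bar>\<close> over the set where
  \<open>\<bar>b\<bar>\<close> is maximal. Minimal \<open>C\<^sup>*\<close>-seminorms coincide with their peaks, hence are multiplicative.\<close>

definition peak :: "'a \<Rightarrow> 'a \<Rightarrow> real" where
  "peak b x = (INF n. p (x \<otimes> b [^] (n::nat)))"

context
  fixes b assumes b: "b \<in> carrier A" "star A b = b" "p b = 1"
begin

lemma peak_decseq: "x \<in> carrier A \<Longrightarrow> decseq (\<lambda>n. p (x \<otimes> b [^] (n::nat)))"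
proof (rule decseq_SucI)
  fix n assume x: "x \<in> carrier A"
  have "p (x \<otimes> b [^] Suc n) = p ((x \<otimes> b [^] n) \<otimes> b)" using x b by (simp add: m_assoc)
  also have "\<dots> \<le> p (x \<otimes> b [^] n)" using submult[of "x \<otimes> b [^] n" b] x b by simp
  finally show "p (x \<otimes> b [^] Suc n) \<le> p (x \<otimes> b [^] n)" .
qed

lemma peak_tendsto: "x \<in> carrier A \<Longrightarrow> (\<lambda>n. p (x \<otimes> b [^] (n::nat))) \<longlonglongrightarrow> peak b x"
  unfolding peak_def using b
  by (intro LIMSEQ_decseq_INF peak_decseq bdd_belowI2[of _ 0]) auto

lemma peak_le: "x \<in> carrier A \<Longrightarrow> peak b x \<le> p x"
  using decseq_ge[OF peak_decseq peak_tendsto, of x 0] b by simp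

lemma peak_cstar_seminorm: "cstar_seminorm A (peak b)"
  unfolding cstar_seminorm_def seminorm_def
proof (intro conjI ballI allI)
  fix x assume x: "x \<in> carrier A"
  show "0 \<le> peak b x" using peak_tendsto[OF x] x b by (intro LIMSEQ_le_const) auto
  show "peak b (c \<odot> x) = cmod c * peak b x" for c
  proof (rule LIMSEQ_unique)
    show "(\<lambda>n. p ((c \<odot> x) \<otimes> b [^] (n::nat))) \<longlonglongrightarrow> peak b (c \<odot> x)" using x by (intro peak_tendsto) auto
    show "(\<lambda>n. p ((c \<odot> x) \<otimes> b [^] (n::nat))) \<longlonglongrightarrow> cmod c * peak b x"
      using tendsto_mult_left[OF peak_tendsto[OF x], of "cmod c"] x b
      by (simp add: scale_mult_left scale)
  qed
  show "peak b (x \<otimes> star A x) = (peak b x)\<^sup>2"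
  proof (rule LIMSEQ_unique)
    have "x \<otimes> star A x \<in> carrier A" using x by (simp add: star_closed)
    \<comment> \<open>Along even exponents, \<open>b [^] (2 * n)\<close> splits into
      \<open>b [^] n\<close> and its adjoint, which turns the sequence for
      \<open>x \<otimes> star A x\<close> into the square of the sequence for x.\<close>
    then have "((\<lambda>n. p ((x \<otimes> star A x) \<otimes> b [^] (n::nat))) \<circ> (\<lambda>n. 2 * n)) \<longlonglongrightarrow> peak b (x \<otimes> star A x)"
      by (intro LIMSEQ_subseq_LIMSEQ peak_tendsto) (auto simp: strict_mono_def)
    moreover have "p ((x \<otimes> star A x) \<otimes> b [^] (2 * n)) = (p (x \<otimes> b [^] n))\<^sup>2" for n :: nat
    proof -
      have "(x \<otimes> star A x) \<otimes> b [^] (2 * n) = (x \<otimes> b [^] n) \<otimes> star A (x \<otimes> b [^] n)"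
        using x b by (simp add: mult_star_mult star_pow nat_pow_mult mult_2)
      then show ?thesis using x b by (simp add: cstar)
    qed
    ultimately show "(\<lambda>n. (p (x \<otimes> b [^] (n::nat)))\<^sup>2) \<longlonglongrightarrow> peak b (x \<otimes> star A x)"
      by (simp add: o_def)
    show "(\<lambda>n. (p (x \<otimes> b [^] (n::nat)))\<^sup>2) \<longlonglongrightarrow> (peak b x)\<^sup>2"
      using peak_tendsto[OF x] by (intro tendsto_intros)
  qed
next
  fix x y assume x: "x \<in> carrier A" and y: "y \<in> carrier A"
  show "peak b (x \<oplus> y) \<le> peak b x + peak b y"
  proof (rule LIMSEQ_le)
    show "(\<lambda>n. p ((x \<oplus> y) \<otimes> b [^] (n::nat))) \<longlonglongrightarrow> peak b (x \<oplus> y)"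
      using x y by (intro peak_tendsto) auto
    show "(\<lambda>n. p (x \<otimes> b [^] (n::nat)) + p (y \<otimes> b [^] n)) \<longlonglongrightarrow> peak b x + peak b y"
      using x y by (intro tendsto_intros peak_tendsto)
    show "\<exists>N. \<forall>n\<ge>N. p ((x \<oplus> y) \<otimes> b [^] n) \<le> p (x \<otimes> b [^] (n::nat)) + p (y \<otimes> b [^] n)"
      using x y b by (auto simp: l_distr intro!: triangle)
  qed
qed

text \<open>A factor b only shifts the defining sequence by one place.\<close>

lemma peak_mult: "x \<in> carrier A \<Longrightarrow> peak b (x \<otimes> b) = peak b x"
proof (rule LIMSEQ_unique)
  assume x: "x \<in> carrier A"
  show "(\<lambda>n. p ((x \<otimes> b) \<otimes> b [^] (n::nat))) \<longlonglongrightarrow> peak b (x \<otimes> b)" using x b by (intro peak_tendsto) auto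
  have "(x \<otimes> b) \<otimes> b [^] n = x \<otimes> b [^] Suc n" for n :: nat
    using x b by (simp add: m_ac)
  then show "(\<lambda>n. p ((x \<otimes> b) \<otimes> b [^] (n::nat))) \<longlonglongrightarrow> peak b x"
    using LIMSEQ_Suc[OF peak_tendsto[OF x]] by simp
qed

text \<open>The values decrease in the exponent and equal 1 at the exponents \<open>2 ^ n\<close>,
  so none is below 1; they start at \<open>p \<one> \<le> 1\<close>.\<close>

lemma p_pow_eq_one: "p (b [^] (n::nat)) = 1"
proof -
  have dec: "decseq (\<lambda>n. p (b [^] (n::nat)))" using peak_decseq[of \<one>] b by simp
  have "p (b [^] (2 ^ n :: nat)) = 1" using self_adjoint_sq_iter[of b n] b by (simp add: sq_iter_pow)
  then have "1 \<le> p (b [^] n)"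
    using decseqD[OF dec, of n "2 ^ n"] by (simp add: less_imp_le)
  moreover have "p (b [^] n) \<le> p \<one>" using decseqD[OF dec, of 0 n] by simp
  ultimately show ?thesis using one_le by simp
qed

end

lemma peak_one: "b \<in> carrier A \<Longrightarrow> star A b = b \<Longrightarrow> p b = 1 \<Longrightarrow> peak b \<one> = 1"
  using peak_tendsto[of b \<one>] p_pow_eq_one[of b] by (simp add: LIMSEQ_const_iff)

text \<open>Seminorms are total functions that are constrained only on the carrier. Setting them to
  0 elsewhere makes the pointwise order of functions, to which Zorn's lemma is applied, reflect the
  order on the carrier.\<close>

definition restrict0 :: "('a \<Rightarrow> real) \<Rightarrow> 'a \<Rightarrow> real" where
  "restrict0 q x = (if x \<in> carrier A then q x else 0)"

lemma restrict0_cstar_seminorm: "cstar_seminorm A (restrict0 q) \<longleftrightarrow> cstar_seminorm A q"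
  by (auto simp: restrict0_def cstar_seminorm_def seminorm_def star_closed)

text \<open>For \<open>p h > 0\<close>, prescribing the value at h keeps the minimal seminorm away
  from 0.\<close>

lemma exists_minimal:
  assumes h: "h \<in> carrier A"
  obtains q where "cstar_seminorm A q" "\<And>x. x \<in> carrier A \<Longrightarrow> q x \<le> p x" "q h = p h"
    "\<And>r. cstar_seminorm A r \<Longrightarrow> (\<And>x. x \<in> carrier A \<Longrightarrow> r x \<le> q x) \<Longrightarrow> r h = p h \<Longrightarrow>
      (\<And>x. x \<in> carrier A \<Longrightarrow> r x = q x)"
proof -
  define S where "S = {q. cstar_seminorm A q \<and> restrict0 q = q \<and> q \<le> restrict0 p \<and> q h = p h}"
  \<comment> \<open>The order is reversed, because \<open>predicate_Zorn\<close> asks for upper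
    bounds and yields maximal elements.\<close>
  let ?P = "\<lambda>q r. r \<le> (q :: 'a \<Rightarrow> real)"
  have po: "partial_order_on S (relation_of ?P S)"
    by (auto simp: partial_order_on_def preorder_on_def refl_on_def relation_of_def
        intro!: transI antisymI intro: order_trans)
  have "\<exists>u\<in>S. \<forall>q\<in>Q. ?P q u" if Q: "Q \<in> Chains (relation_of ?P S)" for Q
  proof (cases "Q = {}")
    case True
    have "restrict0 p \<in> S"
      using cstar_p h by (auto simp: S_def restrict0_cstar_seminorm) (auto simp: restrict0_def)
    with True show ?thesis by auto
  next
    case False
    have QS: "Q \<subseteq> S" and ch: "\<And>q r. q \<in> Q \<Longrightarrow> r \<in> Q \<Longrightarrow> q \<le> r \<or> r \<le> q"
      using Q by (auto simp: Chains_def relation_of_def)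
    let ?I = "\<lambda>x. INF q\<in>Q. q x"
    have I: "cstar_seminorm A ?I"
      using QS ch False by (intro seminorm_INF_chain) (auto simp: S_def)
    have out: "q x = 0" if "q \<in> Q" "x \<notin> carrier A" for q x
    proof -
      have "restrict0 q = q" using QS that(1) by (auto simp: S_def)
      then have "q x = restrict0 q x" by simp
      then show ?thesis using that(2) by (simp add: restrict0_def)
    qed
    have nn: "0 \<le> q x" if "q \<in> Q" for q x
      using QS that out[OF that] by (cases "x \<in> carrier A") (auto simp: S_def cstar_seminorm_def seminorm_def)
    have le: "?I \<le> q" if "q \<in> Q" for q
      unfolding le_fun_def using nn that by (auto intro!: cINF_lower bdd_belowI2[of _ 0])
    obtain q0 where q0: "q0 \<in> Q" using False by auto
    have "?I \<in> S"
      unfolding S_def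
    proof (intro CollectI conjI I)
      have "?I x = (INF q\<in>Q. 0)" if "x \<notin> carrier A" for x
        using out that by (intro INF_cong) auto
      then show "restrict0 ?I = ?I" using False by (auto simp: restrict0_def fun_eq_iff)
      show "?I \<le> restrict0 p" using le[OF q0] q0 QS by (auto simp: S_def intro: order_trans)
      have "?I h = (INF q\<in>Q. p h)" using QS by (intro INF_cong) (auto simp: S_def)
      then show "?I h = p h" using False by simp
    qed
    then show ?thesis using le by blast
  qed
  from predicate_Zorn[OF po this] obtain q where q: "q \<in> S" and min: "\<And>r. r \<in> S \<Longrightarrow> r \<le> q \<Longrightarrow> r = q"
    by blast
  show thesis
  proof (rule that[of q])
    show "cstar_seminorm A q" "q h = p h" using q by (auto simp: S_def)
    show "q x \<le> p x" if "x \<in> carrier A" for x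
      using q that by (auto simp: S_def le_fun_def restrict0_def dest: spec[of _ x])
    fix r x
    assume r: "cstar_seminorm A r" "\<And>x. x \<in> carrier A \<Longrightarrow> r x \<le> q x" "r h = p h" and x: "x \<in> carrier A"
    have "restrict0 r \<le> restrict0 q" using r(2) by (auto simp: le_fun_def restrict0_def)
    then have rq: "restrict0 r \<le> q" using q by (auto simp: S_def)
    then have "restrict0 r \<in> S" using r q h
      by (auto simp: S_def restrict0_cstar_seminorm intro: order_trans) (auto simp: restrict0_def)
    from min[OF this rq] show "r x = q x" using x by (metis restrict0_def)
  qed
qed

text \<open>For a normalized self-adjoint b, the peak of the minimal q at b lies below q. If it
  keeps the value at h, minimality makes it equal to q, and then
  \<open>q (x \<otimes> b) = q x\<close>, because peaks absorb b. For normalized h itself the value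
  is kept automatically. The resulting rule \<open>q (x \<otimes> h) = q x * q h\<close> shows that
  every other b keeps it as well.\<close>

lemma exists_multiplicative_minorant:
  assumes h: "h \<in> carrier A" "star A h = h" "p h > 0"
  obtains q where "cstar_seminorm A q" "\<And>x. x \<in> carrier A \<Longrightarrow> q x \<le> p x" "q h = p h" "q \<one> = 1"
    "\<And>x y. x \<in> carrier A \<Longrightarrow> y \<in> carrier A \<Longrightarrow> q (x \<otimes> y) = q x * q y"
proof -
  obtain q where q: "cstar_seminorm A q" "\<And>x. x \<in> carrier A \<Longrightarrow> q x \<le> p x" "q h = p h"
    and min: "\<And>r x. cstar_seminorm A r \<Longrightarrow> (\<And>x. x \<in> carrier A \<Longrightarrow> r x \<le> q x) \<Longrightarrow> r h = p h \<Longrightarrow>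
      x \<in> carrier A \<Longrightarrow> r x = q x"
    by (rule exists_minimal[OF h(1)]) blast
  interpret q: cstar_seminormed A q by unfold_locales (rule q)
  define unit where "unit b = complex_of_real (1 / q b) \<odot> b" for b
  have unit: "unit b \<in> carrier A" "star A (unit b) = unit b" "q (unit b) = 1"
    if "b \<in> carrier A" "star A b = b" "q b > 0" for b
    using that by (auto simp: unit_def star_smult q.scale norm_divide)
  have mult_unit: "q (x \<otimes> unit b) = q (x \<otimes> b) / q b"
    if "b \<in> carrier A" "x \<in> carrier A" "q b > 0" for b x
    using that by (simp add: unit_def scale_mult_right q.scale norm_divide)
  have unit_mult: "h = complex_of_real (q h) \<odot> unit h"
    using h q(3) by (simp add: unit_def scale_scale)
  have peak_h: "q.peak b h = p h"
    if b: "b \<in> carrier A" "star A b = b" "q b = 1" and bh: "q.peak b (unit h) = 1" for b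
  proof -
    interpret r: cstar_seminormed A "q.peak b" by unfold_locales (rule q.peak_cstar_seminorm[OF b])
    have "q.peak b h = q h * q.peak b (unit h)"
      using h q(3) unit(1)[OF h(1,2)] by (subst unit_mult) (simp add: r.scale)
    then show ?thesis using bh q(3) by simp
  qed
  \<comment> \<open>The disjunction covers \<open>q b = 0\<close>, where b cannot be normalized but
    both sides vanish by submultiplicativity.\<close>
  have self: "q (x \<otimes> b) = q x * q b"
    if b: "b \<in> carrier A" "star A b = b" and bh: "q.peak (unit b) (unit h) = 1 \<or> q b = 0"
      and x: "x \<in> carrier A" for b x
  proof (cases "q b = 0")
    case True
    moreover have "0 \<le> q (x \<otimes> b)" using x b by simp
    ultimately show ?thesis using q.submult[OF x b(1)] by simp
  next
    case False
    then have pos: "q b > 0" using q.nonneg[OF b(1)] by simp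
    note u = unit[OF b pos]
    have "q.peak (unit b) y = q y" if "y \<in> carrier A" for y
      using that bh False u peak_h
      by (intro min q.peak_cstar_seminorm q.peak_le) auto
    then have "q (x \<otimes> unit b) = q x" using q.peak_mult[OF u x] x u by simp
    then show ?thesis using mult_unit[OF b(1) x pos] pos by (simp add: field_simps)
  qed
  have qh: "q h > 0" using h q(3) by simp
  note uh = unit[OF h(1,2) qh]
  \<comment> \<open>The case b = h: the peak at \<open>unit h\<close> absorbs the factor
    \<open>unit h\<close>, which leaves its value at the unit element, and that is 1.\<close>
  have "q.peak (unit h) (unit h) = 1"
    using q.peak_mult[OF uh, of \<one>] q.peak_one[OF uh] uh by simp
  then have mult_h: "q (x \<otimes> h) = q x * q h" if "x \<in> carrier A" for x
    using self[OF h(1,2) _ that] by simp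
  then have mult_uh: "q (x \<otimes> unit h) = q x" if "x \<in> carrier A" for x
    using mult_unit[OF h(1) that qh] that qh by simp
  have self': "q (x \<otimes> b) = q x * q b"
    if b: "b \<in> carrier A" "star A b = b" and x: "x \<in> carrier A" for b x
  proof (cases "q b = 0")
    case True then show ?thesis using self[OF b _ x] by simp
  next
    case False
    then have pos: "q b > 0" using q.nonneg[OF b(1)] by simp
    note u = unit[OF b pos]
    \<comment> \<open>Multiplication by \<open>unit h\<close> does not change q, so the sequence
      that defines the peak at \<open>unit h\<close> is constantly 1.\<close>
    have "q (unit h \<otimes> unit b [^] n) = 1" for n :: nat
      using mult_uh[of "unit b [^] n"] u uh q.p_pow_eq_one[OF u] by (simp add: m_comm)
    then have "q.peak (unit b) (unit h) = 1"
      using q.peak_tendsto[OF u uh(1)] by (simp add: LIMSEQ_const_iff)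
    then show ?thesis using self[OF b _ x] by simp
  qed
  show thesis
  proof (rule that[OF q])
    show "q \<one> = 1" using mult_h[of \<one>] h qh by simp
    fix x y assume x: "x \<in> carrier A" and y: "y \<in> carrier A"
    have "(q (x \<otimes> y))\<^sup>2 = q ((x \<otimes> star A x) \<otimes> (y \<otimes> star A y))"
      using x y by (simp flip: q.cstar add: mult_star_mult)
    also have "\<dots> = q (x \<otimes> star A x) * q (y \<otimes> star A y)"
      using x y by (intro self') (auto simp: star_mult_star star_closed)
    also have "\<dots> = (q x * q y)\<^sup>2" using x y by (simp add: q.cstar power_mult_distrib)
    finally show "q (x \<otimes> y) = q x * q y" using x y by simp
  qed
qed

section \<open>Gelfand-Mazur for multiplicative C*-seminorms\<close>

lemma zero_scalar_unique:
  assumes "p \<one> = 1" "x \<in> carrier A" "p (x \<ominus> l \<odot> \<one>) = 0" "p (x \<ominus> m \<odot> \<one>) = 0"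
  shows "l = m"
proof -
  have "cmod (l - m) = p (l \<odot> \<one> \<ominus> m \<odot> \<one>)"
    using assms(1) by (simp flip: scale_diff_left add: scale)
  also have "\<dots> \<le> p (l \<odot> \<one> \<ominus> x) + p (x \<ominus> m \<odot> \<one>)"
    using assms by (intro diff_triangle) auto
  also have "\<dots> = 0" using assms diff_commute[of x "l \<odot> \<one>"] by simp
  finally show ?thesis by simp
qed

lemma scalar_mult_scalar: "(c \<odot> \<one>) \<otimes> (d \<odot> \<one>) = (c * d) \<odot> \<one>"
  by (simp add: scale_mult_left scale_scale)

text \<open>The second factor is written with \<open>- s\<close>, so that a lower bound valid for
  all \<open>y \<ominus> d \<odot> \<one>\<close> covers both factors.\<close>

lemma sq_diff_scalar:
  assumes "y \<in> carrier A"
  shows "y \<otimes> y \<ominus> (s * s) \<odot> \<one> = (y \<ominus> s \<odot> \<one>) \<otimes> (y \<ominus> (- s) \<odot> \<one>)"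
proof -
  have "y \<otimes> y \<ominus> (s * s) \<odot> \<one> = y \<otimes> (y \<ominus> s \<odot> \<one>) \<oplus> (y \<ominus> s \<odot> \<one>) \<otimes> (s \<odot> \<one>)"
    using assms mult_diff_mult[of y y "s \<odot> \<one>" "s \<odot> \<one>"] by (simp add: scalar_mult_scalar)
  also have "\<dots> = (y \<ominus> s \<odot> \<one>) \<otimes> (y \<oplus> s \<odot> \<one>)"
    using assms by (simp add: r_distr m_comm)
  also have "y \<oplus> s \<odot> \<one> = y \<ominus> (- s) \<odot> \<one>"
    using assms by (simp add: M.minus_eq scale_minus_left)
  finally show ?thesis .
qed

text \<open>The Gelfand--Mazur argument for multiplicative norms: the set where \<open>p (x - l)\<close> attains a
  positive minimum \<open>m\<close> over \<open>l \<in> \<complex>\<close> would contain the disc of radius \<open>m\<close> around each of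
  its points, because \<open>y\<^bsup>N\<^esup> - c\<^bsup>N\<^esup>\<close> factors over \<open>\<complex>\<close> and every linear factor has \<open>p \<ge> m\<close>.
  Only \<open>N = 2\<^bsup>n\<^esup>\<close> is needed, for which square roots suffice.\<close>

lemma exists_zero_scalar:
  assumes one: "p \<one> = 1" and mult: "\<And>x y. x \<in> carrier A \<Longrightarrow> y \<in> carrier A \<Longrightarrow> p (x \<otimes> y) = p x * p y"
    and x: "x \<in> carrier A"
  obtains l where "p (x \<ominus> l \<odot> \<one>) = 0"
proof -
  define f where "f l = p (x \<ominus> l \<odot> \<one>)" for l
  have "\<bar>f l - f m\<bar> \<le> cmod (l - m)" for l m
  proof -
    have "\<bar>f l - f m\<bar> \<le> p ((x \<ominus> l \<odot> \<one>) \<ominus> (x \<ominus> m \<odot> \<one>))"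
      unfolding f_def using x by (intro reverse_triangle) auto
    also have "(x \<ominus> l \<odot> \<one>) \<ominus> (x \<ominus> m \<odot> \<one>) = \<ominus> ((l - m) \<odot> \<one>)"
      using x by (simp add: diff_diff_diff diff_self scale_diff_left) (simp add: M.minus_eq)
    finally show ?thesis by (simp add: minus scale one)
  qed
  then have "1-lipschitz_on UNIV f"
    by (intro lipschitz_onI) (auto simp: dist_norm)
  \<comment> \<open>Outside this disc \<open>f l\<close> is at least \<open>cmod l - p x\<close>,
    which exceeds \<open>p x = f 0\<close>; so a minimum over the disc is a minimum over the
    plane.\<close>
  then have cont: "continuous_on (cball 0 (2 * p x)) f"
    using lipschitz_on_continuous_on continuous_on_subset by blast
  have lower: "cmod l - p x \<le> f l" for l
    using reverse_triangle[of x "l \<odot> \<one>"] x by (simp add: f_def scale one)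
  have f0: "f 0 = p x" using x by (simp add: f_def)
  obtain l0 where l0: "l0 \<in> cball 0 (2 * p x)" "\<And>l. l \<in> cball 0 (2 * p x) \<Longrightarrow> f l0 \<le> f l"
    using continuous_attains_inf[OF compact_cball _ cont] nonneg[OF x] by (auto simp: Ball_def)
  define m where "m = f l0"
  have min: "m \<le> f l" for l
  proof (cases "l \<in> cball 0 (2 * p x)")
    case True then show ?thesis using l0(2) by (simp add: m_def)
  next
    case False
    then have "2 * p x < cmod l" by simp
    then show ?thesis using lower[of l] l0(2)[of 0] f0 x by (simp add: m_def)
  qed
  have "m = 0"
  proof (rule ccontr)
    assume "m \<noteq> 0"
    then have m: "m > 0" using x by (simp add: m_def f_def less_le)
    have step: "f (l + c) = m" if l: "f l = m" and c: "cmod c < m" for l c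
    proof -
      define y where "y = x \<ominus> l \<odot> \<one>"
      have y: "y \<in> carrier A" "p y = m" using x l by (auto simp: y_def f_def)
      have shift: "p (y \<ominus> d \<odot> \<one>) = f (l + d)" for d
      proof -
        have "y \<ominus> d \<odot> \<one> = x \<ominus> (l + d) \<odot> \<one>"
          using x by (simp add: y_def scale_add_left M.minus_eq M.minus_add M.a_assoc)
        then show ?thesis by (simp add: f_def)
      qed
      \<comment> \<open>A square root of d splits the difference at level n + 1 into two differences
        at level n, each bounded below by induction.\<close>
      have A: "m ^ (2 ^ n) \<le> p (sq_iter n y \<ominus> d \<odot> \<one>)" for n d
      proof (induction n arbitrary: d)
        case 0 then show ?case using shift min by simp
      next
        case (Suc n)
        have "m ^ (2 ^ Suc n) = m ^ (2 ^ n) * m ^ (2 ^ n)" by (simp add: mult_2 power_add)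
        also have "\<dots> \<le> p (sq_iter n y \<ominus> csqrt d \<odot> \<one>) * p (sq_iter n y \<ominus> (- csqrt d) \<odot> \<one>)"
          using Suc m y by (intro mult_mono) auto
        also have "\<dots> = p (sq_iter (Suc n) y \<ominus> (csqrt d * csqrt d) \<odot> \<one>)"
          using y sq_diff_scalar[of "sq_iter n y" "csqrt d"] by (simp add: mult)
        finally show ?case by (simp flip: power2_eq_square)
      qed
      \<comment> \<open>The factor \<open>y - c\<close> is kept, and the remaining
        \<open>2 ^ n - 1\<close> linear factors are estimated from below by m; the additional m on
        the right avoids a subtraction in the exponent.\<close>
      have B: "p (y \<ominus> c \<odot> \<one>) * m ^ (2 ^ n) \<le> m * p (sq_iter n y \<ominus> c ^ (2 ^ n) \<odot> \<one>)" for n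
      proof (induction n)
        case 0 then show ?case by (simp add: mult.commute)
      next
        case (Suc n)
        let ?C = "c ^ (2 ^ n)"
        have "p (y \<ominus> c \<odot> \<one>) * m ^ (2 ^ Suc n) = (p (y \<ominus> c \<odot> \<one>) * m ^ (2 ^ n)) * m ^ (2 ^ n)"
          by (simp add: mult_2 power_add)
        also have "\<dots> \<le> (m * p (sq_iter n y \<ominus> ?C \<odot> \<one>)) * p (sq_iter n y \<ominus> (- ?C) \<odot> \<one>)"
          using m y by (intro mult_mono[OF Suc.IH A]) auto
        also have "\<dots> = m * p (sq_iter (Suc n) y \<ominus> (?C * ?C) \<odot> \<one>)"
          using y sq_diff_scalar[of "sq_iter n y" ?C] by (simp add: mult)
        finally show ?case by (simp add: mult_2 power_add)
      qed
      have psq: "p (sq_iter n y) = m ^ (2 ^ n)" for n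
        by (induction n) (use y in \<open>auto simp: mult mult_2 power_add\<close>)
      \<comment> \<open>As p is multiplicative, the iterated square of y has seminorm exactly
        \<open>m ^ (2 ^ n)\<close>; the relative error that comes from c then tends to 0 for
        \<open>cmod c < m\<close>.\<close>
      have bound: "f (l + c) \<le> m * (1 + (cmod c / m) ^ (2 ^ n))" for n
      proof -
        have "f (l + c) * m ^ (2 ^ n) \<le> m * p (sq_iter n y \<ominus> c ^ (2 ^ n) \<odot> \<one>)"
          using B[of n] by (simp add: shift)
        also have "\<dots> \<le> m * (m ^ (2 ^ n) + cmod c ^ (2 ^ n))"
          using m y triangle_diff[of "sq_iter n y" "c ^ (2 ^ n) \<odot> \<one>"]
          by (intro mult_left_mono) (auto simp: psq scale one norm_power)
        also have "\<dots> = (m * (1 + (cmod c / m) ^ (2 ^ n))) * m ^ (2 ^ n)"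
          using m by (simp add: field_simps)
        finally show ?thesis using m by simp
      qed
      have "(\<lambda>n. (cmod c / m) ^ n) \<longlonglongrightarrow> 0"
        using c m by (intro LIMSEQ_realpow_zero) auto
      then have "((\<lambda>n. (cmod c / m) ^ n) \<circ> (\<lambda>n. 2 ^ n)) \<longlonglongrightarrow> 0"
        by (rule LIMSEQ_subseq_LIMSEQ) (auto simp: strict_mono_def)
      then have "(\<lambda>n. m * (1 + (cmod c / m) ^ (2 ^ n))) \<longlonglongrightarrow> m * (1 + 0)"
        unfolding o_def by (intro tendsto_intros)
      then have "f (l + c) \<le> m" using bound by (auto intro: LIMSEQ_le_const)
      then show ?thesis using min[of "l + c"] by simp
    qed
    \<comment> \<open>A point at distance at most \<open>n * (m / 2)\<close> from \<open>l0\<close>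
      is reached in n equal steps of length at most \<open>m / 2\<close>, and \<open>step\<close>
      allows any length below m.\<close>
    have all: "f l = m" if "cmod (l - l0) \<le> real n * (m / 2)" for l n
      using that
    proof (induction n arbitrary: l)
      case 0 then show ?case by (simp add: m_def)
    next
      case (Suc n)
      define t where "t = real n / real (Suc n)"
      have t: "0 \<le> t" "1 - t = 1 / real (Suc n)" "t * real (Suc n) = real n"
        by (auto simp: t_def field_simps)
      define l' where "l' = l0 + of_real t * (l - l0)"
      have "cmod (l' - l0) = t * cmod (l - l0)"
        using t(1) by (simp add: l'_def norm_mult)
      also have "\<dots> \<le> t * (real (Suc n) * (m / 2))"
        using Suc.prems t(1) by (intro mult_left_mono) auto
      also have "\<dots> = real n * (m / 2)"
        unfolding mult.assoc[symmetric] t(3) ..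
      finally have "f l' = m" by (intro Suc.IH)
      moreover have "l - l' = of_real (1 - t) * (l - l0)"
        by (simp add: l'_def algebra_simps)
      then have "cmod (l - l') = cmod (l - l0) / real (Suc n)"
        unfolding t(2) by (simp add: norm_mult norm_divide del: of_nat_Suc)
      then have "cmod (l - l') \<le> m / 2"
        using divide_right_mono[OF Suc.prems, of "real (Suc n)"] by (simp del: of_nat_Suc)
      then have "cmod (l - l') < m" using m by simp
      ultimately show ?case using step[of l' "l - l'"] by simp
    qed
    \<comment> \<open>Chosen so far out that \<open>lower\<close> gives
      \<open>f l \<ge> cmod l0 + m + 1\<close>, which exceeds m.\<close>
    define l where "l = complex_of_real (cmod l0 + p x + m + 1)"
    obtain n where n: "cmod (l - l0) / (m / 2) \<le> real n" using real_arch_simple by blast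
    then have "f l = m" using m by (intro all[of l n]) (simp add: field_simps)
    moreover have "cmod l = cmod l0 + p x + m + 1" using x m unfolding l_def by (simp only: norm_of_real) simp
    ultimately show False using lower[of l] norm_ge_zero[of l0] by linarith
  qed
  then show thesis using that by (simp add: m_def f_def)
qed

text \<open>Modulo elements of seminorm 0, every x is a scalar multiple of \<open>\<one>\<close>;
  this scalar is the value of the character. Since it is unique, each algebraic law is proved by
  exhibiting a scalar that leaves a remainder of seminorm 0.\<close>

lemma multiplicative_character:
  assumes one: "p \<one> = 1" and mult: "\<And>x y. x \<in> carrier A \<Longrightarrow> y \<in> carrier A \<Longrightarrow> p (x \<otimes> y) = p x * p y"
  obtains w where "w \<in> characters A p" "\<And>x. x \<in> carrier A \<Longrightarrow> cmod (w x) = p x"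
proof -
  define w where "w x = (SOME l. p (x \<ominus> l \<odot> \<one>) = 0)" for x
  have w: "p (x \<ominus> w x \<odot> \<one>) = 0" if "x \<in> carrier A" for x
    unfolding w_def by (rule someI_ex) (use exists_zero_scalar[OF one mult that] in blast)
  have wI: "w x = l" if "x \<in> carrier A" "p (x \<ominus> l \<odot> \<one>) = 0" for x l
    using zero_scalar_unique[OF one that(1) w[OF that(1)] that(2)] .
  have norm: "cmod (w x) = p x" if "x \<in> carrier A" for x
    using reverse_triangle[of x "w x \<odot> \<one>"] w[OF that] that by (simp add: scale one)
  have "w \<in> characters A p"
    unfolding characters_def bounded_functionals_def
  proof (intro CollectI conjI ballI allI)
    fix x assume x: "x \<in> carrier A"
    show "cmod (w x) \<le> p x" using norm[OF x] by simp
    show "w (c \<odot> x) = c * w x" for c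
    proof (rule wI)
      have "c \<odot> x \<ominus> (c * w x) \<odot> \<one> = c \<odot> (x \<ominus> w x \<odot> \<one>)"
        using x by (simp add: scale_diff_right scale_scale)
      then show "p (c \<odot> x \<ominus> (c * w x) \<odot> \<one>) = 0" using x w[OF x] by (simp add: scale)
    qed (use x in simp)
    show "w (star A x) = cnj (w x)"
      using x w[OF x] star_eq[of "x \<ominus> w x \<odot> \<one>"]
      by (intro wI) (auto simp: star_closed star_diff star_smult)
    fix y assume y: "y \<in> carrier A"
    have "p ((x \<oplus> y) \<ominus> (w x + w y) \<odot> \<one>) \<le> 0"
      using x y w triangle[of "x \<ominus> w x \<odot> \<one>" "y \<ominus> w y \<odot> \<one>"]
      by (simp add: scale_add_left add_diff_add)
    moreover have "0 \<le> p ((x \<oplus> y) \<ominus> (w x + w y) \<odot> \<one>)" using x y by simp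
    ultimately show "w (x \<oplus> y) = w x + w y" using x y by (intro wI) auto
    have "p (x \<otimes> y \<ominus> (w x * w y) \<odot> \<one>)
        \<le> p (x \<otimes> (y \<ominus> w y \<odot> \<one>)) + p ((x \<ominus> w x \<odot> \<one>) \<otimes> (w y \<odot> \<one>))"
      unfolding scalar_mult_scalar[symmetric] using x y by (subst mult_diff_mult) (auto intro: triangle)
    also have "\<dots> = 0" using x y w by (simp add: mult)
    finally show "w (x \<otimes> y) = w x * w y" using x y by (intro wI) (auto intro: antisym)
  qed
  with norm show thesis by (rule that[rotated])
qed

text \<open>The multiplicative minorant is available for self-adjoint elements, hence it is built
  for \<open>x \<otimes> star A x\<close>. A character takes there the squared modulus of its value
  at x, which matches the C*-identity.\<close>

theorem character_attains:
  assumes x: "x \<in> carrier A"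
  obtains w where "w \<in> characters A p" "cmod (w x) = p x"
proof (cases "p x = 0")
  case True
  have "(\<lambda>_. 0) \<in> characters A p" by (auto simp: characters_def bounded_functionals_def)
  then show thesis using True by (intro that) auto
next
  case False
  define h where "h = x \<otimes> star A x"
  have h: "h \<in> carrier A" "star A h = h" "p h = (p x)\<^sup>2" "p h > 0"
    using x False by (auto simp: h_def star_closed star_mult_star cstar)
  obtain q where q: "cstar_seminorm A q" "\<And>x. x \<in> carrier A \<Longrightarrow> q x \<le> p x" "q h = p h" "q \<one> = 1"
    "\<And>x y. x \<in> carrier A \<Longrightarrow> y \<in> carrier A \<Longrightarrow> q (x \<otimes> y) = q x * q y"
    using exists_multiplicative_minorant[OF h(1,2,4)] by blast
  interpret q: cstar_seminormed A q by unfold_locales (rule q)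
  obtain w where w: "w \<in> characters A q" "\<And>x. x \<in> carrier A \<Longrightarrow> cmod (w x) = q x"
    using q.multiplicative_character[OF q(4,5)] by blast
  have wp: "w \<in> characters A p"
    using w(1) q(2) by (auto simp: characters_def bounded_functionals_def intro: order_trans)
  have "(cmod (w x))\<^sup>2 = cmod (w h)"
    using w(1) x by (simp add: characters_def h_def norm_mult star_closed power2_eq_square)
  also have "\<dots> = (p x)\<^sup>2" using w(2)[OF h(1)] q(3) h(3) by simp
  finally have "cmod (w x) = p x" using x by simp
  with wp show thesis by (rule that)
qed

end

section \<open>Topologies defined by \<open>C\<^sup>*\<close>-seminorms\<close>

context star_algebra begin

lemma topspace_seminorm_topology [simp]: "topspace (seminorm_topology A P) = carrier A"
  by (auto simp: seminorm_topology_def topology_generated_by_topspace)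

lemma openin_seminorm_ball:
  "p \<in> P \<Longrightarrow> x \<in> carrier A \<Longrightarrow> 0 < e \<Longrightarrow>
     openin (seminorm_topology A P) {y \<in> carrier A. p (y \<ominus> x) < e}"
  unfolding seminorm_topology_def by (intro topology_generated_by_Basis) blast

lemma ball_subset_ball:
  assumes "seminorm A p" "x \<in> carrier A" "y \<in> carrier A"
  shows "{z \<in> carrier A. p (z \<ominus> y) < e - p (y \<ominus> x)} \<subseteq> {z \<in> carrier A. p (z \<ominus> x) < e}"
proof -
  interpret seminormed A p by unfold_locales (rule assms(1))
  show ?thesis
  proof clarify
    fix z assume "z \<in> carrier A" "p (z \<ominus> y) < e - p (y \<ominus> x)"
    then show "p (z \<ominus> x) < e" using diff_triangle[of z y x] assms by simp
  qed
qed

text \<open>Directedness lets one seminorm dominate the two that occur in an intersection;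
  nonemptiness, which is part of it, provides a ball inside the carrier.\<close>

lemma openin_seminorm_topology_iff:
  assumes sn: "\<And>p. p \<in> P \<Longrightarrow> seminorm A p" and dir: "directed_upward A P"
  shows "openin (seminorm_topology A P) U \<longleftrightarrow>
    U \<subseteq> carrier A \<and> (\<forall>x\<in>U. \<exists>p\<in>P. \<exists>e>0. {y \<in> carrier A. p (y \<ominus> x) < e} \<subseteq> U)"
    (is "_ \<longleftrightarrow> ?R U")
proof
  assume "openin (seminorm_topology A P) U"
  then have "generate_topology_on (insert (carrier A)
      {{y \<in> carrier A. p (y \<ominus> x) < e} | p x e. p \<in> P \<and> x \<in> carrier A \<and> 0 < e}) U"
    by (simp add: seminorm_topology_def openin_topology_generated_by_iff)
  then show "?R U"
  proof induction
    case Empty then show ?case by simp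
  next
    case (Int a b)
    have "\<exists>r\<in>P. \<exists>g>0. {y \<in> carrier A. r (y \<ominus> x) < g} \<subseteq> a \<inter> b" if x: "x \<in> a \<inter> b" for x
    proof -
      have xc: "x \<in> carrier A" using Int x by auto
      obtain p e where p: "p \<in> P" "e > 0" "{y \<in> carrier A. p (y \<ominus> x) < e} \<subseteq> a" using Int x by blast
      obtain q f where q: "q \<in> P" "f > 0" "{y \<in> carrier A. q (y \<ominus> x) < f} \<subseteq> b" using Int x by blast
      obtain r where r: "r \<in> P" "\<And>x. x \<in> carrier A \<Longrightarrow> p x \<le> r x \<and> q x \<le> r x"
        using dir[unfolded directed_upward_def, THEN conjunct2, rule_format, OF p(1) q(1)] by blast
      have "{y \<in> carrier A. r (y \<ominus> x) < min e f} \<subseteq> a \<inter> b"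
      proof
        fix y assume y: "y \<in> {y \<in> carrier A. r (y \<ominus> x) < min e f}"
        then have "p (y \<ominus> x) < e" "q (y \<ominus> x) < f" using r(2)[of "y \<ominus> x"] xc by auto
        then show "y \<in> a \<inter> b" using y p(3) q(3) by auto
      qed
      then show ?thesis using r(1) p(2) q(2) by (intro bexI[of _ r] exI[of _ "min e f"]) auto
    qed
    then show ?case using Int by auto
  next
    case (UN K)
    show ?case
    proof (intro conjI ballI)
      show "\<Union>K \<subseteq> carrier A" using UN by blast
      fix x assume "x \<in> \<Union>K"
      then obtain k where k: "k \<in> K" "x \<in> k" by blast
      then obtain p e where "p \<in> P" "e > 0" "{y \<in> carrier A. p (y \<ominus> x) < e} \<subseteq> k" using UN by blast
      then show "\<exists>p\<in>P. \<exists>e>0. {y \<in> carrier A. p (y \<ominus> x) < e} \<subseteq> \<Union>K" using k by blast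
    qed
  next
    case (Basis s)
    then consider "s = carrier A"
      | p x e where "s = {y \<in> carrier A. p (y \<ominus> x) < e}" "p \<in> P" "x \<in> carrier A" "0 < e" by blast
    then show ?case
    proof cases
      case 1
      obtain p where "p \<in> P" using dir by (auto simp: directed_upward_def)
      then show ?thesis using 1 by (auto intro!: bexI[of _ p] exI[of _ "1::real"])
    next
      case 2
      have "\<exists>f>0. {z \<in> carrier A. p (z \<ominus> y) < f} \<subseteq> s" if "y \<in> s" for y
        using ball_subset_ball[OF sn[OF 2(2)] 2(3), of y e] that 2 by (intro exI[of _ "e - p (y \<ominus> x)"]) auto
      then show ?thesis using 2 by blast
    qed
  qed
next
  assume R: "?R U"
  show "openin (seminorm_topology A P) U"
  proof (subst openin_subopen, intro ballI)
    fix x assume x: "x \<in> U"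
    then obtain p e where p: "p \<in> P" "e > 0" "{y \<in> carrier A. p (y \<ominus> x) < e} \<subseteq> U" using R by blast
    interpret seminormed A p by unfold_locales (rule sn[OF p(1)])
    have xc: "x \<in> carrier A" using R x by auto
    then have "x \<in> {y \<in> carrier A. p (y \<ominus> x) < e}" using p(2) by (simp add: diff_self)
    then show "\<exists>T. openin (seminorm_topology A P) T \<and> x \<in> T \<and> T \<subseteq> U"
      using openin_seminorm_ball[OF p(1) xc p(2)] p(3) by blast
  qed
qed

text \<open>The comparison is made on the subbase and so applies to families that are not known to
  be directed, such as that of all \<open>\<pi>\<close>-continuous C*-seminorms.\<close>

lemma seminorm_topology_mono:
  assumes P: "\<And>p. p \<in> P \<Longrightarrow> seminorm A p" and Q: "\<And>q. q \<in> Q \<Longrightarrow> seminorm A q"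
    and le: "\<And>p. p \<in> P \<Longrightarrow> \<exists>q\<in>Q. \<exists>k. \<forall>x\<in>carrier A. p x \<le> k * q x"
    and U: "openin (seminorm_topology A P) U"
  shows "openin (seminorm_topology A Q) U"
proof -
  have "openin (seminorm_topology A Q) s"
    if "s \<in> insert (carrier A) {{y \<in> carrier A. p (y \<ominus> x) < e} | p x e. p \<in> P \<and> x \<in> carrier A \<and> 0 < e}" for s
  proof -
    from that consider "s = carrier A"
      | p x e where "s = {y \<in> carrier A. p (y \<ominus> x) < e}" "p \<in> P" "x \<in> carrier A" "0 < e" by blast
    then show ?thesis
    proof cases
      case 1
      then show ?thesis using openin_topspace[of "seminorm_topology A Q"] by simp
    next
      case 2
      obtain q k where q: "q \<in> Q" and le: "\<And>x. x \<in> carrier A \<Longrightarrow> p x \<le> k * q x" using le[OF 2(2)] by blast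
      interpret p: seminormed A p by unfold_locales (rule P[OF 2(2)])
      interpret q: seminormed A q by unfold_locales (rule Q[OF q])
      define k' where "k' = max k 1"
      have k': "k' > 0" "\<And>x. x \<in> carrier A \<Longrightarrow> p x \<le> k' * q x"
        using le q.le_max_scaled by (auto simp: k'_def)
      show ?thesis
      proof (subst openin_subopen, intro ballI)
        fix y assume y: "y \<in> s"
        let ?d = "e - p (y \<ominus> x)"
        have yc: "y \<in> carrier A" and d: "?d > 0" using y 2 by auto
        let ?T = "{z \<in> carrier A. q (z \<ominus> y) < ?d / k'}"
        have "?T \<subseteq> {z \<in> carrier A. p (z \<ominus> y) < ?d}"
        proof clarify
          fix z assume z: "z \<in> carrier A" "q (z \<ominus> y) < ?d / k'"
          then have "p (z \<ominus> y) \<le> k' * q (z \<ominus> y)" using k' yc by simp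
          also have "\<dots> < ?d" using z k'(1) by (simp add: field_simps)
          finally show "p (z \<ominus> y) < ?d" .
        qed
        then have "?T \<subseteq> s" using ball_subset_ball[OF P[OF 2(2)] 2(3) yc, of e] 2(1) by auto
        moreover have "y \<in> ?T" using yc d k' by (simp add: diff_self)
        ultimately show "\<exists>T. openin (seminorm_topology A Q) T \<and> y \<in> T \<and> T \<subseteq> s"
          using openin_seminorm_ball[OF q yc, of "?d / k'"] d k'(1) by (intro exI[of _ ?T]) simp
      qed
    qed
  qed
  moreover have "generate_topology_on (insert (carrier A)
      {{y \<in> carrier A. p (y \<ominus> x) < e} | p x e. p \<in> P \<and> x \<in> carrier A \<and> 0 < e}) U"
    using U by (simp add: seminorm_topology_def openin_topology_generated_by_iff)
  ultimately show ?thesis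
    using generate_topology_on_coarsest[OF istopology_openin] by blast
qed

lemma seminorm_topology_subset:
  assumes Q: "\<And>q. q \<in> Q \<Longrightarrow> seminorm A q" and PQ: "P \<subseteq> Q" and U: "openin (seminorm_topology A P) U"
  shows "openin (seminorm_topology A Q) U"
proof (rule seminorm_topology_mono[OF _ Q _ U])
  show "seminorm A p" if "p \<in> P" for p using Q PQ that by blast
  show "\<exists>q\<in>Q. \<exists>k. \<forall>x\<in>carrier A. p x \<le> k * q x" if "p \<in> P" for p
    using PQ that by (intro bexI[of _ p] exI[of _ 1]) auto
qed

lemma continuous_map_seminorm:
  assumes "seminorm A p" "p \<in> P"
  shows "continuous_map (seminorm_topology A P) euclideanreal p"
proof -
  interpret seminormed A p by unfold_locales (rule assms(1))
  show ?thesis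
    unfolding continuous_map_def
  proof (intro conjI allI impI)
    fix U :: "real set" assume U: "openin euclidean U"
    show "openin (seminorm_topology A P) {x \<in> topspace (seminorm_topology A P). p x \<in> U}"
    proof (subst openin_subopen, intro ballI)
      fix x assume "x \<in> {x \<in> topspace (seminorm_topology A P). p x \<in> U}"
      then have x: "x \<in> carrier A" "p x \<in> U" by auto
      then obtain e where e: "e > 0" "\<And>t. dist t (p x) < e \<Longrightarrow> t \<in> U"
        using U by (auto simp: open_dist)
      have "{y \<in> carrier A. p (y \<ominus> x) < e} \<subseteq> {x \<in> topspace (seminorm_topology A P). p x \<in> U}"
        using x(1) e(2) reverse_triangle by (auto simp: dist_real_def intro: le_less_trans)
      then show "\<exists>T. openin (seminorm_topology A P) T \<and> x \<in> T \<and>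
          T \<subseteq> {x \<in> topspace (seminorm_topology A P). p x \<in> U}"
        using openin_seminorm_ball[OF assms(2) x(1) e(1)] x(1) e(1)
        by (intro exI[of _ "{y \<in> carrier A. p (y \<ominus> x) < e}"]) (simp add: diff_self)
    qed
  qed auto
qed

end


text \<open>Maxima rather than sums make the family directed, because a sum of C*-seminorms in
  general violates the C*-identity. The zero seminorm makes the closure of the empty family
  nonempty.\<close>

inductive_set max_closure :: "('a \<Rightarrow> real) set \<Rightarrow> ('a \<Rightarrow> real) set" for P where
  max_closure_zero: "(\<lambda>_. 0) \<in> max_closure P"
| max_closure_base: "p \<in> P \<Longrightarrow> p \<in> max_closure P"
| max_closure_max: "p \<in> max_closure P \<Longrightarrow> q \<in> max_closure P \<Longrightarrow> (\<lambda>x. max (p x) (q x)) \<in> max_closure P"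

lemma (in star_algebra) cstar_seminorm_zero: "cstar_seminorm A (\<lambda>_. 0)"
  by (auto simp: cstar_seminorm_def seminorm_def)

lemma (in star_algebra) cstar_seminorm_max:
  assumes "cstar_seminorm A p" "cstar_seminorm A q"
  shows "cstar_seminorm A (\<lambda>x. max (p x) (q x))"
proof -
  interpret p: cstar_seminormed A p by unfold_locales (rule assms)
  interpret q: cstar_seminormed A q by unfold_locales (rule assms)
  show ?thesis
    unfolding cstar_seminorm_def seminorm_def
  proof (intro conjI ballI allI)
    fix x assume x: "x \<in> carrier A"
    show "0 \<le> max (p x) (q x)" using x by (simp add: le_max_iff_disj)
    show "max (p (c \<odot> x)) (q (c \<odot> x)) = cmod c * max (p x) (q x)" for c
      using x by (simp add: p.scale q.scale max_mult_distrib_left)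
    show "max (p (x \<otimes> star A x)) (q (x \<otimes> star A x)) = (max (p x) (q x))\<^sup>2"
    proof (cases "p x \<le> q x")
      case True
      then show ?thesis using x by (simp add: p.cstar q.cstar max_absorb2 power_mono)
    next
      case False
      then show ?thesis using x by (simp add: p.cstar q.cstar max_absorb1 power_mono)
    qed
    fix y assume y: "y \<in> carrier A"
    show "max (p (x \<oplus> y)) (q (x \<oplus> y)) \<le> max (p x) (q x) + max (p y) (q y)"
      using p.triangle[OF x y] q.triangle[OF x y] by (auto simp: max_def)
  qed
qed

lemma (in star_algebra) cstar_seminorm_max_closure:
  assumes "\<And>p. p \<in> P \<Longrightarrow> cstar_seminorm A p" "p \<in> max_closure P"
  shows "cstar_seminorm A p"
  using assms(2) by induction (auto intro: assms(1) cstar_seminorm_zero cstar_seminorm_max)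

lemma (in star_algebra) seminorm_topology_max_closure:
  assumes "\<And>p. p \<in> P \<Longrightarrow> cstar_seminorm A p"
  shows "seminorm_topology A (max_closure P) = seminorm_topology A P"
proof (rule topology_eq[THEN iffD2], intro allI iffI)
  have sn: "seminorm A p" if "p \<in> max_closure P" for p
    using cstar_seminorm_max_closure[OF assms that] by (simp add: cstar_seminorm_def)
  fix U
  show "openin (seminorm_topology A P) U \<Longrightarrow> openin (seminorm_topology A (max_closure P)) U"
    by (rule seminorm_topology_subset[OF sn]) (auto intro: max_closure_base)
  have open_ball: "openin (seminorm_topology A P) {y \<in> carrier A. p (y \<ominus> x) < e}"
    if "p \<in> max_closure P" "x \<in> carrier A" "0 < e" for p x e
    using that(1)
  proof induction
    case max_closure_zero
    then show ?case using that(3) openin_topspace[of "seminorm_topology A P"] by simp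
  next
    case (max_closure_base p)
    then show ?case using openin_seminorm_ball that by blast
  next
    case (max_closure_max p q)
    have "{y \<in> carrier A. max (p (y \<ominus> x)) (q (y \<ominus> x)) < e}
        = {y \<in> carrier A. p (y \<ominus> x) < e} \<inter> {y \<in> carrier A. q (y \<ominus> x) < e}" by auto
    then show ?case using max_closure_max by (simp add: openin_Int)
  qed
  assume "openin (seminorm_topology A (max_closure P)) U"
  then have "generate_topology_on (insert (carrier A) {{y \<in> carrier A. p (y \<ominus> x) < e} | p x e.
      p \<in> max_closure P \<and> x \<in> carrier A \<and> 0 < e}) U"
    by (simp add: seminorm_topology_def openin_topology_generated_by_iff)
  moreover have "openin (seminorm_topology A P) s" if "s \<in> insert (carrier A)
      {{y \<in> carrier A. p (y \<ominus> x) < e} | p x e. p \<in> max_closure P \<and> x \<in> carrier A \<and> 0 < e}" for s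
    using that open_ball openin_topspace[of "seminorm_topology A P"] by auto
  ultimately show "openin (seminorm_topology A P) U"
    using generate_topology_on_coarsest[OF istopology_openin] by blast
qed


text \<open>Carries an explicit directed defining family, so that openness, limits and Cauchy
  filters become estimates for one seminorm at a time. The completion and the injective tensor
  product are shown to be further instances.\<close>

locale cstar_topology = star_algebra A for A :: "('a, 'm) top_star_alg_scheme" (structure) +
  fixes P :: "('a \<Rightarrow> real) set"
  assumes P_cstar: "p \<in> P \<Longrightarrow> cstar_seminorm A p"
    and P_directed: "directed_upward A P"
    and topol: "topol A = seminorm_topology A P"

lemma LC_star_algebra_cstar_topology:
  assumes "LC_star_algebra A"
  obtains P where "cstar_topology A P"
proof -
  obtain P where P: "\<forall>p\<in>P. cstar_seminorm A p" "topol A = seminorm_topology A P" and "star_algebra A"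
    using assms by (auto simp: LC_star_algebra_def)
  interpret star_algebra A by fact
  have "cstar_topology A (max_closure P)"
  proof (intro cstar_topology.intro cstar_topology_axioms.intro)
    show "star_algebra A" by fact
    show "cstar_seminorm A p" if "p \<in> max_closure P" for p
      using cstar_seminorm_max_closure[OF _ that] P(1) by blast
    show "topol A = seminorm_topology A (max_closure P)"
      using seminorm_topology_max_closure P by simp
    show "directed_upward A (max_closure P)"
      unfolding directed_upward_def
    proof (intro conjI ballI)
      show "max_closure P \<noteq> {}" using max_closure_zero by blast
      fix p q assume "p \<in> max_closure P" "q \<in> max_closure P"
      then show "\<exists>r\<in>max_closure P. \<forall>x\<in>carrier A. p x \<le> r x \<and> q x \<le> r x"
        by (intro bexI[of _ "\<lambda>x. max (p x) (q x)"]) (auto intro: max_closure_max)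
    qed
  qed
  then show thesis by (rule that)
qed

section \<open>Openness, limits and boundedness in terms of a directed family\<close>

context cstar_topology begin

lemma P_cstar_seminormed: "p \<in> P \<Longrightarrow> cstar_seminormed A p"
  by (intro cstar_seminormedI P_cstar)

lemma P_seminorm: "p \<in> P \<Longrightarrow> seminorm A p"
  using P_cstar by (simp add: cstar_seminorm_def)

lemma P_seminormed: "p \<in> P \<Longrightarrow> seminormed A p"
  by (intro seminormedI P_seminorm)

lemma LC: "LC_star_algebra A"
  using P_cstar topol star_algebra_axioms by (auto simp: LC_star_algebra_def)

lemma P_dominates:
  assumes "p \<in> P" "q \<in> P"
  obtains r where "r \<in> P" "\<And>x. x \<in> carrier A \<Longrightarrow> p x \<le> r x" "\<And>x. x \<in> carrier A \<Longrightarrow> q x \<le> r x"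
  using P_directed[unfolded directed_upward_def, THEN conjunct2, rule_format, OF assms] by blast

lemma P_nonempty: "P \<noteq> {}"
  using P_directed by (simp add: directed_upward_def)

lemma topspace_topol [simp]: "topspace (topol A) = carrier A"
  by (simp add: topol)

lemma openin_iff:
  "openin (topol A) U \<longleftrightarrow>
    U \<subseteq> carrier A \<and> (\<forall>x\<in>U. \<exists>p\<in>P. \<exists>e>0. {y \<in> carrier A. p (y \<ominus> x) < e} \<subseteq> U)"
  unfolding topol by (rule openin_seminorm_topology_iff[OF P_seminorm P_directed])

lemma openin_ball: "p \<in> P \<Longrightarrow> x \<in> carrier A \<Longrightarrow> 0 < e \<Longrightarrow> openin (topol A) {y \<in> carrier A. p (y \<ominus> x) < e}"
  unfolding topol by (rule openin_seminorm_ball)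

lemma limitin_iff:
  "limitin (topol A) f l F \<longleftrightarrow>
    l \<in> carrier A \<and> (\<forall>p\<in>P. \<forall>e>0. \<forall>\<^sub>F x in F. f x \<in> carrier A \<and> p (f x \<ominus> l) < e)"
proof (intro iffI conjI ballI allI impI)
  assume L: "limitin (topol A) f l F"
  then show l: "l \<in> carrier A" by (simp add: limitin_def)
  fix p and e :: real assume p: "p \<in> P" and e: "e > 0"
  interpret seminormed A p by (rule P_seminormed[OF p])
  have "l \<in> {y \<in> carrier A. p (y \<ominus> l) < e}" using l e by (simp add: diff_self)
  then have "\<forall>\<^sub>F x in F. f x \<in> {y \<in> carrier A. p (y \<ominus> l) < e}"
    using L openin_ball[OF p l e] unfolding limitin_def by blast
  then show "\<forall>\<^sub>F x in F. f x \<in> carrier A \<and> p (f x \<ominus> l) < e" by simp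
next
  assume R: "l \<in> carrier A \<and> (\<forall>p\<in>P. \<forall>e>0. \<forall>\<^sub>F x in F. f x \<in> carrier A \<and> p (f x \<ominus> l) < e)"
  show "limitin (topol A) f l F"
    unfolding limitin_def
  proof (intro conjI allI impI)
    show "l \<in> topspace (topol A)" using R by simp
    fix U assume "openin (topol A) U \<and> l \<in> U"
    then obtain p e where "p \<in> P" "e > 0" "{y \<in> carrier A. p (y \<ominus> l) < e} \<subseteq> U"
      using openin_iff by blast
    with R show "\<forall>\<^sub>F x in F. f x \<in> U" by (auto elim!: eventually_mono dest!: bspec)
  qed
qed

lemma uniformly_close_iff:
  "uniformly_close A F G \<longleftrightarrow>
    (\<forall>p\<in>P. \<forall>e>0. \<forall>\<^sub>F (x, y) in F \<times>\<^sub>F G. x \<ominus> y \<in> carrier A \<and> p (x \<ominus> y) < e)"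
proof (intro iffI ballI allI impI)
  fix p and e :: real assume L: "uniformly_close A F G" and p: "p \<in> P" and e: "e > 0"
  interpret seminormed A p by (rule P_seminormed[OF p])
  have "\<forall>\<^sub>F (x, y) in F \<times>\<^sub>F G. x \<ominus> y \<in> {y \<in> carrier A. p (y \<ominus> \<zero>) < e}"
  proof -
    have "openin (topol A) {y \<in> carrier A. p (y \<ominus> \<zero>) < e} \<and> \<zero> \<in> {y \<in> carrier A. p (y \<ominus> \<zero>) < e}"
      using openin_ball[OF p _ e, of \<zero>] e by simp
    then show ?thesis using L unfolding uniformly_close_def by blast
  qed
  then show "\<forall>\<^sub>F (x, y) in F \<times>\<^sub>F G. x \<ominus> y \<in> carrier A \<and> p (x \<ominus> y) < e"
    by (rule eventually_mono) auto
next
  assume R: "\<forall>p\<in>P. \<forall>e>0. \<forall>\<^sub>F (x, y) in F \<times>\<^sub>F G. x \<ominus> y \<in> carrier A \<and> p (x \<ominus> y) < e"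
  show "uniformly_close A F G"
    unfolding uniformly_close_def
  proof (intro allI impI)
    fix U assume "openin (topol A) U \<and> \<zero> \<in> U"
    then obtain p e where pe: "p \<in> P" "e > 0" "{y \<in> carrier A. p (y \<ominus> \<zero>) < e} \<subseteq> U"
      using openin_iff by blast
    with R have "\<forall>\<^sub>F (x, y) in F \<times>\<^sub>F G. x \<ominus> y \<in> carrier A \<and> p (x \<ominus> y) < e" by blast
    then show "\<forall>\<^sub>F (x, y) in F \<times>\<^sub>F G. x \<ominus> y \<in> U"
      by (rule eventually_mono) (use pe(3) in auto)
  qed
qed

text \<open>By homogeneity, a bound on one neighbourhood of zero extends to a multiple of p on the
  whole carrier.\<close>

lemma bounded_near_zero:
  assumes s: "seminorm A s" and U: "openin (topol A) U" "\<zero> \<in> U" and sU: "\<And>x. x \<in> U \<Longrightarrow> s x < 1"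
  obtains p k where "p \<in> P" "k > 0" "\<And>x. x \<in> carrier A \<Longrightarrow> s x \<le> k * p x"
proof -
  interpret s: seminormed A s by unfold_locales (rule s)
  obtain p e where p: "p \<in> P" "e > 0" "{y \<in> carrier A. p (y \<ominus> \<zero>) < e} \<subseteq> U"
    using U openin_iff by blast
  interpret p: seminormed A p by (rule P_seminormed[OF p(1)])
  have "s x \<le> 1 / e * p x" if x: "x \<in> carrier A" for x
  proof (rule field_le_epsilon)
    fix d :: real assume d: "d > 0"
    \<comment> \<open>The summand \<open>e * d\<close> keeps the scaling factor finite when
      \<open>p x = 0\<close>; it contributes exactly d to the final estimate.\<close>
    define t where "t = e / (p x + e * d)"
    have pos: "p x + e * d > 0" using p.nonneg[OF x] p(2) d by (simp add: add_nonneg_pos)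
    then have t: "t > 0" using p(2) by (simp add: t_def)
    have cm: "cmod (complex_of_real t) = t" using t by simp
    have "t * p x < e" using pos p(2) d x by (simp add: t_def field_simps)
    then have "complex_of_real t \<odot> x \<in> U" using p(3) x cm by (auto simp: p.scale)
    then have "t * s x < 1" using sU x cm s.scale[OF x, of "complex_of_real t"] by fastforce
    then have "s x < 1 / t" using t by (simp add: field_simps)
    also have "1 / t = 1 / e * p x + d" using p(2) by (simp add: t_def field_simps)
    finally show "s x \<le> 1 / e * p x + d" by simp
  qed
  with p show thesis by (intro that[of p "1 / e"]) auto
qed

lemma continuous_seminorm_bounded:
  assumes s: "seminorm A s" and cont: "continuous_map (topol A) euclideanreal s"
  obtains p k where "p \<in> P" "k > 0" "\<And>x. x \<in> carrier A \<Longrightarrow> s x \<le> k * p x"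
proof -
  interpret s: seminormed A s by unfold_locales (rule s)
  have "openin (topol A) {x \<in> topspace (topol A). s x \<in> {..<1}}"
    using openin_continuous_map_preimage[OF cont, of "{..<1}"] by simp
  then show thesis by (rule bounded_near_zero[OF s]) (auto intro: that)
qed

lemma Hausdorff_separated:
  assumes "Hausdorff_space (topol A)" "x \<in> carrier A" "\<And>p. p \<in> P \<Longrightarrow> p x = 0"
  shows "x = \<zero>"
proof (rule ccontr)
  assume "x \<noteq> \<zero>"
  then obtain U V where UV: "openin (topol A) U" "openin (topol A) V" "x \<in> U" "\<zero> \<in> V" "disjnt U V"
    using assms(1,2) unfolding Hausdorff_space_def by (metis M.zero_closed topspace_topol)
  then obtain p e where p: "p \<in> P" "e > 0" "{y \<in> carrier A. p (y \<ominus> \<zero>) < e} \<subseteq> V"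
    using openin_iff by blast
  moreover have "p x = 0" using assms(3) p(1) .
  ultimately have "x \<in> V" using assms(2) by auto
  then show False using UV by (auto simp: disjnt_iff)
qed

lemma separated_Hausdorff:
  assumes "\<And>x. x \<in> carrier A \<Longrightarrow> (\<And>p. p \<in> P \<Longrightarrow> p x = 0) \<Longrightarrow> x = \<zero>"
  shows "Hausdorff_space (topol A)"
  unfolding Hausdorff_space_def
proof (intro allI impI)
  fix x y assume xy: "x \<in> topspace (topol A) \<and> y \<in> topspace (topol A) \<and> x \<noteq> y"
  then obtain p where p: "p \<in> P" "p (x \<ominus> y) \<noteq> 0"
    using assms[of "x \<ominus> y"] diff_eq_zeroD[of x y] by auto
  interpret seminormed A p by (rule P_seminormed[OF p(1)])
  define e where "e = p (x \<ominus> y) / 2"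
  have "0 \<le> p (x \<ominus> y)" using xy by simp
  then have e: "e > 0" using p(2) by (simp add: e_def)
  let ?B = "\<lambda>x. {z \<in> carrier A. p (z \<ominus> x) < e}"
  have "disjnt (?B x) (?B y)"
    unfolding disjnt_iff
  proof clarify
    fix z assume z: "z \<in> carrier A" "p (z \<ominus> x) < e" "p (z \<ominus> y) < e"
    then have "p (x \<ominus> y) < e + e"
      using diff_triangle[of x z y] diff_commute[of x z] xy by simp
    then show False by (simp add: e_def)
  qed
  moreover have "x \<in> ?B x" "y \<in> ?B y" using xy e by (auto simp: diff_self)
  ultimately show "\<exists>U V. openin (topol A) U \<and> openin (topol A) V \<and> x \<in> U \<and> y \<in> V \<and> disjnt U V"
    using openin_ball[OF p(1) _ e, of x] openin_ball[OF p(1) _ e, of y] xy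
    by (intro exI[of _ "?B x"] exI[of _ "?B y"]) simp
qed

end

section \<open>Morphisms and continuous linear maps\<close>

lemma star_morphismsD:
  assumes "u \<in> star_morphisms A B"
  shows "\<And>x. x \<in> carrier A \<Longrightarrow> u x \<in> carrier B"
    and "\<And>x y. \<lbrakk>x \<in> carrier A; y \<in> carrier A\<rbrakk> \<Longrightarrow> u (x \<oplus>\<^bsub>A\<^esub> y) = u x \<oplus>\<^bsub>B\<^esub> u y"
    and "\<And>x y. \<lbrakk>x \<in> carrier A; y \<in> carrier A\<rbrakk> \<Longrightarrow> u (x \<otimes>\<^bsub>A\<^esub> y) = u x \<otimes>\<^bsub>B\<^esub> u y"
    and "u \<one>\<^bsub>A\<^esub> = \<one>\<^bsub>B\<^esub>"
    and "\<And>c x. x \<in> carrier A \<Longrightarrow> u (c \<odot>\<^bsub>A\<^esub> x) = c \<odot>\<^bsub>B\<^esub> u x"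
    and "\<And>x. x \<in> carrier A \<Longrightarrow> u (star A x) = star B (u x)"
    and "continuous_map (topol A) (topol B) u"
  using assms by (auto simp: star_morphisms_def ring_hom_def)

lemma star_morphismsI:
  assumes "\<And>x. x \<in> carrier A \<Longrightarrow> u x \<in> carrier B"
    and "\<And>x y. \<lbrakk>x \<in> carrier A; y \<in> carrier A\<rbrakk> \<Longrightarrow> u (x \<oplus>\<^bsub>A\<^esub> y) = u x \<oplus>\<^bsub>B\<^esub> u y"
    and "\<And>x y. \<lbrakk>x \<in> carrier A; y \<in> carrier A\<rbrakk> \<Longrightarrow> u (x \<otimes>\<^bsub>A\<^esub> y) = u x \<otimes>\<^bsub>B\<^esub> u y"
    and "u \<one>\<^bsub>A\<^esub> = \<one>\<^bsub>B\<^esub>"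
    and "\<And>c x. x \<in> carrier A \<Longrightarrow> u (c \<odot>\<^bsub>A\<^esub> x) = c \<odot>\<^bsub>B\<^esub> u x"
    and "\<And>x. x \<in> carrier A \<Longrightarrow> u (star A x) = star B (u x)"
    and "continuous_map (topol A) (topol B) u"
  shows "u \<in> star_morphisms A B"
  using assms by (auto simp: star_morphisms_def intro!: ring_hom_memI)

locale cstar_linear_map = A: cstar_topology A P + B: cstar_topology B Q
  for A :: "('a, 'm) top_star_alg_scheme" (structure) and P
    and B :: "('b, 'n) top_star_alg_scheme" (structure) and Q +
  fixes u :: "'a \<Rightarrow> 'b"
  assumes u_closed: "x \<in> carrier A \<Longrightarrow> u x \<in> carrier B"
    and u_add: "x \<in> carrier A \<Longrightarrow> y \<in> carrier A \<Longrightarrow> u (x \<oplus>\<^bsub>A\<^esub> y) = u x \<oplus>\<^bsub>B\<^esub> u y"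
    and u_scale: "x \<in> carrier A \<Longrightarrow> u (c \<odot>\<^bsub>A\<^esub> x) = c \<odot>\<^bsub>B\<^esub> u x"
begin

lemma u_zero: "u \<zero>\<^bsub>A\<^esub> = \<zero>\<^bsub>B\<^esub>"
  using u_scale[of "\<zero>\<^bsub>A\<^esub>" 0] u_closed[of "\<zero>\<^bsub>A\<^esub>"] by simp

lemma u_diff: "x \<in> carrier A \<Longrightarrow> y \<in> carrier A \<Longrightarrow> u (x \<ominus>\<^bsub>A\<^esub> y) = u x \<ominus>\<^bsub>B\<^esub> u y"
  by (simp add: A.M.minus_eq B.M.minus_eq u_add A.minus_eq_scale B.minus_eq_scale u_scale u_closed)

lemma continuousI:
  assumes bd: "\<And>q. q \<in> Q \<Longrightarrow> \<exists>p\<in>P. \<exists>k. \<forall>x\<in>carrier A. q (u x) \<le> k * p x"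
  shows "continuous_map (topol A) (topol B) u"
  unfolding continuous_map_def
proof (intro conjI allI impI)
  show "u \<in> topspace (topol A) \<rightarrow> topspace (topol B)" using u_closed by simp
  fix V assume V: "openin (topol B) V"
  show "openin (topol A) {x \<in> topspace (topol A). u x \<in> V}"
    unfolding A.openin_iff
  proof (intro conjI ballI)
    fix x assume "x \<in> {x \<in> topspace (topol A). u x \<in> V}"
    then have x: "x \<in> carrier A" "u x \<in> V" by auto
    obtain q e where q: "q \<in> Q" "e > 0" "{y \<in> carrier B. q (y \<ominus>\<^bsub>B\<^esub> u x) < e} \<subseteq> V"
      using V x(2) B.openin_iff by blast
    obtain p k where p: "p \<in> P" "\<And>x. x \<in> carrier A \<Longrightarrow> q (u x) \<le> k * p x" using bd[OF q(1)] by blast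
    interpret p: seminormed A p by (rule A.P_seminormed[OF p(1)])
    define k' where "k' = max k 1"
    have k': "k' > 0" "\<And>x. x \<in> carrier A \<Longrightarrow> q (u x) \<le> k' * p x"
      using p(2) p.le_max_scaled by (auto simp: k'_def)
    have "{y \<in> carrier A. p (y \<ominus>\<^bsub>A\<^esub> x) < e / k'} \<subseteq> {x \<in> topspace (topol A). u x \<in> V}"
    proof clarify
      fix y assume y: "y \<in> carrier A" "p (y \<ominus>\<^bsub>A\<^esub> x) < e / k'"
      have "q (u y \<ominus>\<^bsub>B\<^esub> u x) \<le> k' * p (y \<ominus>\<^bsub>A\<^esub> x)"
        using k'(2)[of "y \<ominus>\<^bsub>A\<^esub> x"] x y by (simp add: u_diff)
      also have "\<dots> < e" using y(2) k'(1) by (simp add: field_simps)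
      finally show "y \<in> topspace (topol A) \<and> u y \<in> V" using q(3) y(1) u_closed by auto
    qed
    then show "\<exists>p\<in>P. \<exists>e>0. {y \<in> carrier A. p (y \<ominus>\<^bsub>A\<^esub> x) < e} \<subseteq> {x \<in> topspace (topol A). u x \<in> V}"
      using p(1) q(2) k'(1) by (intro bexI[of _ p] exI[of _ "e / k'"]) auto
  qed simp
qed

text \<open>The pullback of q along u is a seminorm that is below 1 on a neighbourhood of zero, so
  \<open>bounded_near_zero\<close> applies to it.\<close>

lemma continuousD:
  assumes cont: "continuous_map (topol A) (topol B) u" and q: "q \<in> Q"
  obtains p k where "p \<in> P" "k > 0" "\<And>x. x \<in> carrier A \<Longrightarrow> q (u x) \<le> k * p x"
proof -
  interpret q: seminormed B q by (rule B.P_seminormed[OF q])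
  have sn: "seminorm A (\<lambda>x. q (u x))"
    unfolding seminorm_def by (auto simp: u_closed u_add u_scale q.triangle q.scale)
  have "openin (topol A) {x \<in> topspace (topol A). u x \<in> {y \<in> carrier B. q (y \<ominus>\<^bsub>B\<^esub> \<zero>\<^bsub>B\<^esub>) < 1}}"
    by (intro openin_continuous_map_preimage[OF cont] B.openin_ball q) auto
  then show thesis by (rule A.bounded_near_zero[OF sn]) (auto simp: u_zero intro: that)
qed

end

lemma star_morphism_linear_map:
  assumes "cstar_topology A P" "cstar_topology B Q" "u \<in> star_morphisms A B"
  shows "cstar_linear_map A P B Q u"
  using assms by (auto simp: cstar_linear_map_def cstar_linear_map_axioms_def star_morphismsD)

section \<open>The Hausdorff completion as a star algebra\<close>

lemma eventually_prod_filterI: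
  assumes "eventually P F" "eventually Q G" "\<And>a b. P a \<Longrightarrow> Q b \<Longrightarrow> R (a, b)"
  shows "eventually R (F \<times>\<^sub>F G)"
  using assms unfolding eventually_prod_filter by blast

context cstar_topology begin

text \<open>For a single seminorm a Cauchy filter can be approximated by a sequence; algebraic identities
  and estimates in the completion are checked along such sequences, one seminorm at a time.\<close>

definition filter_conv :: "('a \<Rightarrow> real) \<Rightarrow> (nat \<Rightarrow> 'a) \<Rightarrow> 'a filter \<Rightarrow> bool" where
  "filter_conv p x F \<longleftrightarrow> (\<forall>n. x n \<in> carrier A) \<and>
     (\<forall>e>0. \<forall>\<^sub>F n in sequentially. \<forall>\<^sub>F y in F. p (y \<ominus> x n) < e)"

lemma filter_convD:
  "filter_conv p x F \<Longrightarrow> 0 < e \<Longrightarrow> \<forall>\<^sub>F n in sequentially. \<forall>\<^sub>F y in F. p (y \<ominus> x n) < e"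
  by (simp add: filter_conv_def)

lemma uniformly_closeD:
  "uniformly_close A F G \<Longrightarrow> p \<in> P \<Longrightarrow> 0 < e \<Longrightarrow>
    \<forall>\<^sub>F (x, y) in F \<times>\<^sub>F G. x \<ominus> y \<in> carrier A \<and> p (x \<ominus> y) < e"
  unfolding uniformly_close_iff by blast

text \<open>The n-th point of the sequence is taken from a member of F whose p-diameter is less than
  \<open>1 / (n + 1)\<close>. Different seminorms may require different sequences, as the family may
  be uncountable.\<close>

lemma cauchy_filters_iff:
  "F \<in> cauchy_filters A \<longleftrightarrow> F \<noteq> bot \<and> (\<forall>\<^sub>F x in F. x \<in> carrier A) \<and>
    (\<forall>p\<in>P. \<exists>x. filter_conv p x F)"
proof
  assume F: "F \<in> cauchy_filters A"
  then have nb: "F \<noteq> bot" and ca: "\<forall>\<^sub>F x in F. x \<in> carrier A" and uc: "uniformly_close A F F"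
    by (auto simp: cauchy_filters_def)
  have "\<exists>x. filter_conv p x F" if p: "p \<in> P" for p
  proof -
    have "\<exists>a\<in>carrier A. \<forall>\<^sub>F y in F. p (y \<ominus> a) < 1 / real (Suc n)" for n
    proof -
      have "\<forall>\<^sub>F (x, y) in F \<times>\<^sub>F F. x \<ominus> y \<in> carrier A \<and> p (x \<ominus> y) < 1 / real (Suc n)"
        using uc p by (intro uniformly_closeD) simp_all
      then obtain Q where Q: "eventually Q F"
        "\<And>x y. Q x \<Longrightarrow> Q y \<Longrightarrow> x \<ominus> y \<in> carrier A \<and> p (x \<ominus> y) < 1 / real (Suc n)"
        unfolding eventually_prod_same by auto
      obtain a where a: "Q a" "a \<in> carrier A"
        using eventually_happens'[OF nb eventually_conj[OF Q(1) ca]] by auto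
      have "\<forall>\<^sub>F y in F. p (y \<ominus> a) < 1 / real (Suc n)"
        using Q(1) by (rule eventually_mono) (use Q(2) a in blast)
      with a show ?thesis by blast
    qed
    then obtain x where x: "\<And>n. x n \<in> carrier A" "\<And>n. \<forall>\<^sub>F y in F. p (y \<ominus> x n) < 1 / real (Suc n)"
      by metis
    have "filter_conv p x F"
      unfolding filter_conv_def
    proof (intro conjI allI impI x(1))
      fix e :: real assume "e > 0"
      then have "\<forall>\<^sub>F n in sequentially. 1 / real (Suc n) < e"
        using order_tendstoD(2)[OF LIMSEQ_Suc[OF lim_1_over_n]] by simp
      then show "\<forall>\<^sub>F n in sequentially. \<forall>\<^sub>F y in F. p (y \<ominus> x n) < e"
      proof (rule eventually_mono)
        fix n assume "1 / real (Suc n) < e"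
        then show "\<forall>\<^sub>F y in F. p (y \<ominus> x n) < e"
          using x(2)[of n] by (auto elim: eventually_mono)
      qed
    qed
    then show ?thesis by blast
  qed
  with nb ca show "F \<noteq> bot \<and> (\<forall>\<^sub>F x in F. x \<in> carrier A) \<and> (\<forall>p\<in>P. \<exists>x. filter_conv p x F)" by blast
next
  assume R: "F \<noteq> bot \<and> (\<forall>\<^sub>F x in F. x \<in> carrier A) \<and> (\<forall>p\<in>P. \<exists>x. filter_conv p x F)"
  have "uniformly_close A F F"
    unfolding uniformly_close_iff
  proof (intro ballI allI impI)
    fix p and e :: real assume p: "p \<in> P" and e: "e > 0"
    interpret seminormed A p by (rule P_seminormed[OF p])
    obtain x where x: "filter_conv p x F" using R p by blast
    have "\<forall>\<^sub>F n in sequentially. \<forall>\<^sub>F y in F. p (y \<ominus> x n) < e / 2"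
      using x e by (intro filter_convD) simp_all
    then obtain n where n: "\<forall>\<^sub>F y in F. p (y \<ominus> x n) < e / 2"
      using eventually_happens' sequentially_bot by blast
    have xn: "x n \<in> carrier A" using x by (simp add: filter_conv_def)
    have "\<forall>\<^sub>F y in F. p (y \<ominus> x n) < e / 2 \<and> y \<in> carrier A" using n R by (simp add: eventually_conj)
    then show "\<forall>\<^sub>F (x, y) in F \<times>\<^sub>F F. x \<ominus> y \<in> carrier A \<and> p (x \<ominus> y) < e"
      using \<open>\<forall>\<^sub>F y in F. p (y \<ominus> x n) < e / 2 \<and> y \<in> carrier A\<close>
    proof (rule eventually_prod_filterI)
      fix a b assume "p (a \<ominus> x n) < e / 2 \<and> a \<in> carrier A" "p (b \<ominus> x n) < e / 2 \<and> b \<in> carrier A"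
      then show "case (a, b) of (x, y) \<Rightarrow> x \<ominus> y \<in> carrier A \<and> p (x \<ominus> y) < e"
        using diff_triangle[of a "x n" b] diff_commute[of b "x n"] xn by simp
    qed
  qed
  with R show "F \<in> cauchy_filters A" by (simp add: cauchy_filters_def)
qed

lemma filter_conv_close:
  assumes p: "p \<in> P" and F: "F \<in> cauchy_filters A" and G: "G \<in> cauchy_filters A"
    and uc: "uniformly_close A F G" and x: "filter_conv p x F"
  shows "filter_conv p x G"
  unfolding filter_conv_def
proof (intro conjI allI impI)
  interpret seminormed A p by (rule P_seminormed[OF p])
  show xc: "x n \<in> carrier A" for n using x by (simp add: filter_conv_def)
  fix e :: real assume e: "e > 0"
  have "\<forall>\<^sub>F (x, y) in F \<times>\<^sub>F G. x \<ominus> y \<in> carrier A \<and> p (x \<ominus> y) < e / 2"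
    using uc p e by (intro uniformly_closeD) simp_all
  then obtain Q R where QR: "eventually Q F" "eventually R G"
    "\<And>x y. Q x \<Longrightarrow> R y \<Longrightarrow> p (x \<ominus> y) < e / 2"
    unfolding eventually_prod_filter by auto
  have "\<forall>\<^sub>F n in sequentially. \<forall>\<^sub>F y in F. p (y \<ominus> x n) < e / 2"
    using x e by (intro filter_convD) simp_all
  then show "\<forall>\<^sub>F n in sequentially. \<forall>\<^sub>F y in G. p (y \<ominus> x n) < e"
  proof (rule eventually_mono)
    fix n assume n: "\<forall>\<^sub>F y in F. p (y \<ominus> x n) < e / 2"
    have "\<forall>\<^sub>F y in F. y \<in> carrier A" "F \<noteq> bot" using F by (auto simp: cauchy_filters_def)
    then have "\<exists>f. (p (f \<ominus> x n) < e / 2 \<and> Q f) \<and> f \<in> carrier A"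
      using n QR(1) by (intro eventually_happens' eventually_conj)
    then obtain f where f: "p (f \<ominus> x n) < e / 2" "Q f" "f \<in> carrier A" by blast
    have "\<forall>\<^sub>F y in G. R y \<and> y \<in> carrier A" using G QR(2) by (simp add: cauchy_filters_def eventually_conj)
    then show "\<forall>\<^sub>F y in G. p (y \<ominus> x n) < e"
    proof (rule eventually_mono)
      fix y assume y: "R y \<and> y \<in> carrier A"
      then show "p (y \<ominus> x n) < e"
        using diff_triangle[of y f "x n"] diff_commute[of y f] QR(3)[of f y] f xc by simp
    qed
  qed
qed

text \<open>Together with \<open>filter_conv_close\<close>: two Cauchy filters are equivalent
  exactly if for each seminorm some sequence approximates both. Symmetry and transitivity of
  \<open>cauchy_rel\<close> are read off from this form.\<close>

lemma uniformly_close_filter_conv: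
  assumes F: "F \<in> cauchy_filters A" and G: "G \<in> cauchy_filters A"
    and x: "\<And>p. p \<in> P \<Longrightarrow> \<exists>x. filter_conv p x F \<and> filter_conv p x G"
  shows "uniformly_close A F G"
  unfolding uniformly_close_iff
proof (intro ballI allI impI)
  fix p and e :: real assume p: "p \<in> P" and e: "e > 0"
  interpret seminormed A p by (rule P_seminormed[OF p])
  obtain x where x: "filter_conv p x F" "filter_conv p x G" using x[OF p] by blast
  have "\<forall>\<^sub>F n in sequentially. (\<forall>\<^sub>F y in F. p (y \<ominus> x n) < e / 2) \<and> (\<forall>\<^sub>F y in G. p (y \<ominus> x n) < e / 2)"
    using x e by (intro eventually_conj filter_convD) simp_all
  then obtain n where n: "\<forall>\<^sub>F y in F. p (y \<ominus> x n) < e / 2" "\<forall>\<^sub>F y in G. p (y \<ominus> x n) < e / 2"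
    using eventually_happens' sequentially_bot by blast
  have xn: "x n \<in> carrier A" using x by (simp add: filter_conv_def)
  have "\<forall>\<^sub>F y in F. p (y \<ominus> x n) < e / 2 \<and> y \<in> carrier A"
      "\<forall>\<^sub>F y in G. p (y \<ominus> x n) < e / 2 \<and> y \<in> carrier A"
    using n F G by (auto simp: eventually_conj_iff cauchy_filters_def)
  then show "\<forall>\<^sub>F (x, y) in F \<times>\<^sub>F G. x \<ominus> y \<in> carrier A \<and> p (x \<ominus> y) < e"
  proof (rule eventually_prod_filterI)
    fix a b assume "p (a \<ominus> x n) < e / 2 \<and> a \<in> carrier A" "p (b \<ominus> x n) < e / 2 \<and> b \<in> carrier A"
    then show "case (a, b) of (x, y) \<Rightarrow> x \<ominus> y \<in> carrier A \<and> p (x \<ominus> y) < e"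
      using diff_triangle[of a "x n" b] diff_commute[of b "x n"] xn by simp
  qed
qed

lemma equiv_cauchy_rel: "equiv (cauchy_filters A) (cauchy_rel A)"
proof (rule equivI)
  show "cauchy_rel A \<subseteq> cauchy_filters A \<times> cauchy_filters A" by (auto simp: cauchy_rel_def)
  show "refl_on (cauchy_filters A) (cauchy_rel A)"
    by (auto simp: refl_on_def cauchy_rel_def cauchy_filters_def)
  have share: "\<exists>x. filter_conv p x F \<and> filter_conv p x G"
    if rel: "(F, G) \<in> cauchy_rel A" and p: "p \<in> P" for F G p
  proof -
    have FG: "F \<in> cauchy_filters A" "G \<in> cauchy_filters A" "uniformly_close A F G"
      using rel by (auto simp: cauchy_rel_def)
    obtain x where "filter_conv p x F" using FG(1) p unfolding cauchy_filters_iff by blast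
    then show ?thesis using filter_conv_close[OF p FG] by blast
  qed
  show "sym (cauchy_rel A)"
  proof (rule symI)
    fix F G assume FG: "(F, G) \<in> cauchy_rel A"
    then have "uniformly_close A G F"
      using share[OF FG] by (intro uniformly_close_filter_conv) (auto simp: cauchy_rel_def)
    with FG show "(G, F) \<in> cauchy_rel A" by (simp add: cauchy_rel_def)
  qed
  show "trans (cauchy_rel A)"
  proof (rule transI)
    fix F G H assume FG: "(F, G) \<in> cauchy_rel A" and GH: "(G, H) \<in> cauchy_rel A"
    have "uniformly_close A F H"
    proof (rule uniformly_close_filter_conv)
      show "F \<in> cauchy_filters A" "H \<in> cauchy_filters A" using FG GH by (auto simp: cauchy_rel_def)
      fix p assume p: "p \<in> P"
      obtain x where x: "filter_conv p x F" "filter_conv p x G" using share[OF FG p] by blast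
      have "filter_conv p x H"
        using GH x(2) by (intro filter_conv_close[OF p, of G H]) (auto simp: cauchy_rel_def)
      with x show "\<exists>x. filter_conv p x F \<and> filter_conv p x H" by blast
    qed
    with FG GH show "(F, H) \<in> cauchy_rel A" by (simp add: cauchy_rel_def)
  qed
qed

section \<open>Operations on classes of Cauchy filters\<close>

abbreviation K where "K \<equiv> hausdorff_completion A"

lemma carrier_K: "carrier K = cauchy_filters A // cauchy_rel A"
  by (simp add: hausdorff_completion_def)

text \<open>By \<open>filter_conv_close\<close>, for \<open>p \<in> P\<close> it is the same to ask
  this of one representative or of all. Membership in the carrier excludes the empty set, for which
  the quantifier would be vacuous.\<close>

definition conv :: "('a \<Rightarrow> real) \<Rightarrow> (nat \<Rightarrow> 'a) \<Rightarrow> 'a filter set \<Rightarrow> bool" where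
  "conv p x X \<longleftrightarrow> X \<in> carrier K \<and> (\<forall>F\<in>X. filter_conv p x F)"

lemma class_in_carrier: "F \<in> cauchy_filters A \<Longrightarrow> cauchy_class A F \<in> carrier K"
  unfolding carrier_K by (rule quotientI)

lemma in_class: "F \<in> cauchy_filters A \<Longrightarrow> F \<in> cauchy_class A F"
  using equiv_class_self[OF equiv_cauchy_rel] .

lemma conv_class:
  assumes "p \<in> P" "F \<in> cauchy_filters A" "filter_conv p x F"
  shows "conv p x (cauchy_class A F)"
  using assms class_in_carrier[OF assms(2)] filter_conv_close[OF assms(1,2)]
  by (auto simp: conv_def cauchy_rel_def)

lemma carrier_KE:
  assumes "X \<in> carrier K"
  obtains F where "F \<in> cauchy_filters A" "F \<in> X" "X = cauchy_class A F"
  using assms in_class unfolding carrier_K by (metis quotientE)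

lemma exists_conv:
  assumes "X \<in> carrier K" "p \<in> P"
  obtains x where "conv p x X"
  using assms cauchy_filters_iff conv_class by (metis carrier_KE)

lemma exists_conv2:
  assumes "X \<in> carrier K" "Y \<in> carrier K" "p \<in> P"
  obtains x y where "conv p x X" "conv p y Y"
proof -
  obtain x where x: "conv p x X" using exists_conv[OF assms(1,3)] .
  obtain y where "conv p y Y" using exists_conv[OF assms(2,3)] .
  with x show thesis by (rule that)
qed

lemma exists_conv3:
  assumes "X \<in> carrier K" "Y \<in> carrier K" "Z \<in> carrier K" "p \<in> P"
  obtains x y z where "conv p x X" "conv p y Y" "conv p z Z"
proof -
  obtain x y where xy: "conv p x X" "conv p y Y" using exists_conv2[OF assms(1,2,4)] .
  obtain z where "conv p z Z" using exists_conv[OF assms(3,4)] .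
  with xy show thesis by (rule that)
qed

lemma conv_carrier: "conv p x X \<Longrightarrow> X \<in> carrier K"
  by (simp add: conv_def)

lemma conv_seq_carrier: "conv p x X \<Longrightarrow> x n \<in> carrier A"
  by (auto simp: conv_def filter_conv_def elim!: carrier_KE)

lemma class_eqI:
  assumes "F \<in> cauchy_filters A" "G \<in> cauchy_filters A"
    "\<And>p. p \<in> P \<Longrightarrow> \<exists>x. filter_conv p x F \<and> filter_conv p x G"
  shows "cauchy_class A F = cauchy_class A G"
  using uniformly_close_filter_conv[OF assms] assms(1,2)
  by (intro equiv_class_eq[OF equiv_cauchy_rel]) (simp add: cauchy_rel_def)

lemma conv_eqI:
  assumes "X \<in> carrier K" "Y \<in> carrier K" "\<And>p. p \<in> P \<Longrightarrow> \<exists>x. conv p x X \<and> conv p x Y"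
  shows "X = Y"
proof -
  obtain F G where F: "F \<in> cauchy_filters A" "F \<in> X" "X = cauchy_class A F"
    and G: "G \<in> cauchy_filters A" "G \<in> Y" "Y = cauchy_class A G"
    using assms(1,2) by (metis carrier_KE)
  have "\<exists>x. filter_conv p x F \<and> filter_conv p x G" if "p \<in> P" for p
    using assms(3)[OF that] F(2) G(2) by (auto simp: conv_def)
  then show ?thesis using class_eqI F G by metis
qed

lemma conv_cong: "conv p x X \<Longrightarrow> (\<And>n. x n = y n) \<Longrightarrow> conv p y X"
  using ext[of x y] by simp

text \<open>Treats addition and multiplication of the completion uniformly. The union over
  representatives in the definition collapses to a single class, because the image filters share
  their approximating sequences.\<close>

lemma binary_op:
  assumes closed: "\<And>a b. a \<in> carrier A \<Longrightarrow> b \<in> carrier A \<Longrightarrow> f a b \<in> carrier A"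
    and pres: "\<And>p x y F G. \<lbrakk>p \<in> P; F \<in> cauchy_filters A; G \<in> cauchy_filters A;
      filter_conv p x F; filter_conv p y G\<rbrakk> \<Longrightarrow>
      filter_conv p (\<lambda>n. f (x n) (y n)) (filtermap (\<lambda>(a, b). f a b) (F \<times>\<^sub>F G))"
    and X: "X \<in> carrier K" and Y: "Y \<in> carrier K"
  defines "Z \<equiv> (\<Union>F\<in>X. \<Union>G\<in>Y. cauchy_class A (filtermap (\<lambda>(a, b). f a b) (F \<times>\<^sub>F G)))"
  shows "Z \<in> carrier K"
    and "\<And>p x y. p \<in> P \<Longrightarrow> conv p x X \<Longrightarrow> conv p y Y \<Longrightarrow> conv p (\<lambda>n. f (x n) (y n)) Z"
proof -
  obtain F0 G0 where F0: "F0 \<in> cauchy_filters A" "F0 \<in> X" "X = cauchy_class A F0"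
    and G0: "G0 \<in> cauchy_filters A" "G0 \<in> Y" "Y = cauchy_class A G0"
    using X Y by (metis carrier_KE)
  let ?f = "\<lambda>F G. filtermap (\<lambda>(a, b). f a b) (F \<times>\<^sub>F G)"
  have cf: "?f F G \<in> cauchy_filters A" if F: "F \<in> cauchy_filters A" and G: "G \<in> cauchy_filters A" for F G
    unfolding cauchy_filters_iff
  proof (intro conjI ballI)
    show "?f F G \<noteq> bot" using F G by (simp add: cauchy_filters_def filtermap_bot_iff prod_filter_eq_bot)
    have "\<forall>\<^sub>F a in F. a \<in> carrier A" "\<forall>\<^sub>F b in G. b \<in> carrier A"
      using F G by (auto simp: cauchy_filters_def)
    then show "\<forall>\<^sub>F x in ?f F G. x \<in> carrier A"
      unfolding eventually_filtermap eventually_prod_filter using closed by (auto intro!: exI)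
    fix p assume p: "p \<in> P"
    obtain x y where "filter_conv p x F" "filter_conv p y G"
      using F G p unfolding cauchy_filters_iff by blast
    then show "\<exists>x. filter_conv p x (?f F G)" using pres[OF p F G] by blast
  qed
  have same: "cauchy_class A (?f F G) = cauchy_class A (?f F0 G0)" if F: "F \<in> X" and G: "G \<in> Y" for F G
  proof -
    have FG: "F \<in> cauchy_filters A" "G \<in> cauchy_filters A"
      using F G F0 G0 by (auto simp: cauchy_rel_def)
    show ?thesis
    proof (rule class_eqI[OF cf[OF FG] cf[OF F0(1) G0(1)]])
      fix p assume p: "p \<in> P"
      obtain x y where "conv p x X" "conv p y Y" using exists_conv2[OF X Y p] .
      then have "filter_conv p x F" "filter_conv p x F0" "filter_conv p y G" "filter_conv p y G0"
        using F G F0(2) G0(2) by (auto simp: conv_def)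
      then show "\<exists>x. filter_conv p x (?f F G) \<and> filter_conv p x (?f F0 G0)"
        using pres[OF p] FG F0(1) G0(1) by blast
    qed
  qed
  have Z: "Z = cauchy_class A (?f F0 G0)"
  proof -
    have "Z = (\<Union>F\<in>X. \<Union>G\<in>Y. cauchy_class A (?f F0 G0))"
      unfolding Z_def by (intro SUP_cong refl same)
    then show ?thesis using F0(2) G0(2) by auto
  qed
  show "Z \<in> carrier K" unfolding Z by (rule class_in_carrier[OF cf[OF F0(1) G0(1)]])
  show "conv p (\<lambda>n. f (x n) (y n)) Z" if "p \<in> P" "conv p x X" "conv p y Y" for p x y
    unfolding Z using that F0 G0
    by (intro conv_class cf pres) (auto simp: conv_def)
qed

lemma unary_op:
  assumes closed: "\<And>a. a \<in> carrier A \<Longrightarrow> f a \<in> carrier A"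
    and pres: "\<And>p x F. \<lbrakk>p \<in> P; F \<in> cauchy_filters A; filter_conv p x F\<rbrakk> \<Longrightarrow>
      filter_conv p (\<lambda>n. f (x n)) (filtermap f F)"
    and X: "X \<in> carrier K"
  defines "Z \<equiv> (\<Union>F\<in>X. cauchy_class A (filtermap f F))"
  shows "Z \<in> carrier K"
    and "\<And>p x. p \<in> P \<Longrightarrow> conv p x X \<Longrightarrow> conv p (\<lambda>n. f (x n)) Z"
proof -
  obtain F0 where F0: "F0 \<in> cauchy_filters A" "F0 \<in> X" "X = cauchy_class A F0"
    using X by (metis carrier_KE)
  have cf: "filtermap f F \<in> cauchy_filters A" if F: "F \<in> cauchy_filters A" for F
    unfolding cauchy_filters_iff
  proof (intro conjI ballI)
    show "filtermap f F \<noteq> bot" using F by (simp add: cauchy_filters_def filtermap_bot_iff)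
    have "\<forall>\<^sub>F a in F. a \<in> carrier A" using F by (auto simp: cauchy_filters_def)
    then show "\<forall>\<^sub>F x in filtermap f F. x \<in> carrier A"
      unfolding eventually_filtermap by (rule eventually_mono) (rule closed)
    fix p assume p: "p \<in> P"
    obtain x where "filter_conv p x F" using F p unfolding cauchy_filters_iff by blast
    then show "\<exists>x. filter_conv p x (filtermap f F)" using pres[OF p F] by blast
  qed
  have same: "cauchy_class A (filtermap f F) = cauchy_class A (filtermap f F0)" if F: "F \<in> X" for F
  proof -
    have Fc: "F \<in> cauchy_filters A" using F F0 by (auto simp: cauchy_rel_def)
    show ?thesis
    proof (rule class_eqI[OF cf[OF Fc] cf[OF F0(1)]])
      fix p assume p: "p \<in> P"
      obtain x where "conv p x X" using exists_conv[OF X p] by metis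
      then have "filter_conv p x F" "filter_conv p x F0" using F F0(2) by (auto simp: conv_def)
      then show "\<exists>x. filter_conv p x (filtermap f F) \<and> filter_conv p x (filtermap f F0)"
        using pres[OF p] Fc F0(1) by blast
    qed
  qed
  have Z: "Z = cauchy_class A (filtermap f F0)"
  proof -
    have "Z = (\<Union>F\<in>X. cauchy_class A (filtermap f F0))"
      unfolding Z_def by (intro SUP_cong refl same)
    then show ?thesis using F0(2) by auto
  qed
  show "Z \<in> carrier K" unfolding Z by (rule class_in_carrier[OF cf[OF F0(1)]])
  show "conv p (\<lambda>n. f (x n)) Z" if "p \<in> P" "conv p x X" for p x
    unfolding Z using that F0
    by (intro conv_class cf pres) (auto simp: conv_def)
qed

lemma filter_conv_seqD: "filter_conv p x F \<Longrightarrow> x n \<in> carrier A"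
  by (simp add: filter_conv_def)

lemma filter_conv_add:
  assumes p: "p \<in> P" and F: "F \<in> cauchy_filters A" and G: "G \<in> cauchy_filters A"
    and x: "filter_conv p x F" and y: "filter_conv p y G"
  shows "filter_conv p (\<lambda>n. x n \<oplus> y n) (filtermap (\<lambda>(a, b). a \<oplus> b) (F \<times>\<^sub>F G))"
  unfolding filter_conv_def
proof (intro conjI allI impI)
  interpret seminormed A p by (rule P_seminormed[OF p])
  note xc = filter_conv_seqD[OF x] and yc = filter_conv_seqD[OF y]
  show "x n \<oplus> y n \<in> carrier A" for n using xc yc by simp
  fix e :: real assume e: "e > 0"
  have "\<forall>\<^sub>F n in sequentially. (\<forall>\<^sub>F a in F. p (a \<ominus> x n) < e / 2) \<and> (\<forall>\<^sub>F b in G. p (b \<ominus> y n) < e / 2)"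
    using x y e by (intro eventually_conj filter_convD) simp_all
  then show "\<forall>\<^sub>F n in sequentially. \<forall>\<^sub>F z in filtermap (\<lambda>(a, b). a \<oplus> b) (F \<times>\<^sub>F G). p (z \<ominus> (x n \<oplus> y n)) < e"
  proof (rule eventually_mono)
    fix n assume n: "(\<forall>\<^sub>F a in F. p (a \<ominus> x n) < e / 2) \<and> (\<forall>\<^sub>F b in G. p (b \<ominus> y n) < e / 2)"
    have "\<forall>\<^sub>F a in F. p (a \<ominus> x n) < e / 2 \<and> a \<in> carrier A"
        "\<forall>\<^sub>F b in G. p (b \<ominus> y n) < e / 2 \<and> b \<in> carrier A"
      using n F G by (auto simp: eventually_conj_iff cauchy_filters_def)
    then show "\<forall>\<^sub>F z in filtermap (\<lambda>(a, b). a \<oplus> b) (F \<times>\<^sub>F G). p (z \<ominus> (x n \<oplus> y n)) < e"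
      unfolding eventually_filtermap
    proof (rule eventually_prod_filterI)
      fix a b assume "p (a \<ominus> x n) < e / 2 \<and> a \<in> carrier A" "p (b \<ominus> y n) < e / 2 \<and> b \<in> carrier A"
      then show "p ((case (a, b) of (a, b) \<Rightarrow> a \<oplus> b) \<ominus> (x n \<oplus> y n)) < e"
        using triangle[of "a \<ominus> x n" "b \<ominus> y n"] xc yc by (simp add: add_diff_add)
    qed
  qed
qed

text \<open>Prepares the product: multiplication is uniformly continuous only on bounded
  sets.\<close>

lemma filter_conv_bounded:
  assumes p: "p \<in> P" and F: "F \<in> cauchy_filters A" and x: "filter_conv p x F"
  obtains B where "B > 0" "\<forall>\<^sub>F a in F. p a \<le> B" "\<forall>\<^sub>F n in sequentially. p (x n) \<le> B"
proof -
  interpret seminormed A p by (rule P_seminormed[OF p])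
  note xc = filter_conv_seqD[OF x]
  have ev: "\<forall>\<^sub>F n in sequentially. \<forall>\<^sub>F a in F. p (a \<ominus> x n) < 1" using x by (simp add: filter_conv_def)
  then obtain N where N: "\<forall>\<^sub>F a in F. p (a \<ominus> x N) < 1"
    using eventually_happens' sequentially_bot by blast
  have Fc: "\<forall>\<^sub>F a in F. a \<in> carrier A" "F \<noteq> bot" using F by (auto simp: cauchy_filters_def)
  have b: "\<forall>\<^sub>F a in F. p a \<le> p (x N) + 1 \<and> a \<in> carrier A"
    using eventually_conj[OF N Fc(1)]
  proof (rule eventually_mono)
    fix a assume "p (a \<ominus> x N) < 1 \<and> a \<in> carrier A"
    then show "p a \<le> p (x N) + 1 \<and> a \<in> carrier A" using reverse_triangle[of a "x N"] xc by auto
  qed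
  show thesis
  \<comment> \<open>One unit leads from \<open>x N\<close> to the elements of the filter, a second
    one from these to \<open>x n\<close>.\<close>
  proof (rule that[of "p (x N) + 2"])
    show "p (x N) + 2 > 0" using nonneg[OF xc, of N] by simp
    show "\<forall>\<^sub>F a in F. p a \<le> p (x N) + 2" using b by (rule eventually_mono) auto
    show "\<forall>\<^sub>F n in sequentially. p (x n) \<le> p (x N) + 2"
      using ev
    proof (rule eventually_mono)
      fix n assume "\<forall>\<^sub>F a in F. p (a \<ominus> x n) < 1"
      then obtain a where "p (a \<ominus> x n) < 1" "p a \<le> p (x N) + 1" "a \<in> carrier A"
        using eventually_happens'[OF Fc(2) eventually_conj[OF b]] by blast
      then show "p (x n) \<le> p (x N) + 2" using reverse_triangle[of a "x n"] xc[of n] by auto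
    qed
  qed
qed

lemma filter_conv_mult:
  assumes p: "p \<in> P" and F: "F \<in> cauchy_filters A" and G: "G \<in> cauchy_filters A"
    and x: "filter_conv p x F" and y: "filter_conv p y G"
  shows "filter_conv p (\<lambda>n. x n \<otimes> y n) (filtermap (\<lambda>(a, b). a \<otimes> b) (F \<times>\<^sub>F G))"
  unfolding filter_conv_def
proof (intro conjI allI impI)
  interpret cstar_seminormed A p by (rule P_cstar_seminormed[OF p])
  note xc = filter_conv_seqD[OF x] and yc = filter_conv_seqD[OF y]
  show "x n \<otimes> y n \<in> carrier A" for n using xc yc by simp
  \<comment> \<open>In \<open>a b - x y = a (b - y) + (a - x) y\<close> the differences are
    multiplied by a, which B bounds, and by y, which C bounds.\<close>
  obtain B where B: "B > 0" "\<forall>\<^sub>F a in F. p a \<le> B" using filter_conv_bounded[OF p F x] by blast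
  obtain C where C: "C > 0" "\<forall>\<^sub>F n in sequentially. p (y n) \<le> C" using filter_conv_bounded[OF p G y] by blast
  fix e :: real assume e: "e > 0"
  have "\<forall>\<^sub>F n in sequentially. ((\<forall>\<^sub>F a in F. p (a \<ominus> x n) < e / (2 * C)) \<and>
      (\<forall>\<^sub>F b in G. p (b \<ominus> y n) < e / (2 * B))) \<and> p (y n) \<le> C"
    using x y e B(1) C by (intro eventually_conj filter_convD) simp_all
  then show "\<forall>\<^sub>F n in sequentially. \<forall>\<^sub>F z in filtermap (\<lambda>(a, b). a \<otimes> b) (F \<times>\<^sub>F G). p (z \<ominus> x n \<otimes> y n) < e"
  proof (rule eventually_mono)
    fix n assume n: "((\<forall>\<^sub>F a in F. p (a \<ominus> x n) < e / (2 * C)) \<and>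
      (\<forall>\<^sub>F b in G. p (b \<ominus> y n) < e / (2 * B))) \<and> p (y n) \<le> C"
    have "\<forall>\<^sub>F a in F. p (a \<ominus> x n) < e / (2 * C) \<and> a \<in> carrier A \<and> p a \<le> B"
        "\<forall>\<^sub>F b in G. p (b \<ominus> y n) < e / (2 * B) \<and> b \<in> carrier A"
      using n F G B(2) by (auto simp: eventually_conj_iff cauchy_filters_def)
    then show "\<forall>\<^sub>F z in filtermap (\<lambda>(a, b). a \<otimes> b) (F \<times>\<^sub>F G). p (z \<ominus> x n \<otimes> y n) < e"
      unfolding eventually_filtermap
    proof (rule eventually_prod_filterI)
      fix a b assume a: "p (a \<ominus> x n) < e / (2 * C) \<and> a \<in> carrier A \<and> p a \<le> B"
        and b: "p (b \<ominus> y n) < e / (2 * B) \<and> b \<in> carrier A"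
      have "p (a \<otimes> b \<ominus> x n \<otimes> y n) \<le> p (a \<otimes> (b \<ominus> y n)) + p ((a \<ominus> x n) \<otimes> y n)"
        using a b xc yc by (subst mult_diff_mult) (auto intro: triangle)
      also have "\<dots> \<le> p a * p (b \<ominus> y n) + p (a \<ominus> x n) * p (y n)"
        using a b xc yc by (intro add_mono submult) auto
      also have "\<dots> \<le> B * p (b \<ominus> y n) + p (a \<ominus> x n) * C"
        using a b xc yc n less_imp_le[OF B(1)] by (intro add_mono mult_mono) auto
      also have "\<dots> < B * (e / (2 * B)) + e / (2 * C) * C"
        using a b B(1) C(1) by (intro add_strict_mono mult_strict_left_mono mult_strict_right_mono) auto
      also have "\<dots> = e" using B(1) C(1) by simp
      finally show "p ((case (a, b) of (a, b) \<Rightarrow> a \<otimes> b) \<ominus> x n \<otimes> y n) < e" by simp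
    qed
  qed
qed

lemma filter_conv_map:
  assumes p: "p \<in> P" and F: "F \<in> cauchy_filters A" and x: "filter_conv p x F"
    and f: "\<And>a. a \<in> carrier A \<Longrightarrow> f a \<in> carrier A"
    and lip: "\<And>a b. a \<in> carrier A \<Longrightarrow> b \<in> carrier A \<Longrightarrow> p (f a \<ominus> f b) \<le> k * p (a \<ominus> b)"
  shows "filter_conv p (\<lambda>n. f (x n)) (filtermap f F)"
  unfolding filter_conv_def
proof (intro conjI allI impI)
  interpret seminormed A p by (rule P_seminormed[OF p])
  note xc = filter_conv_seqD[OF x]
  show "f (x n) \<in> carrier A" for n using xc f by simp
  fix e :: real assume e: "e > 0"
  define k' where "k' = max k 1"
  have k': "k' > 0" by (simp add: k'_def)
  have "\<forall>\<^sub>F n in sequentially. \<forall>\<^sub>F a in F. p (a \<ominus> x n) < e / k'"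
    using x e k' by (intro filter_convD) simp_all
  then show "\<forall>\<^sub>F n in sequentially. \<forall>\<^sub>F z in filtermap f F. p (z \<ominus> f (x n)) < e"
  proof (rule eventually_mono)
    fix n assume n: "\<forall>\<^sub>F a in F. p (a \<ominus> x n) < e / k'"
    have "\<forall>\<^sub>F a in F. p (a \<ominus> x n) < e / k' \<and> a \<in> carrier A"
      using n F by (auto simp: eventually_conj_iff cauchy_filters_def)
    then show "\<forall>\<^sub>F z in filtermap f F. p (z \<ominus> f (x n)) < e"
      unfolding eventually_filtermap
    proof (rule eventually_mono)
      fix a assume a: "p (a \<ominus> x n) < e / k' \<and> a \<in> carrier A"
      have "p (f a \<ominus> f (x n)) \<le> k' * p (a \<ominus> x n)"
        unfolding k'_def using a xc lip by (intro le_max_scaled) auto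
      also have "\<dots> < e" using a k' by (simp add: field_simps)
      finally show "p (f a \<ominus> f (x n)) < e" .
    qed
  qed
qed

lemma add_K: "X \<oplus>\<^bsub>K\<^esub> Y =
    (\<Union>F\<in>X. \<Union>G\<in>Y. cauchy_class A (filtermap (\<lambda>(a, b). a \<oplus> b) (F \<times>\<^sub>F G)))"
  and mult_K: "X \<otimes>\<^bsub>K\<^esub> Y =
    (\<Union>F\<in>X. \<Union>G\<in>Y. cauchy_class A (filtermap (\<lambda>(a, b). a \<otimes> b) (F \<times>\<^sub>F G)))"
  and scale_K: "c \<odot>\<^bsub>K\<^esub> X = (\<Union>F\<in>X. cauchy_class A (filtermap (\<lambda>a. c \<odot> a) F))"
  and star_K: "star K X = (\<Union>F\<in>X. cauchy_class A (filtermap (star A) F))"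
  by (simp_all add: hausdorff_completion_def)

lemma K_add: "X \<in> carrier K \<Longrightarrow> Y \<in> carrier K \<Longrightarrow> X \<oplus>\<^bsub>K\<^esub> Y \<in> carrier K"
  unfolding add_K by (rule binary_op(1)[OF _ filter_conv_add]) simp

lemma conv_add:
  assumes "p \<in> P" "conv p x X" "conv p y Y"
  shows "conv p (\<lambda>n. x n \<oplus> y n) (X \<oplus>\<^bsub>K\<^esub> Y)"
  unfolding add_K
  by (rule binary_op(2)[OF _ filter_conv_add assms(2,3)[THEN conv_carrier] assms]) simp

lemma K_mult: "X \<in> carrier K \<Longrightarrow> Y \<in> carrier K \<Longrightarrow> X \<otimes>\<^bsub>K\<^esub> Y \<in> carrier K"
  unfolding mult_K by (rule binary_op(1)[OF _ filter_conv_mult]) simp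

lemma conv_mult:
  assumes "p \<in> P" "conv p x X" "conv p y Y"
  shows "conv p (\<lambda>n. x n \<otimes> y n) (X \<otimes>\<^bsub>K\<^esub> Y)"
  unfolding mult_K
  by (rule binary_op(2)[OF _ filter_conv_mult assms(2,3)[THEN conv_carrier] assms]) simp

lemma filter_conv_scale:
  "\<lbrakk>p \<in> P; F \<in> cauchy_filters A; filter_conv p x F\<rbrakk> \<Longrightarrow>
    filter_conv p (\<lambda>n. c \<odot> x n) (filtermap (\<lambda>a. c \<odot> a) F)"
  by (rule filter_conv_map[where k = "cmod c"])
    (auto simp: seminormed.scale[OF P_seminormed] simp flip: scale_diff_right)

lemma filter_conv_star:
  "\<lbrakk>p \<in> P; F \<in> cauchy_filters A; filter_conv p x F\<rbrakk> \<Longrightarrow>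
    filter_conv p (\<lambda>n. star A (x n)) (filtermap (star A) F)"
  by (rule filter_conv_map[where k = 1])
    (auto simp: star_closed cstar_seminormed.star_eq[OF P_cstar_seminormed] simp flip: star_diff)

lemma K_scale: "X \<in> carrier K \<Longrightarrow> c \<odot>\<^bsub>K\<^esub> X \<in> carrier K"
  unfolding scale_K by (rule unary_op(1)[OF _ filter_conv_scale]) simp

lemma conv_scale: "p \<in> P \<Longrightarrow> conv p x X \<Longrightarrow> conv p (\<lambda>n. c \<odot> x n) (c \<odot>\<^bsub>K\<^esub> X)"
  unfolding scale_K by (rule unary_op(2)[OF _ filter_conv_scale conv_carrier]) simp_all

lemma K_star: "X \<in> carrier K \<Longrightarrow> star K X \<in> carrier K"
  unfolding star_K by (rule unary_op(1)[OF star_closed filter_conv_star])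

lemma conv_star: "p \<in> P \<Longrightarrow> conv p x X \<Longrightarrow> conv p (\<lambda>n. star A (x n)) (star K X)"
  unfolding star_K by (rule unary_op(2)[OF star_closed filter_conv_star conv_carrier])

lemma filter_conv_principal:
  assumes "a \<in> carrier A" "p \<in> P"
  shows "filter_conv p (\<lambda>_. a) (principal {a})"
proof -
  have "p (a \<ominus> a) = 0"
    using assms seminormed.zero[OF P_seminormed[OF assms(2)]] by (simp add: diff_self)
  then show ?thesis using assms(1) unfolding filter_conv_def eventually_principal by simp
qed

lemma principal_cauchy: "a \<in> carrier A \<Longrightarrow> principal {a} \<in> cauchy_filters A"
  unfolding cauchy_filters_iff eventually_principal principal_eq_bot_iff
  using filter_conv_principal by blast

abbreviation emb where "emb \<equiv> completion_map A"

lemma emb_closed: "a \<in> carrier A \<Longrightarrow> emb a \<in> carrier K"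
  unfolding completion_map_def by (intro class_in_carrier principal_cauchy)

lemma conv_emb: "p \<in> P \<Longrightarrow> a \<in> carrier A \<Longrightarrow> conv p (\<lambda>_. a) (emb a)"
  unfolding completion_map_def by (intro conv_class principal_cauchy filter_conv_principal)

lemma K_one: "\<one>\<^bsub>K\<^esub> = emb \<one>" and K_zero: "\<zero>\<^bsub>K\<^esub> = emb \<zero>"
  by (simp_all add: hausdorff_completion_def completion_map_def)

lemma conv_one: "p \<in> P \<Longrightarrow> conv p (\<lambda>_. \<one>) \<one>\<^bsub>K\<^esub>" and conv_zero: "p \<in> P \<Longrightarrow> conv p (\<lambda>_. \<zero>) \<zero>\<^bsub>K\<^esub>"
  by (simp_all add: K_one K_zero conv_emb)

lemmas K_closed = K_add K_mult K_scale K_star emb_closed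
lemmas conv_intros = conv_add conv_mult conv_scale conv_star conv_emb conv_one conv_zero

text \<open>Transfers algebraic laws from A to the completion: both sides are approximated by
  sequences that agree termwise. In its uses u and v stay schematic and are built by
  \<open>conv_intros\<close> along the terms L and R; a law in fewer than three variables repeats an
  argument.\<close>

lemma conv_identity:
  assumes "X \<in> carrier K" "Y \<in> carrier K" "Z \<in> carrier K" "L \<in> carrier K" "R \<in> carrier K"
    and "\<And>p x y z. \<lbrakk>p \<in> P; conv p x X; conv p y Y; conv p z Z; \<And>n. x n \<in> carrier A;
      \<And>n. y n \<in> carrier A; \<And>n. z n \<in> carrier A\<rbrakk> \<Longrightarrow> \<exists>u v. conv p u L \<and> conv p v R \<and> (\<forall>n. u n = v n)"
  shows "L = R"
proof (rule conv_eqI[OF assms(4,5)])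
  fix p assume p: "p \<in> P"
  obtain x y z where xyz: "conv p x X" "conv p y Y" "conv p z Z" using exists_conv3[OF assms(1-3) p] .
  obtain u v where "conv p u L" "conv p v R" "\<forall>n. u n = v n"
    using assms(6)[OF p xyz xyz[THEN conv_seq_carrier]] by blast
  then show "\<exists>u. conv p u L \<and> conv p u R" using conv_cong by blast
qed

lemma star_algebra_K: "star_algebra K"
proof -
  note cl = K_closed K_zero K_one
  have "cring K"
  proof (rule cringI)
    show "abelian_group K"
    proof (rule abelian_groupI)
      fix X Y Z assume X: "X \<in> carrier K" and Y: "Y \<in> carrier K" and Z: "Z \<in> carrier K"
      show "X \<oplus>\<^bsub>K\<^esub> Y \<oplus>\<^bsub>K\<^esub> Z = X \<oplus>\<^bsub>K\<^esub> (Y \<oplus>\<^bsub>K\<^esub> Z)"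
        by (rule conv_identity[OF X Y Z], simp add: cl X Y Z, simp add: cl X Y Z, intro exI conjI allI,
            (rule conv_intros | assumption)+, simp add: M.a_assoc)
    next
      fix X Y assume X: "X \<in> carrier K" and Y: "Y \<in> carrier K"
      show "X \<oplus>\<^bsub>K\<^esub> Y = Y \<oplus>\<^bsub>K\<^esub> X"
        by (rule conv_identity[OF X Y Y], simp add: cl X Y, simp add: cl X Y, intro exI conjI allI,
            (rule conv_intros | assumption)+, simp add: M.a_comm)
    next
      fix X assume X: "X \<in> carrier K"
      show "\<zero>\<^bsub>K\<^esub> \<oplus>\<^bsub>K\<^esub> X = X"
        by (rule conv_identity[OF X X X], simp add: cl X, simp add: cl X, intro exI conjI allI,
            (rule conv_intros | assumption)+, simp add: M.l_zero)
      \<comment> \<open>Negatives are obtained by scaling with -1, which is already an operation of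
        the completion.\<close>
      have "(- 1) \<odot>\<^bsub>K\<^esub> X \<oplus>\<^bsub>K\<^esub> X = \<zero>\<^bsub>K\<^esub>"
        by (rule conv_identity[OF X X X], simp add: cl X, simp add: cl X, intro exI conjI allI,
            (rule conv_intros | assumption)+, simp add: scale_minus_left M.l_neg)
      then show "\<exists>Y\<in>carrier K. Y \<oplus>\<^bsub>K\<^esub> X = \<zero>\<^bsub>K\<^esub>" using K_scale[OF X] by blast
    qed (simp_all add: cl)
    show "comm_monoid K"
    proof (rule comm_monoidI)
      fix X Y Z assume X: "X \<in> carrier K" and Y: "Y \<in> carrier K" and Z: "Z \<in> carrier K"
      show "X \<otimes>\<^bsub>K\<^esub> Y \<otimes>\<^bsub>K\<^esub> Z = X \<otimes>\<^bsub>K\<^esub> (Y \<otimes>\<^bsub>K\<^esub> Z)"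
        by (rule conv_identity[OF X Y Z], simp add: cl X Y Z, simp add: cl X Y Z, intro exI conjI allI,
            (rule conv_intros | assumption)+, simp add: m_assoc)
    next
      fix X Y assume X: "X \<in> carrier K" and Y: "Y \<in> carrier K"
      show "X \<otimes>\<^bsub>K\<^esub> Y = Y \<otimes>\<^bsub>K\<^esub> X"
        by (rule conv_identity[OF X Y Y], simp add: cl X Y, simp add: cl X Y, intro exI conjI allI,
            (rule conv_intros | assumption)+, simp add: m_comm)
    next
      fix X assume X: "X \<in> carrier K"
      show "\<one>\<^bsub>K\<^esub> \<otimes>\<^bsub>K\<^esub> X = X"
        by (rule conv_identity[OF X X X], simp add: cl X, simp add: cl X, intro exI conjI allI,
            (rule conv_intros | assumption)+, simp add: l_one)
    qed (simp_all add: cl)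
    fix X Y Z assume X: "X \<in> carrier K" and Y: "Y \<in> carrier K" and Z: "Z \<in> carrier K"
    show "(X \<oplus>\<^bsub>K\<^esub> Y) \<otimes>\<^bsub>K\<^esub> Z = X \<otimes>\<^bsub>K\<^esub> Z \<oplus>\<^bsub>K\<^esub> Y \<otimes>\<^bsub>K\<^esub> Z"
      by (rule conv_identity[OF X Y Z], simp add: cl X Y Z, simp add: cl X Y Z, intro exI conjI allI,
          (rule conv_intros | assumption)+, simp add: l_distr)
  qed
  then have "algebra complex_ring K"
  proof (rule algebraI[OF R_cring])
    fix X assume X: "X \<in> carrier K"
    show "c \<odot>\<^bsub>K\<^esub> X \<in> carrier K" for c using X by (rule K_scale)
    show "\<one>\<^bsub>complex_ring\<^esub> \<odot>\<^bsub>K\<^esub> X = X"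
      by (rule conv_identity[OF X X X], simp add: cl X, simp add: cl X, intro exI conjI allI,
          (rule conv_intros | assumption)+, simp add: complex_ring_def)
    fix a b
    show "(a \<oplus>\<^bsub>complex_ring\<^esub> b) \<odot>\<^bsub>K\<^esub> X = a \<odot>\<^bsub>K\<^esub> X \<oplus>\<^bsub>K\<^esub> b \<odot>\<^bsub>K\<^esub> X"
      by (rule conv_identity[OF X X X], simp add: cl X, simp add: cl X, intro exI conjI allI,
          (rule conv_intros | assumption)+, simp add: complex_ring_def scale_add_left)
    show "(a \<otimes>\<^bsub>complex_ring\<^esub> b) \<odot>\<^bsub>K\<^esub> X = a \<odot>\<^bsub>K\<^esub> (b \<odot>\<^bsub>K\<^esub> X)"
      by (rule conv_identity[OF X X X], simp add: cl X, simp add: cl X, intro exI conjI allI,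
          (rule conv_intros | assumption)+, simp add: complex_ring_def scale_scale)
    fix Y assume Y: "Y \<in> carrier K"
    show "a \<odot>\<^bsub>K\<^esub> (X \<oplus>\<^bsub>K\<^esub> Y) = a \<odot>\<^bsub>K\<^esub> X \<oplus>\<^bsub>K\<^esub> a \<odot>\<^bsub>K\<^esub> Y"
      by (rule conv_identity[OF X Y Y], simp add: cl X Y, simp add: cl X Y, intro exI conjI allI,
          (rule conv_intros | assumption)+, simp add: scale_add_right)
    show "(a \<odot>\<^bsub>K\<^esub> X) \<otimes>\<^bsub>K\<^esub> Y = a \<odot>\<^bsub>K\<^esub> (X \<otimes>\<^bsub>K\<^esub> Y)"
      by (rule conv_identity[OF X Y Y], simp add: cl X Y, simp add: cl X Y, intro exI conjI allI,
          (rule conv_intros | assumption)+, simp add: scale_mult_left)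
  qed
  then show ?thesis
  proof (rule star_algebra.intro, unfold_locales)
    fix X assume X: "X \<in> carrier K"
    show "star K X \<in> carrier K" using X by (rule K_star)
    show "star K (star K X) = X"
      by (rule conv_identity[OF X X X], simp add: cl X, simp add: cl X, intro exI conjI allI,
          (rule conv_intros | assumption)+, simp add: star_star)
    show "star K (a \<odot>\<^bsub>K\<^esub> X) = cnj a \<odot>\<^bsub>K\<^esub> star K X" for a
      by (rule conv_identity[OF X X X], simp add: cl X, simp add: cl X, intro exI conjI allI,
          (rule conv_intros | assumption)+, simp add: star_smult)
    fix Y assume Y: "Y \<in> carrier K"
    show "star K (X \<oplus>\<^bsub>K\<^esub> Y) = star K X \<oplus>\<^bsub>K\<^esub> star K Y"
      by (rule conv_identity[OF X Y Y], simp add: cl X Y, simp add: cl X Y, intro exI conjI allI,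
          (rule conv_intros | assumption)+, simp add: star_add)
    show "star K (X \<otimes>\<^bsub>K\<^esub> Y) = star K Y \<otimes>\<^bsub>K\<^esub> star K X"
      by (rule conv_identity[OF X Y Y], simp add: cl X Y, simp add: cl X Y, intro exI conjI allI,
          (rule conv_intros | assumption)+, simp add: star_mult)
  qed
qed

end

section \<open>The topology of the completion\<close>

context cstar_topology begin

interpretation K: star_algebra K by (rule star_algebra_K)

lemma conv_diff:
  assumes "p \<in> P" "conv p x X" "conv p y Y"
  shows "conv p (\<lambda>n. x n \<ominus> y n) (X \<ominus>\<^bsub>K\<^esub> Y)"
proof -
  note s = assms(2,3)[THEN conv_seq_carrier] and c = assms(2,3)[THEN conv_carrier]
  have "X \<ominus>\<^bsub>K\<^esub> Y = X \<oplus>\<^bsub>K\<^esub> (- 1) \<odot>\<^bsub>K\<^esub> Y" using c by (simp add: K.M.minus_eq K.minus_eq_scale)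
  moreover have "conv p (\<lambda>n. x n \<oplus> (- 1) \<odot> y n) (X \<oplus>\<^bsub>K\<^esub> (- 1) \<odot>\<^bsub>K\<^esub> Y)"
    using assms by (intro conv_add conv_scale)
  then have "conv p (\<lambda>n. x n \<ominus> y n) (X \<oplus>\<^bsub>K\<^esub> (- 1) \<odot>\<^bsub>K\<^esub> Y)"
    by (rule conv_cong) (simp add: s M.minus_eq minus_eq_scale)
  ultimately show ?thesis by simp
qed

text \<open>With x = y it gives the Cauchy property; with two different sequences it shows that the
  limit in \<open>hat\<close> does not depend on the choice.\<close>

lemma conv_Cauchy:
  assumes p: "p \<in> P" and x: "conv p x X" and y: "conv p y X" and e: "e > 0"
  obtains n0 where "\<And>m n. m \<ge> n0 \<Longrightarrow> n \<ge> n0 \<Longrightarrow> p (x m \<ominus> y n) < e"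
proof -
  interpret seminormed A p by (rule P_seminormed[OF p])
  note xc = conv_seq_carrier[OF x] and yc = conv_seq_carrier[OF y]
  obtain F where F: "F \<in> cauchy_filters A" "F \<in> X" using carrier_KE[OF conv_carrier[OF x]] .
  have fx: "filter_conv p x F" and fy: "filter_conv p y F" using x y F by (auto simp: conv_def)
  have "\<forall>\<^sub>F n in sequentially. (\<forall>\<^sub>F a in F. p (a \<ominus> x n) < e / 2) \<and> (\<forall>\<^sub>F a in F. p (a \<ominus> y n) < e / 2)"
    using fx fy e by (intro eventually_conj filter_convD) simp_all
  then obtain n0 where n0: "\<And>n. n \<ge> n0 \<Longrightarrow> \<forall>\<^sub>F a in F. p (a \<ominus> x n) < e / 2"
    "\<And>n. n \<ge> n0 \<Longrightarrow> \<forall>\<^sub>F a in F. p (a \<ominus> y n) < e / 2"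
    unfolding eventually_sequentially by blast
  show thesis
  proof (rule that[of n0])
    fix m n assume m: "m \<ge> n0" and n: "n \<ge> n0"
    have Fc: "\<forall>\<^sub>F a in F. a \<in> carrier A" "F \<noteq> bot" using F by (auto simp: cauchy_filters_def)
    obtain a where a: "a \<in> carrier A" "p (a \<ominus> x m) < e / 2" "p (a \<ominus> y n) < e / 2"
      using eventually_happens'[OF Fc(2) eventually_conj[OF Fc(1) eventually_conj[OF n0(1)[OF m] n0(2)[OF n]]]]
      by blast
    then show "p (x m \<ominus> y n) < e"
      using diff_triangle[of "x m" a "y n"] diff_commute[of a "x m"] xc yc by simp
  qed
qed

text \<open>The continuous extension of p to the completion. For \<open>p \<in> P\<close> the chosen
  sequence may be replaced by any other one, by \<open>hat_tendsto\<close>.\<close>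

definition hat :: "('a \<Rightarrow> real) \<Rightarrow> 'a filter set \<Rightarrow> real" where
  "hat p X = lim (\<lambda>n. p ((SOME x. conv p x X) n))"

lemma hat_tendsto:
  assumes p: "p \<in> P" and x: "conv p x X"
  shows "(\<lambda>n. p (x n)) \<longlonglongrightarrow> hat p X"
proof -
  interpret seminormed A p by (rule P_seminormed[OF p])
  define y where "y = (SOME x. conv p x X)"
  have y: "conv p y X" unfolding y_def by (rule someI[of "\<lambda>x. conv p x X", OF x])
  note xc = conv_seq_carrier[OF x] and yc = conv_seq_carrier[OF y]
  have "Cauchy (\<lambda>n. p (y n))"
    unfolding Cauchy_def
  proof (intro allI impI)
    fix e :: real assume e: "e > 0"
    obtain n0 where n0: "\<And>m n. m \<ge> n0 \<Longrightarrow> n \<ge> n0 \<Longrightarrow> p (y m \<ominus> y n) < e"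
      using conv_Cauchy[OF p y y e] by blast
    have "dist (p (y m)) (p (y n)) < e" if "m \<ge> n0" "n \<ge> n0" for m n
      using reverse_triangle[OF yc yc, of m n] n0[OF that] by (simp add: dist_real_def)
    then show "\<exists>M. \<forall>m\<ge>M. \<forall>n\<ge>M. dist (p (y m)) (p (y n)) < e" by blast
  qed
  then have "convergent (\<lambda>n. p (y n))" by (simp add: Cauchy_convergent_iff)
  then have lim: "(\<lambda>n. p (y n)) \<longlonglongrightarrow> hat p X"
    unfolding hat_def y_def by (simp add: convergent_LIMSEQ_iff)
  have "(\<lambda>n. p (x n) - p (y n)) \<longlonglongrightarrow> 0"
    unfolding LIMSEQ_def
  proof (intro allI impI)
    fix e :: real assume e: "e > 0"
    obtain n0 where n0: "\<And>m n. m \<ge> n0 \<Longrightarrow> n \<ge> n0 \<Longrightarrow> p (x m \<ominus> y n) < e"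
      using conv_Cauchy[OF p x y e] by blast
    have "dist (p (x n) - p (y n)) 0 < e" if "n \<ge> n0" for n
      using reverse_triangle[OF xc yc, of n n] n0[OF that that] by (simp add: dist_real_def)
    then show "\<exists>n0. \<forall>n\<ge>n0. dist (p (x n) - p (y n)) 0 < e" by blast
  qed
  from tendsto_add[OF this lim] show ?thesis by simp
qed

lemma hat_emb: "p \<in> P \<Longrightarrow> a \<in> carrier A \<Longrightarrow> hat p (emb a) = p a"
  using hat_tendsto[OF _ conv_emb] by (simp add: LIMSEQ_const_iff)

lemma hat_cstar_seminorm:
  assumes p: "p \<in> P" shows "cstar_seminorm K (hat p)"
  unfolding cstar_seminorm_def seminorm_def
proof (intro conjI ballI allI)
  interpret cstar_seminormed A p by (rule P_cstar_seminormed[OF p])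
  fix X assume X: "X \<in> carrier K"
  obtain x where x: "conv p x X" using exists_conv[OF X p] .
  note xc = conv_seq_carrier[OF x] and xt = hat_tendsto[OF p x]
  show "0 \<le> hat p X" using xt xc by (intro LIMSEQ_le_const) auto
  show "hat p (c \<odot>\<^bsub>K\<^esub> X) = cmod c * hat p X" for c
    using hat_tendsto[OF p conv_scale[OF p x, of c]] tendsto_mult_left[OF xt, of "cmod c"]
    by (intro LIMSEQ_unique) (simp_all add: xc scale)
  show "hat p (X \<otimes>\<^bsub>K\<^esub> star K X) = (hat p X)\<^sup>2"
    using hat_tendsto[OF p conv_mult[OF p x conv_star[OF p x]]] tendsto_power[OF xt, of 2]
    by (intro LIMSEQ_unique) (simp_all add: xc cstar)
  fix Y assume Y: "Y \<in> carrier K"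
  obtain y where y: "conv p y Y" using exists_conv[OF Y p] .
  note yc = conv_seq_carrier[OF y] and yt = hat_tendsto[OF p y]
  show "hat p (X \<oplus>\<^bsub>K\<^esub> Y) \<le> hat p X + hat p Y"
    using hat_tendsto[OF p conv_add[OF p x y]] tendsto_add[OF xt yt]
    by (rule LIMSEQ_le) (use xc yc triangle in auto)
qed

lemma hat_seminorm: "p \<in> P \<Longrightarrow> seminorm K (hat p)"
  using hat_cstar_seminorm by (simp add: cstar_seminorm_def)

text \<open>A sequence that approximates X for p then has \<open>p (x n)\<close> tending to 0, so it
  also approximates the principal filter at zero.\<close>

lemma hat_eq_zero:
  assumes X: "X \<in> carrier K" and z: "\<And>p. p \<in> P \<Longrightarrow> hat p X = 0"
  shows "X = \<zero>\<^bsub>K\<^esub>"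
proof (rule conv_eqI[OF X K.M.zero_closed])
  fix p assume p: "p \<in> P"
  interpret seminormed A p by (rule P_seminormed[OF p])
  obtain x where x: "conv p x X" using exists_conv[OF X p] .
  note xc = conv_seq_carrier[OF x]
  have lim: "(\<lambda>n. p (x n)) \<longlonglongrightarrow> 0" using hat_tendsto[OF p x] z[OF p] by simp
  have "filter_conv p x (principal {\<zero>})"
    unfolding filter_conv_def
  proof (intro conjI allI impI xc)
    fix e :: real assume "e > 0"
    then have "\<forall>\<^sub>F n in sequentially. p (x n) < e" by (rule order_tendstoD(2)[OF lim])
    then show "\<forall>\<^sub>F n in sequentially. \<forall>\<^sub>F y in principal {\<zero>}. p (y \<ominus> x n) < e"
      by (rule eventually_mono) (use xc diff_commute[of \<zero>] in \<open>simp add: eventually_principal\<close>)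
  qed
  then have "conv p x \<zero>\<^bsub>K\<^esub>"
    unfolding K_zero completion_map_def by (intro conv_class p principal_cauchy) auto
  with x show "\<exists>x. conv p x X \<and> conv p x \<zero>\<^bsub>K\<^esub>" by blast
qed

lemma hat_approx:
  assumes p: "p \<in> P" and x: "conv p x X" and e: "e > 0"
  shows "\<forall>\<^sub>F n in sequentially. hat p (X \<ominus>\<^bsub>K\<^esub> emb (x n)) < e"
proof -
  \<comment> \<open>Half of e is held back, because the limit in m preserves only the weak
    inequality.\<close>
  obtain n0 where n0: "\<And>m n. m \<ge> n0 \<Longrightarrow> n \<ge> n0 \<Longrightarrow> p (x m \<ominus> x n) < e / 2"
    using conv_Cauchy[OF p x x, of "e / 2"] e by auto
  have "hat p (X \<ominus>\<^bsub>K\<^esub> emb (x n)) < e" if "n \<ge> n0" for n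
  proof -
    have "(\<lambda>m. p (x m \<ominus> x n)) \<longlonglongrightarrow> hat p (X \<ominus>\<^bsub>K\<^esub> emb (x n))"
      by (intro hat_tendsto[OF p] conv_diff p x conv_emb conv_seq_carrier[OF x])
    then have "hat p (X \<ominus>\<^bsub>K\<^esub> emb (x n)) \<le> e / 2"
      by (rule LIMSEQ_le_const2) (use n0 that in \<open>auto intro!: exI[of _ n0] less_imp_le\<close>)
    then show ?thesis using e by simp
  qed
  then show ?thesis unfolding eventually_sequentially by blast
qed

lemma emb_dense:
  assumes p: "p \<in> P" and X: "X \<in> carrier K" and e: "e > 0"
  obtains a where "a \<in> carrier A" "hat p (X \<ominus>\<^bsub>K\<^esub> emb a) < e"
proof -
  obtain x where x: "conv p x X" using exists_conv[OF X p] .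
  obtain n where "hat p (X \<ominus>\<^bsub>K\<^esub> emb (x n)) < e"
    using eventually_happens'[OF sequentially_bot hat_approx[OF p x e]] by blast
  with conv_seq_carrier[OF x] show thesis by (rule that)
qed

lemma hat_directed: "directed_upward K (hat ` P)"
  unfolding directed_upward_def
proof (intro conjI ballI)
  show "hat ` P \<noteq> {}" using P_nonempty by simp
  fix p' q' assume "p' \<in> hat ` P" "q' \<in> hat ` P"
  then obtain p q where pq: "p \<in> P" "q \<in> P" "p' = hat p" "q' = hat q" by blast
  obtain r where r: "r \<in> P" "\<And>x. x \<in> carrier A \<Longrightarrow> p x \<le> r x" "\<And>x. x \<in> carrier A \<Longrightarrow> q x \<le> r x"
    using P_dominates[OF pq(1,2)] by blast
  have le: "hat s X \<le> hat r X" if s: "s \<in> P" "\<And>x. x \<in> carrier A \<Longrightarrow> s x \<le> r x" and X: "X \<in> carrier K" for s X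
  proof -
    obtain F where F: "F \<in> cauchy_filters A" "F \<in> X" "X = cauchy_class A F" using carrier_KE[OF X] .
    obtain x where x: "conv r x X" using exists_conv[OF X r(1)] .
    \<comment> \<open>Since r dominates s, a sequence that approximates for r also approximates for
      s; the two extensions can then be compared along the same sequence.\<close>
    have "filter_conv s x F"
      unfolding filter_conv_def
    proof (intro conjI allI impI conv_seq_carrier[OF x])
      fix e :: real assume e: "e > 0"
      have "\<forall>\<^sub>F n in sequentially. \<forall>\<^sub>F y in F. r (y \<ominus> x n) < e"
        using x F(2) e by (intro filter_convD) (auto simp: conv_def)
      then show "\<forall>\<^sub>F n in sequentially. \<forall>\<^sub>F y in F. s (y \<ominus> x n) < e"
      proof (rule eventually_mono)
        fix n assume n: "\<forall>\<^sub>F y in F. r (y \<ominus> x n) < e"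
        have "\<forall>\<^sub>F y in F. r (y \<ominus> x n) < e \<and> y \<in> carrier A"
          using n F(1) by (simp add: eventually_conj cauchy_filters_def)
        then show "\<forall>\<^sub>F y in F. s (y \<ominus> x n) < e"
        proof (rule eventually_mono)
          fix y assume "r (y \<ominus> x n) < e \<and> y \<in> carrier A"
          then show "s (y \<ominus> x n) < e" using s(2)[of "y \<ominus> x n"] conv_seq_carrier[OF x, of n] by simp
        qed
      qed
    qed
    then have "conv s x X" unfolding F(3) by (rule conv_class[OF s(1) F(1)])
    from hat_tendsto[OF s(1) this] hat_tendsto[OF r(1) x] show ?thesis
      by (rule LIMSEQ_le) (use s(2) conv_seq_carrier[OF x] in auto)
  qed
  show "\<exists>r\<in>hat ` P. \<forall>x\<in>carrier K. p' x \<le> r x \<and> q' x \<le> r x"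
    using le pq r by (intro bexI[of _ "hat r"]) auto
qed

lemma openin_K: "openin (topol K) W \<longleftrightarrow> completion_open A W"
  by (simp add: hausdorff_completion_def topology_inverse'[OF istopology_completion_open])

text \<open>This lemma and \<open>close_if_ext_less\<close> translate between closeness of
  representatives, by which the completion topology is defined, and balls of \<open>hat p\<close>.
  The factor 3 lost in each direction does not affect the topology.\<close>

lemma hat_less_if_close:
  assumes p: "p \<in> P" and F: "F \<in> cauchy_filters A" "F \<in> X" and G: "G \<in> cauchy_filters A" "G \<in> Y"
    and X: "X \<in> carrier K" and Y: "Y \<in> carrier K" and e: "0 < e"
    and ev: "\<forall>\<^sub>F (x, y) in F \<times>\<^sub>F G. x \<ominus> y \<in> carrier A \<and> p (x \<ominus> y) < e / 3"
  shows "hat p (Y \<ominus>\<^bsub>K\<^esub> X) < e"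
proof -
  interpret seminormed A p by (rule P_seminormed[OF p])
  obtain x y where x: "conv p x X" and y: "conv p y Y" using exists_conv2[OF X Y p] .
  note xc = conv_seq_carrier[OF x] and yc = conv_seq_carrier[OF y]
  have "\<forall>\<^sub>F n in sequentially. (\<forall>\<^sub>F a in F. p (a \<ominus> x n) < e / 6) \<and> (\<forall>\<^sub>F b in G. p (b \<ominus> y n) < e / 6)"
    using x y F G e by (intro eventually_conj filter_convD) (auto simp: conv_def)
  then have "\<forall>\<^sub>F n in sequentially. p (y n \<ominus> x n) \<le> 2 * e / 3"
  proof (rule eventually_mono)
    fix n assume n: "(\<forall>\<^sub>F a in F. p (a \<ominus> x n) < e / 6) \<and> (\<forall>\<^sub>F b in G. p (b \<ominus> y n) < e / 6)"
    obtain Q R where QR: "eventually Q F" "eventually R G" "\<And>a b. Q a \<Longrightarrow> R b \<Longrightarrow> p (a \<ominus> b) < e / 3"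
      using ev unfolding eventually_prod_filter by auto
    have Fc: "\<forall>\<^sub>F a in F. a \<in> carrier A" "F \<noteq> bot" "\<forall>\<^sub>F a in G. a \<in> carrier A" "G \<noteq> bot"
      using F G by (auto simp: cauchy_filters_def)
    obtain a where a: "a \<in> carrier A" "Q a" "p (a \<ominus> x n) < e / 6"
      using eventually_happens'[OF Fc(2) eventually_conj[OF Fc(1) eventually_conj[OF QR(1) n[THEN conjunct1]]]]
      by blast
    obtain b where b: "b \<in> carrier A" "R b" "p (b \<ominus> y n) < e / 6"
      using eventually_happens'[OF Fc(4) eventually_conj[OF Fc(3) eventually_conj[OF QR(2) n[THEN conjunct2]]]]
      by blast
    \<comment> \<open>The total is e/6 + e/3 + e/6 = 2e/3; the remaining e/3 restores strictness
      after the limit.\<close>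
    show "p (y n \<ominus> x n) \<le> 2 * e / 3"
      using diff_triangle[OF yc b(1) xc, of n n] diff_triangle[OF b(1) a(1) xc, of n]
        diff_commute[OF b(1) yc, of n] diff_commute[OF b(1) a(1)] a b QR(3)[OF a(2) b(2)]
      by linarith
  qed
  then have "hat p (Y \<ominus>\<^bsub>K\<^esub> X) \<le> 2 * e / 3"
    by (rule tendsto_upperbound[OF hat_tendsto[OF p conv_diff[OF p y x]]]) simp
  then show ?thesis using e by simp
qed

lemma close_if_ext_less:
  assumes p: "p \<in> P" and F: "F \<in> cauchy_filters A" "F \<in> X" and G: "G \<in> cauchy_filters A" "G \<in> Y"
    and X: "X \<in> carrier K" and Y: "Y \<in> carrier K" and e: "0 < e" and less: "hat p (Y \<ominus>\<^bsub>K\<^esub> X) < e / 3"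
  shows "\<forall>\<^sub>F (x, y) in F \<times>\<^sub>F G. x \<ominus> y \<in> carrier A \<and> p (x \<ominus> y) < e"
proof -
  interpret seminormed A p by (rule P_seminormed[OF p])
  obtain x y where x: "conv p x X" and y: "conv p y Y" using exists_conv2[OF X Y p] .
  note xc = conv_seq_carrier[OF x] and yc = conv_seq_carrier[OF y]
  have "\<forall>\<^sub>F n in sequentially. ((\<forall>\<^sub>F a in F. p (a \<ominus> x n) < e / 3) \<and> (\<forall>\<^sub>F b in G. p (b \<ominus> y n) < e / 3)) \<and>
      p (y n \<ominus> x n) < e / 3"
    using x y F G e
    by (intro eventually_conj filter_convD order_tendstoD(2)[OF hat_tendsto[OF p conv_diff[OF p y x]] less])
      (auto simp: conv_def)
  then obtain n where n: "\<forall>\<^sub>F a in F. p (a \<ominus> x n) < e / 3" "\<forall>\<^sub>F b in G. p (b \<ominus> y n) < e / 3"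
    "p (y n \<ominus> x n) < e / 3"
    using eventually_happens'[OF sequentially_bot] by blast
  have "\<forall>\<^sub>F a in F. p (a \<ominus> x n) < e / 3 \<and> a \<in> carrier A" "\<forall>\<^sub>F b in G. p (b \<ominus> y n) < e / 3 \<and> b \<in> carrier A"
    using n F G by (auto simp: eventually_conj_iff cauchy_filters_def)
  then show ?thesis
  proof (rule eventually_prod_filterI)
    fix a b assume a: "p (a \<ominus> x n) < e / 3 \<and> a \<in> carrier A" and b: "p (b \<ominus> y n) < e / 3 \<and> b \<in> carrier A"
    have "p (a \<ominus> b) < e"
      using diff_triangle[of a "x n" b] diff_triangle[of "x n" "y n" b] diff_commute[of "x n" "y n"]
        diff_commute[of "y n" b] a b xc yc n(3) by force
    then show "case (a, b) of (x, y) \<Rightarrow> x \<ominus> y \<in> carrier A \<and> p (x \<ominus> y) < e" using a b by simp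
  qed
qed

text \<open>Makes the completion an instance of \<open>cstar_topology\<close>, so that the results
  on directed families of C*-seminorms apply to it.\<close>

lemma topol_K: "topol K = seminorm_topology K (hat ` P)"
proof (rule topology_eq[THEN iffD2], intro allI)
  fix W
  have "completion_open A W \<longleftrightarrow> W \<subseteq> carrier K \<and>
      (\<forall>X\<in>W. \<exists>p\<in>P. \<exists>e>0. {Y \<in> carrier K. hat p (Y \<ominus>\<^bsub>K\<^esub> X) < e} \<subseteq> W)"
    (is "?L \<longleftrightarrow> ?R")
  proof
    assume L: ?L
    have "\<exists>p\<in>P. \<exists>e>0. {Y \<in> carrier K. hat p (Y \<ominus>\<^bsub>K\<^esub> X) < e} \<subseteq> W" if XW: "X \<in> W" for X
    proof -
      obtain U where U: "openin (topol A) U" "\<zero> \<in> U" "completion_nbhd A U X \<subseteq> W"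
        using L XW by (auto simp: completion_open_def)
      have X: "X \<in> carrier K" using L XW by (auto simp: completion_open_def carrier_K)
      obtain p e where p: "p \<in> P" "e > 0" "{y \<in> carrier A. p (y \<ominus> \<zero>) < e} \<subseteq> U"
        using U(1,2) openin_iff by blast
      have "{Y \<in> carrier K. hat p (Y \<ominus>\<^bsub>K\<^esub> X) < e / 3} \<subseteq> completion_nbhd A U X"
      proof clarify
        fix Y assume Y: "Y \<in> carrier K" "hat p (Y \<ominus>\<^bsub>K\<^esub> X) < e / 3"
        obtain F where F: "F \<in> cauchy_filters A" "F \<in> X" using carrier_KE[OF X] .
        obtain G where G: "G \<in> cauchy_filters A" "G \<in> Y" using carrier_KE[OF Y(1)] .
        have "\<forall>\<^sub>F (x, y) in F \<times>\<^sub>F G. x \<ominus> y \<in> carrier A \<and> p (x \<ominus> y) < e"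
          by (rule close_if_ext_less[OF p(1) F G X Y(1) p(2) Y(2)])
        then have "\<forall>\<^sub>F (x, y) in F \<times>\<^sub>F G. x \<ominus> y \<in> U"
          by (rule eventually_mono) (use p(3) in auto)
        then show "Y \<in> completion_nbhd A U X"
          using Y(1) F(2) G(2) unfolding completion_nbhd_def carrier_K by blast
      qed
      then show ?thesis using U(3) p(1,2) by (intro bexI[of _ p] exI[of _ "e / 3"]) auto
    qed
    then show ?R using L by (auto simp: completion_open_def carrier_K)
  next
    assume R: ?R
    have "\<exists>U. openin (topol A) U \<and> \<zero> \<in> U \<and> completion_nbhd A U X \<subseteq> W" if XW: "X \<in> W" for X
    proof -
      obtain p e where p: "p \<in> P" "e > 0" "{Y \<in> carrier K. hat p (Y \<ominus>\<^bsub>K\<^esub> X) < e} \<subseteq> W"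
        using R XW by blast
      interpret seminormed A p by (rule P_seminormed[OF p(1)])
      have X: "X \<in> carrier K" using R XW by auto
      let ?U = "{y \<in> carrier A. p (y \<ominus> \<zero>) < e / 3}"
      have "completion_nbhd A ?U X \<subseteq> W"
      proof
        fix Y assume "Y \<in> completion_nbhd A ?U X"
        then obtain F G where Y: "Y \<in> carrier K" and FG: "F \<in> X" "G \<in> Y"
          "\<forall>\<^sub>F (x, y) in F \<times>\<^sub>F G. x \<ominus> y \<in> ?U"
          by (auto simp: completion_nbhd_def carrier_K)
        have "F \<in> cauchy_filters A" "G \<in> cauchy_filters A"
          using X Y FG(1,2) by (auto simp: cauchy_rel_def elim!: carrier_KE)
        moreover have "\<forall>\<^sub>F (x, y) in F \<times>\<^sub>F G. x \<ominus> y \<in> carrier A \<and> p (x \<ominus> y) < e / 3"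
          using FG(3) by (rule eventually_mono) auto
        ultimately have "hat p (Y \<ominus>\<^bsub>K\<^esub> X) < e"
          using hat_less_if_close[OF p(1) _ FG(1) _ FG(2) X Y p(2)] by blast
        then show "Y \<in> W" using p(3) Y by auto
      qed
      moreover have "openin (topol A) ?U" "\<zero> \<in> ?U" using openin_ball[OF p(1), of \<zero> "e / 3"] p(2) by simp_all
      ultimately show ?thesis by blast
    qed
    then show ?L using R by (auto simp: completion_open_def carrier_K)
  qed
  also have "\<dots> \<longleftrightarrow> openin (seminorm_topology K (hat ` P)) W"
    by (subst K.openin_seminorm_topology_iff[OF _ hat_directed]) (auto simp: hat_seminorm)
  finally show "openin (topol K) W \<longleftrightarrow> openin (seminorm_topology K (hat ` P)) W"
    unfolding openin_K .
qed

lemma cstar_topology_K: "cstar_topology K (hat ` P)"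
  by unfold_locales (use hat_cstar_seminorm hat_directed topol_K in auto)

interpretation K: cstar_topology K "hat ` P" by (rule cstar_topology_K)

lemma Hausdorff_K: "Hausdorff_space (topol K)"
  by (rule K.separated_Hausdorff, rule hat_eq_zero) auto

text \<open>The traces on \<open>A\<close> of the \<open>e\<close>-neighbourhoods of the members of a Cauchy filter on the
  completion generate a Cauchy filter on \<open>A\<close> whose class is the limit.\<close>

lemma complete_K: "complete_algebra K"
  unfolding complete_algebra_def
proof
  fix \<F> assume \<F>: "\<F> \<in> cauchy_filters K"
  then have nb: "\<F> \<noteq> bot" and ca: "\<forall>\<^sub>F X in \<F>. X \<in> carrier K" and uc: "uniformly_close K \<F> \<F>"
    by (auto simp: cauchy_filters_def)
  define B where "B = {(p, e, M). p \<in> P \<and> e > (0::real) \<and> (\<forall>\<^sub>F X in \<F>. X \<in> M) \<and> M \<subseteq> carrier K}"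
  define S where "S = (\<lambda>(p, e, M). {a \<in> carrier A. \<exists>X\<in>M. hat p (X \<ominus>\<^bsub>K\<^esub> emb a) < e})"
  define G where "G = (INF b\<in>B. principal (S b))"
  obtain p0 where p0: "p0 \<in> P" using P_nonempty by blast
  have B0: "(p0, 1, carrier K) \<in> B" using p0 ca by (simp add: B_def)
  \<comment> \<open>The sets \<open>S b\<close> form a filter base: two seminorms are dominated by a
    third, the smaller tolerance is taken, and the members of the filter are intersected.\<close>
  have ev: "eventually Q G \<longleftrightarrow> (\<exists>b\<in>B. \<forall>a\<in>S b. Q a)" for Q
    unfolding G_def
  proof (subst eventually_INF_base)
    show "B \<noteq> {}" using B0 by blast
    show "(\<exists>b\<in>B. eventually Q (principal (S b))) = (\<exists>b\<in>B. \<forall>a\<in>S b. Q a)"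
      by (simp add: eventually_principal)
    fix b c assume b: "b \<in> B" and c: "c \<in> B"
    obtain p e M where b': "b = (p, e, M)" by (cases b)
    obtain q f N where c': "c = (q, f, N)" by (cases c)
    obtain r' where r: "r' \<in> hat ` P" "\<And>x. x \<in> carrier K \<Longrightarrow> hat p x \<le> r' x"
      "\<And>x. x \<in> carrier K \<Longrightarrow> hat q x \<le> r' x"
      using K.P_dominates[of "hat p" "hat q"] b c b' c' by (auto simp: B_def)
    then obtain r where r': "r \<in> P" "r' = hat r" by blast
    have MN: "M \<subseteq> carrier K" using b b' by (simp add: B_def)
    have "(r, min e f, M \<inter> N) \<in> B"
      using b c b' c' r'(1) by (auto simp: B_def eventually_conj_iff)
    moreover have "S (r, min e f, M \<inter> N) \<subseteq> S b \<inter> S c"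
    proof
      fix a assume "a \<in> S (r, min e f, M \<inter> N)"
      then obtain X where X: "a \<in> carrier A" "X \<in> M" "X \<in> N" "hat r (X \<ominus>\<^bsub>K\<^esub> emb a) < min e f"
        by (auto simp: S_def)
      then have "X \<ominus>\<^bsub>K\<^esub> emb a \<in> carrier K" using MN by (auto simp: emb_closed)
      then have "hat p (X \<ominus>\<^bsub>K\<^esub> emb a) < e" "hat q (X \<ominus>\<^bsub>K\<^esub> emb a) < f"
        using r(2,3)[of "X \<ominus>\<^bsub>K\<^esub> emb a"] X(4) r'(2) by auto
      then show "a \<in> S b \<inter> S c" using X b' c' by (auto simp: S_def)
    qed
    ultimately show "\<exists>x\<in>B. principal (S x) \<le> inf (principal (S b)) (principal (S c))"
      by (intro bexI[of _ "(r, min e f, M \<inter> N)"]) auto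
  qed
  have small: "\<exists>M. (\<forall>\<^sub>F X in \<F>. X \<in> M) \<and> M \<subseteq> carrier K \<and> (\<forall>X\<in>M. \<forall>Y\<in>M. hat p (X \<ominus>\<^bsub>K\<^esub> Y) < e)"
    if p: "p \<in> P" and e: "e > 0" for p e
  proof -
    have "\<forall>\<^sub>F (X, Y) in \<F> \<times>\<^sub>F \<F>. X \<ominus>\<^bsub>K\<^esub> Y \<in> carrier K \<and> hat p (X \<ominus>\<^bsub>K\<^esub> Y) < e"
      using p e by (intro K.uniformly_closeD[OF uc]) auto
    then obtain Q where Q: "eventually Q \<F>" "\<And>X Y. Q X \<Longrightarrow> Q Y \<Longrightarrow> hat p (X \<ominus>\<^bsub>K\<^esub> Y) < e"
      unfolding eventually_prod_same by auto
    show ?thesis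
      using eventually_conj[OF Q(1) ca] Q(2) by (intro exI[of _ "{X. Q X \<and> X \<in> carrier K}"]) auto
  qed
  have diam: "p (a \<ominus> b) < e" if p: "p \<in> P" and M: "M \<subseteq> carrier K" "\<forall>X\<in>M. \<forall>Y\<in>M. hat p (X \<ominus>\<^bsub>K\<^esub> Y) < e / 3"
    and a: "a \<in> S (p, e / 3, M)" and b: "b \<in> S (p, e / 3, M)" for p M e a b
  proof -
    interpret k: seminormed K "hat p" using p by (intro K.P_seminormed) simp
    obtain X where X: "X \<in> M" "hat p (X \<ominus>\<^bsub>K\<^esub> emb a) < e / 3" and ac: "a \<in> carrier A" using a by (auto simp: S_def)
    obtain Y where Y: "Y \<in> M" "hat p (Y \<ominus>\<^bsub>K\<^esub> emb b) < e / 3" and bc: "b \<in> carrier A" using b by (auto simp: S_def)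
    have XY: "X \<in> carrier K" "Y \<in> carrier K" using M X Y by auto
    have "(\<lambda>_::nat. p (a \<ominus> b)) \<longlonglongrightarrow> hat p (emb a \<ominus>\<^bsub>K\<^esub> emb b)"
      using p ac bc by (intro hat_tendsto conv_diff conv_emb)
    then have "p (a \<ominus> b) = hat p (emb a \<ominus>\<^bsub>K\<^esub> emb b)" by (simp add: LIMSEQ_const_iff)
    also have "\<dots> \<le> hat p (emb a \<ominus>\<^bsub>K\<^esub> X) + (hat p (X \<ominus>\<^bsub>K\<^esub> Y) + hat p (Y \<ominus>\<^bsub>K\<^esub> emb b))"
      using k.diff_triangle[of "emb a" X "emb b"] k.diff_triangle[of X Y "emb b"] XY ac bc
      by (simp add: emb_closed)
    also have "\<dots> < e"
      using k.diff_commute[of X "emb a"] X Y M(2) XY ac by (fastforce simp: emb_closed)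
    finally show ?thesis .
  qed
  have G: "G \<in> cauchy_filters A"
    unfolding cauchy_filters_def
  proof (intro CollectI conjI)
    show "G \<noteq> bot"
    proof
      \<comment> \<open>The traces are nonempty because the image of A is dense in the
        completion.\<close>
      assume "G = bot"
      then obtain p e M where b: "(p, e, M) \<in> B" "S (p, e, M) = {}"
        using ev[of "\<lambda>_. False"] by auto
      obtain X where X: "X \<in> M" using b(1) eventually_happens'[OF nb] by (auto simp: B_def)
      obtain a where "a \<in> carrier A" "hat p (X \<ominus>\<^bsub>K\<^esub> emb a) < e"
        using emb_dense[of p X e] b(1) X by (auto simp: B_def)
      then show False using b(2) X by (auto simp: S_def)
    qed
    show "\<forall>\<^sub>F x in G. x \<in> carrier A" unfolding ev using B0 by (auto simp: S_def)
    show "uniformly_close A G G"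
      unfolding uniformly_close_iff
    proof (intro ballI allI impI)
      fix p and e :: real assume p: "p \<in> P" and e: "e > 0"
      obtain M where M: "\<forall>\<^sub>F X in \<F>. X \<in> M" "M \<subseteq> carrier K" "\<forall>X\<in>M. \<forall>Y\<in>M. hat p (X \<ominus>\<^bsub>K\<^esub> Y) < e / 3"
        using small[OF p, of "e / 3"] e by auto
      have "\<forall>\<^sub>F a in G. a \<in> S (p, e / 3, M)"
        unfolding ev using p e M by (intro bexI[of _ "(p, e / 3, M)"]) (auto simp: B_def)
      from this this show "\<forall>\<^sub>F (x, y) in G \<times>\<^sub>F G. x \<ominus> y \<in> carrier A \<and> p (x \<ominus> y) < e"
      proof (rule eventually_prod_filterI)
        fix a b assume ab: "a \<in> S (p, e / 3, M)" "b \<in> S (p, e / 3, M)"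
        then have "a \<in> carrier A" "b \<in> carrier A" by (auto simp: S_def)
        then show "case (a, b) of (x, y) \<Rightarrow> x \<ominus> y \<in> carrier A \<and> p (x \<ominus> y) < e"
          using diam[OF p M(2,3) ab] by simp
      qed
    qed
  qed
  define L where "L = cauchy_class A G"
  have L: "L \<in> carrier K" unfolding L_def by (rule class_in_carrier[OF G])
  have "limitin (topol K) (\<lambda>x. x) L \<F>"
    unfolding K.limitin_iff
  proof (intro conjI L ballI allI impI)
    fix p' and e :: real assume p': "p' \<in> hat ` P" and e: "e > 0"
    then obtain p where p: "p \<in> P" "p' = hat p" by blast
    interpret k: seminormed K "hat p" using p by (intro K.P_seminormed) simp
    obtain M where M: "\<forall>\<^sub>F X in \<F>. X \<in> M" "M \<subseteq> carrier K" "\<forall>X\<in>M. \<forall>Y\<in>M. hat p (X \<ominus>\<^bsub>K\<^esub> Y) < e / 4"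
      using small[OF p(1), of "e / 4"] e by auto
    have evG: "\<forall>\<^sub>F a in G. a \<in> S (p, e / 4, M)"
      unfolding ev using p e M by (intro bexI[of _ "(p, e / 4, M)"]) (auto simp: B_def)
    obtain x where x: "conv p x L" using exists_conv[OF L p(1)] .
    have fc: "filter_conv p x G" using x in_class[OF G] by (simp add: conv_def L_def)
    have "\<forall>\<^sub>F n in sequentially. (\<forall>\<^sub>F a in G. p (a \<ominus> x n) < e / 4) \<and> hat p (L \<ominus>\<^bsub>K\<^esub> emb (x n)) < e / 4"
      using e by (intro eventually_conj filter_convD[OF fc] hat_approx[OF p(1) x]) simp_all
    then obtain n where n: "\<forall>\<^sub>F a in G. p (a \<ominus> x n) < e / 4" "hat p (L \<ominus>\<^bsub>K\<^esub> emb (x n)) < e / 4"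
      using eventually_happens'[OF sequentially_bot] by blast
    note xn = conv_seq_carrier[OF x, of n]
    have "G \<noteq> bot" using G by (simp add: cauchy_filters_def)
    then obtain a where a: "p (a \<ominus> x n) < e / 4" "a \<in> S (p, e / 4, M)"
      using eventually_happens'[OF _ eventually_conj[OF n(1) evG]] by blast
    then obtain Y where Y: "Y \<in> M" "hat p (Y \<ominus>\<^bsub>K\<^esub> emb a) < e / 4" and ac: "a \<in> carrier A" by (auto simp: S_def)
    have Yc: "Y \<in> carrier K" using Y M by auto
    have "(\<lambda>_::nat. p (a \<ominus> x n)) \<longlonglongrightarrow> hat p (emb a \<ominus>\<^bsub>K\<^esub> emb (x n))"
      using p ac xn by (intro hat_tendsto conv_diff conv_emb)
    then have eq: "p (a \<ominus> x n) = hat p (emb a \<ominus>\<^bsub>K\<^esub> emb (x n))" by (simp add: LIMSEQ_const_iff)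
    show "\<forall>\<^sub>F X in \<F>. X \<in> carrier K \<and> p' (X \<ominus>\<^bsub>K\<^esub> L) < e"
      using M(1)
    proof (rule eventually_mono)
      fix X assume X: "X \<in> M"
      then have Xc: "X \<in> carrier K" using M by auto
      note ea = emb_closed[OF ac] and ex = emb_closed[OF xn]
      \<comment> \<open>Four steps of e/4 each: inside M from X to Y, from Y to the trace point a,
        from a to the approximating point \<open>x n\<close>, and from there to L.\<close>
      have "hat p (X \<ominus>\<^bsub>K\<^esub> L) \<le> hat p (X \<ominus>\<^bsub>K\<^esub> Y) + (hat p (Y \<ominus>\<^bsub>K\<^esub> emb a) +
          (hat p (emb a \<ominus>\<^bsub>K\<^esub> emb (x n)) + hat p (emb (x n) \<ominus>\<^bsub>K\<^esub> L)))"
        using k.diff_triangle[OF Xc Yc L] k.diff_triangle[OF Yc ea L] k.diff_triangle[OF ea ex L] by linarith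
      also have "hat p (X \<ominus>\<^bsub>K\<^esub> Y) < e / 4" using M(3) X Y by blast
      then have "hat p (X \<ominus>\<^bsub>K\<^esub> Y) + (hat p (Y \<ominus>\<^bsub>K\<^esub> emb a) +
          (hat p (emb a \<ominus>\<^bsub>K\<^esub> emb (x n)) + hat p (emb (x n) \<ominus>\<^bsub>K\<^esub> L))) < e"
        using Y(2) a(1) n(2) k.diff_commute[OF L ex] unfolding eq by linarith
      finally show "X \<in> carrier K \<and> p' (X \<ominus>\<^bsub>K\<^esub> L) < e" using Xc p(2) by simp
    qed
  qed
  then show "\<exists>l. limitin (topol K) (\<lambda>x. x) l \<F>" ..
qed

theorem K_star_algebra_K: "K_star_algebra K"
  unfolding K_star_algebra_def using K.LC Hausdorff_K complete_K by blast

lemma emb_add: "a \<in> carrier A \<Longrightarrow> b \<in> carrier A \<Longrightarrow> emb (a \<oplus> b) = emb a \<oplus>\<^bsub>K\<^esub> emb b"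
  by (rule conv_eqI) (auto simp: K_closed intro!: exI[of _ "\<lambda>_. a \<oplus> b"] conv_emb conv_add)

lemma emb_mult: "a \<in> carrier A \<Longrightarrow> b \<in> carrier A \<Longrightarrow> emb (a \<otimes> b) = emb a \<otimes>\<^bsub>K\<^esub> emb b"
  by (rule conv_eqI) (auto simp: K_closed intro!: exI[of _ "\<lambda>_. a \<otimes> b"] conv_emb conv_mult)

lemma emb_scale: "a \<in> carrier A \<Longrightarrow> emb (c \<odot> a) = c \<odot>\<^bsub>K\<^esub> emb a"
  by (rule conv_eqI) (auto simp: K_closed intro!: exI[of _ "\<lambda>_. c \<odot> a"] conv_emb conv_scale)

lemma emb_star: "a \<in> carrier A \<Longrightarrow> emb (star A a) = star K (emb a)"
  by (rule conv_eqI)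
    (auto simp: K_closed star_closed intro!: exI[of _ "\<lambda>_. star A a"] conv_emb conv_star)

lemma emb_morphism: "emb \<in> star_morphisms A K"
proof (rule star_morphismsI)
  have "cstar_linear_map A P K (hat ` P) emb"
    by unfold_locales (auto simp: emb_closed emb_add emb_scale)
  then show "continuous_map (topol A) (topol K) emb"
    by (rule cstar_linear_map.continuousI) (auto simp: hat_emb intro!: exI[of _ "1::real"])
qed (simp_all add: emb_closed emb_add emb_mult emb_scale emb_star K_one)

end

section \<open>Extension of morphisms to the completion\<close>

context cstar_seminormed begin

text \<open>Convergence for a single seminorm; limits are determined only up to elements of seminorm
  0. Equality is recovered later by letting the seminorm vary in a Hausdorff algebra.\<close>

definition converges :: "(nat \<Rightarrow> 'a) \<Rightarrow> 'a \<Rightarrow> bool" where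
  "converges z l \<longleftrightarrow> (\<forall>n. z n \<in> carrier A) \<and> l \<in> carrier A \<and> (\<lambda>n. p (z n \<ominus> l)) \<longlonglongrightarrow> 0"

lemma convergesI:
  assumes "\<And>n. z n \<in> carrier A" "l \<in> carrier A" "\<And>n. p (z n \<ominus> l) \<le> e n" "e \<longlonglongrightarrow> 0"
  shows "converges z l"
  unfolding converges_def
  using assms by (auto intro!: tendsto_sandwich[OF _ _ tendsto_const assms(4)] always_eventually)

lemma convergesD:
  assumes "converges z l"
  shows "z n \<in> carrier A" "l \<in> carrier A" "(\<lambda>n. p (z n \<ominus> l)) \<longlonglongrightarrow> 0"
  using assms by (auto simp: converges_def)

lemma converges_norm:
  assumes "converges z l" shows "(\<lambda>n. p (z n)) \<longlonglongrightarrow> p l"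
proof (rule LIM_zero_cancel, rule Lim_null_comparison[OF always_eventually convergesD(3)[OF assms]], rule allI)
  show "norm (p (z n) - p l) \<le> p (z n \<ominus> l)" for n
    using reverse_triangle[of "z n" l] convergesD[OF assms] by simp
qed

lemma converges_add:
  assumes "converges z l" "converges y m" shows "converges (\<lambda>n. z n \<oplus> y n) (l \<oplus> m)"
proof (rule convergesI)
  show "p ((z n \<oplus> y n) \<ominus> (l \<oplus> m)) \<le> p (z n \<ominus> l) + p (y n \<ominus> m)" for n
    using assms[THEN convergesD(1)] assms[THEN convergesD(2)] by (simp add: add_diff_add triangle)
  show "(\<lambda>n. p (z n \<ominus> l) + p (y n \<ominus> m)) \<longlonglongrightarrow> 0"
    using tendsto_add[OF assms[THEN convergesD(3)]] by simp
qed (use assms in \<open>auto simp: converges_def\<close>)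

lemma converges_mult:
  assumes "converges z l" "converges y m" shows "converges (\<lambda>n. z n \<otimes> y n) (l \<otimes> m)"
proof (rule convergesI)
  note c = assms[THEN convergesD(1)] assms[THEN convergesD(2)]
  show "p (z n \<otimes> y n \<ominus> l \<otimes> m) \<le> p (z n) * p (y n \<ominus> m) + p (z n \<ominus> l) * p m" for n
  proof -
    have "p (z n \<otimes> y n \<ominus> l \<otimes> m) \<le> p (z n \<otimes> (y n \<ominus> m)) + p ((z n \<ominus> l) \<otimes> m)"
      using c by (subst mult_diff_mult) (auto intro: triangle)
    also have "\<dots> \<le> p (z n) * p (y n \<ominus> m) + p (z n \<ominus> l) * p m"
      using c by (intro add_mono submult) auto
    finally show ?thesis .
  qed
  have "(\<lambda>n. p (z n) * p (y n \<ominus> m) + p (z n \<ominus> l) * p m) \<longlonglongrightarrow> p l * 0 + 0 * p m"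
    using assms by (intro tendsto_intros converges_norm convergesD(3))
  then show "(\<lambda>n. p (z n) * p (y n \<ominus> m) + p (z n \<ominus> l) * p m) \<longlonglongrightarrow> 0" by simp
qed (use assms in \<open>auto simp: converges_def\<close>)

lemma converges_scale:
  assumes "converges z l" shows "converges (\<lambda>n. c \<odot> z n) (c \<odot> l)"
proof (rule convergesI)
  show "p (c \<odot> z n \<ominus> c \<odot> l) \<le> cmod c * p (z n \<ominus> l)" for n
    using convergesD[OF assms] by (simp add: scale flip: scale_diff_right)
  show "(\<lambda>n. cmod c * p (z n \<ominus> l)) \<longlonglongrightarrow> 0"
    using tendsto_mult_left[OF convergesD(3)[OF assms], of "cmod c"] by simp
qed (use assms in \<open>auto simp: converges_def\<close>)

lemma converges_star:
  assumes "converges z l" shows "converges (\<lambda>n. star A (z n)) (star A l)"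
proof (rule convergesI)
  show "p (star A (z n) \<ominus> star A l) \<le> p (z n \<ominus> l)" for n
    using convergesD[OF assms] by (simp add: star_eq flip: star_diff)
qed (use assms in \<open>auto simp: converges_def star_closed\<close>)

lemma converges_const: "l \<in> carrier A \<Longrightarrow> converges (\<lambda>_. l) l"
  by (simp add: converges_def diff_self)

lemma converges_unique:
  assumes "converges z l" "converges z m" shows "p (l \<ominus> m) = 0"
proof -
  have "(\<lambda>n. p (z n \<ominus> l) + p (z n \<ominus> m)) \<longlonglongrightarrow> 0 + 0"
    using assms by (intro tendsto_add convergesD(3))
  moreover have "p (l \<ominus> m) \<le> p (z n \<ominus> l) + p (z n \<ominus> m)" for n
    using assms[THEN convergesD(1)] assms[THEN convergesD(2)] diff_triangle[of l "z n" m] diff_commute[of l "z n"] by simp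
  ultimately have "p (l \<ominus> m) \<le> 0 + 0" by (intro LIMSEQ_le_const) auto
  then show ?thesis using assms[THEN convergesD(2)] by (intro antisym) auto
qed

end

text \<open>Density of the image of A. Continuity bounds both morphisms by one seminorm of the
  completion, and their difference is already zero on the dense part.\<close>

lemma completion_unique:
  assumes A: "cstar_topology A P" and C: "K_star_algebra C"
    and w: "w \<in> star_morphisms (hausdorff_completion A) C" and w': "w' \<in> star_morphisms (hausdorff_completion A) C"
    and eq: "\<And>a. a \<in> carrier A \<Longrightarrow> w (completion_map A a) = w' (completion_map A a)"
    and X: "X \<in> carrier (hausdorff_completion A)"
  shows "w X = w' X"
proof -
  interpret cstar_topology A P by fact
  interpret K: cstar_topology K "hat ` P" by (rule cstar_topology_K)
  obtain Q where "cstar_topology C Q"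
    using C LC_star_algebra_cstar_topology unfolding K_star_algebra_def by blast
  then interpret C: cstar_topology C Q .
  interpret w: cstar_linear_map K "hat ` P" C Q w
    by (rule star_morphism_linear_map[OF K.cstar_topology_axioms C.cstar_topology_axioms w])
  interpret w': cstar_linear_map K "hat ` P" C Q w'
    by (rule star_morphism_linear_map[OF K.cstar_topology_axioms C.cstar_topology_axioms w'])
  have "w X \<ominus>\<^bsub>C\<^esub> w' X = \<zero>\<^bsub>C\<^esub>"
  proof (rule C.Hausdorff_separated)
    show "Hausdorff_space (topol C)" using C by (simp add: K_star_algebra_def)
    show "w X \<ominus>\<^bsub>C\<^esub> w' X \<in> carrier C" using X w.u_closed w'.u_closed by simp
    fix q assume q: "q \<in> Q"
    interpret q: seminormed C q by (rule C.P_seminormed[OF q])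
    obtain p1 k1 where p1: "p1 \<in> hat ` P" "k1 > 0" "\<And>X. X \<in> carrier K \<Longrightarrow> q (w X) \<le> k1 * p1 X"
      using w.continuousD[OF star_morphismsD(7)[OF w] q] by metis
    obtain p2 k2 where p2: "p2 \<in> hat ` P" "k2 > 0" "\<And>X. X \<in> carrier K \<Longrightarrow> q (w' X) \<le> k2 * p2 X"
      using w'.continuousD[OF star_morphismsD(7)[OF w'] q] by metis
    obtain p where p: "p \<in> hat ` P" "\<And>x. x \<in> carrier K \<Longrightarrow> p1 x \<le> p x" "\<And>x. x \<in> carrier K \<Longrightarrow> p2 x \<le> p x"
      using K.P_dominates[OF p1(1) p2(1)] by metis
    interpret p: seminormed K p by (rule K.P_seminormed[OF p(1)])
    obtain p' where p': "p' \<in> P" "p = hat p'" using p(1) by blast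
    have "q (w X \<ominus>\<^bsub>C\<^esub> w' X) \<le> 0"
    proof (rule field_le_epsilon)
      fix e :: real assume e: "e > 0"
      obtain a where a: "a \<in> carrier A" "p (X \<ominus>\<^bsub>K\<^esub> emb a) < e / (k1 + k2)"
        using emb_dense[OF p'(1) X, of "e / (k1 + k2)"] e p1(2) p2(2) unfolding p'(2) by auto
      note ea = emb_closed[OF a(1)]
      define D where "D = X \<ominus>\<^bsub>K\<^esub> emb a"
      have D: "D \<in> carrier K" using X ea by (simp add: D_def)
      \<comment> \<open>Both morphisms agree on \<open>emb a\<close>, so only the small remainder D
        contributes.\<close>
      have "w X \<ominus>\<^bsub>C\<^esub> w' X = w D \<ominus>\<^bsub>C\<^esub> w' D"
        using X ea eq[OF a(1)] w.u_closed w'.u_closed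
        by (simp add: D_def w.u_diff w'.u_diff C.diff_diff_diff[of "w X"] C.diff_self)
      also have "q (w D \<ominus>\<^bsub>C\<^esub> w' D) \<le> q (w D) + q (w' D)"
        using D w.u_closed w'.u_closed by (intro q.triangle_diff)
      also have "\<dots> \<le> k1 * p D + k2 * p D"
        using p1(3)[OF D] p2(3)[OF D] mult_left_mono[OF p(2)[OF D] less_imp_le[OF p1(2)]]
          mult_left_mono[OF p(3)[OF D] less_imp_le[OF p2(2)]] by linarith
      also have "\<dots> \<le> e" using a(2) p1(2) p2(2) by (simp add: D_def field_simps)
      finally show "q (w X \<ominus>\<^bsub>C\<^esub> w' X) \<le> 0 + e" by simp
    qed
    moreover have "0 \<le> q (w X \<ominus>\<^bsub>C\<^esub> w' X)" using X w.u_closed w'.u_closed by simp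
    ultimately show "q (w X \<ominus>\<^bsub>C\<^esub> w' X) = 0" by simp
  qed
  then show ?thesis by (rule C.diff_eq_zeroD[OF w.u_closed[OF X] w'.u_closed[OF X]])
qed

text \<open>Completeness provides a limit of the image of one representative filter. All further
  properties of w are checked along approximating sequences, for one seminorm of C at a
  time.\<close>

lemma completion_extension:
  assumes A: "cstar_topology A P" and C: "K_star_algebra C" and u: "u \<in> star_morphisms A C"
  obtains w where "w \<in> star_morphisms (hausdorff_completion A) C"
    "\<And>a. a \<in> carrier A \<Longrightarrow> w (completion_map A a) = u a"
proof -
  interpret cstar_topology A P by fact
  interpret K: cstar_topology K "hat ` P" by (rule cstar_topology_K)
  obtain Q where "cstar_topology C Q"
    using C LC_star_algebra_cstar_topology unfolding K_star_algebra_def by blast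
  then interpret C: cstar_topology C Q .
  interpret u: cstar_linear_map A P C Q u
    by (rule star_morphism_linear_map[OF A C.cstar_topology_axioms u])
  note uD = star_morphismsD[OF u]
  have complete: "complete_algebra C" and T2: "Hausdorff_space (topol C)"
    using C by (auto simp: K_star_algebra_def)
  have cauchy: "filtermap u F \<in> cauchy_filters C" if F: "F \<in> cauchy_filters A" for F
    unfolding cauchy_filters_def
  proof (intro CollectI conjI)
    have Fc: "F \<noteq> bot" "\<forall>\<^sub>F x in F. x \<in> carrier A" "uniformly_close A F F"
      using F by (auto simp: cauchy_filters_def)
    show "filtermap u F \<noteq> bot" using Fc(1) by (simp add: filtermap_bot_iff)
    show "\<forall>\<^sub>F x in filtermap u F. x \<in> carrier C"
      unfolding eventually_filtermap using Fc(2) by (rule eventually_mono) (rule uD(1))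
    show "uniformly_close C (filtermap u F) (filtermap u F)"
      unfolding uniformly_close_def
    proof (intro allI impI)
      fix V assume V: "openin (topol C) V \<and> \<zero>\<^bsub>C\<^esub> \<in> V"
      let ?U = "{x \<in> topspace (topol A). u x \<in> V}"
      have "openin (topol A) ?U" "\<zero>\<^bsub>A\<^esub> \<in> ?U"
        using V openin_continuous_map_preimage[OF uD(7)] by (auto simp: u.u_zero)
      then have "\<forall>\<^sub>F (x, y) in F \<times>\<^sub>F F. x \<ominus>\<^bsub>A\<^esub> y \<in> ?U" using Fc(3) unfolding uniformly_close_def by blast
      then obtain R where R: "eventually R F" "\<And>x y. R x \<Longrightarrow> R y \<Longrightarrow> x \<ominus>\<^bsub>A\<^esub> y \<in> ?U"
        unfolding eventually_prod_same by auto
      have "\<forall>\<^sub>F z in filtermap u F. \<exists>x. R x \<and> x \<in> carrier A \<and> z = u x"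
        unfolding eventually_filtermap using eventually_conj[OF R(1) Fc(2)] by (rule eventually_mono) auto
      from this this show "\<forall>\<^sub>F (x, y) in filtermap u F \<times>\<^sub>F filtermap u F. x \<ominus>\<^bsub>C\<^esub> y \<in> V"
      proof (rule eventually_prod_filterI)
        fix a b assume "\<exists>x. R x \<and> x \<in> carrier A \<and> a = u x" "\<exists>x. R x \<and> x \<in> carrier A \<and> b = u x"
        then obtain x y where "R x" "x \<in> carrier A" "a = u x" "R y" "y \<in> carrier A" "b = u y" by blast
        then show "case (a, b) of (x, y) \<Rightarrow> x \<ominus>\<^bsub>C\<^esub> y \<in> V" using R(2)[of x y] by (simp add: u.u_diff)
      qed
    qed
  qed
  have "\<exists>l. \<exists>F\<in>X. F \<in> cauchy_filters A \<and> limitin (topol C) (\<lambda>x. x) l (filtermap u F)" if X: "X \<in> carrier K" for X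
    using carrier_KE[OF X] cauchy complete unfolding complete_algebra_def by metis
  then obtain w where w: "\<And>X. X \<in> carrier K \<Longrightarrow>
      \<exists>F\<in>X. F \<in> cauchy_filters A \<and> limitin (topol C) (\<lambda>x. x) (w X) (filtermap u F)"
    by metis
  have wc: "w X \<in> carrier C" if "X \<in> carrier K" for X
    using w[OF that] by (auto simp: C.limitin_iff)
  have bd: "\<exists>p\<in>P. \<exists>k>0. \<forall>x\<in>carrier A. q (u x) \<le> k * p x" if "q \<in> Q" for q
    using u.continuousD[OF uD(7) that] by metis
  \<comment> \<open>Whichever representative was chosen for X, the images of every sequence
    approximating X for p converge to \<open>w X\<close>; this frees w from the choice.\<close>
  have lim: "cstar_seminormed.converges C q (\<lambda>n. u (x n)) (w X)"
    if q: "q \<in> Q" and p: "p \<in> P" and k: "k > 0" "\<forall>x\<in>carrier A. q (u x) \<le> k * p x" and x: "conv p x X"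
    for q p k x X
  proof -
    interpret q: cstar_seminormed C q by (rule C.P_cstar_seminormed[OF q])
    note X = conv_carrier[OF x] and xc = conv_seq_carrier[OF x]
    obtain F where F: "F \<in> X" "F \<in> cauchy_filters A" "limitin (topol C) (\<lambda>x. x) (w X) (filtermap u F)"
      using w[OF X] by blast
    have fc: "filter_conv p x F" using x F(1) by (simp add: conv_def)
    have Fc: "\<forall>\<^sub>F a in F. a \<in> carrier A" "F \<noteq> bot" using F by (auto simp: cauchy_filters_def)
    have "(\<lambda>n. q (u (x n) \<ominus>\<^bsub>C\<^esub> w X)) \<longlonglongrightarrow> 0"
    proof (rule order_tendstoI)
      fix a :: real assume "a < 0"
      then have "a < q (u (x n) \<ominus>\<^bsub>C\<^esub> w X)" for n
        using q.nonneg[of "u (x n) \<ominus>\<^bsub>C\<^esub> w X"] uD(1)[OF xc[of n]] wc[OF X] by (auto intro: less_le_trans)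
      then show "\<forall>\<^sub>F n in sequentially. a < q (u (x n) \<ominus>\<^bsub>C\<^esub> w X)" by simp
    next
      fix e :: real assume e: "0 < e"
      have l: "\<forall>\<^sub>F a in F. u a \<in> carrier C \<and> q (u a \<ominus>\<^bsub>C\<^esub> w X) < e / 2"
        using F(3) q half_gt_zero[OF e] unfolding C.limitin_iff eventually_filtermap by blast
      have "\<forall>\<^sub>F n in sequentially. \<forall>\<^sub>F a in F. p (a \<ominus>\<^bsub>A\<^esub> x n) < e / (2 * k)"
        using e k by (intro filter_convD[OF fc]) simp
      then show "\<forall>\<^sub>F n in sequentially. q (u (x n) \<ominus>\<^bsub>C\<^esub> w X) < e"
      proof (rule eventually_mono)
        fix n assume n: "\<forall>\<^sub>F a in F. p (a \<ominus>\<^bsub>A\<^esub> x n) < e / (2 * k)"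
        obtain a where a: "a \<in> carrier A" "p (a \<ominus>\<^bsub>A\<^esub> x n) < e / (2 * k)" "q (u a \<ominus>\<^bsub>C\<^esub> w X) < e / 2"
          using eventually_happens'[OF Fc(2) eventually_conj[OF Fc(1) eventually_conj[OF n l]]] by blast
        have "q (u a \<ominus>\<^bsub>C\<^esub> u (x n)) \<le> k * p (a \<ominus>\<^bsub>A\<^esub> x n)"
          using k(2) a(1) xc by (simp flip: u.u_diff)
        also have "\<dots> < e / 2" using a(2) k(1) by (simp add: field_simps)
        finally have "q (u (x n) \<ominus>\<^bsub>C\<^esub> u a) < e / 2"
          using q.diff_commute[OF uD(1)[OF a(1)] uD(1)[OF xc]] by simp
        then show "q (u (x n) \<ominus>\<^bsub>C\<^esub> w X) < e"
          using q.diff_triangle[OF uD(1)[OF xc] uD(1)[OF a(1)] wc[OF X], of n] a(3) by simp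
      qed
    qed
    then show ?thesis using uD(1) xc wc[OF X] by (simp add: q.converges_def)
  qed
  \<comment> \<open>Two elements of C are equal if for each seminorm q some sequence converges to
    both: their difference then has seminorm 0 for all q, and C is Hausdorff.\<close>
  have eqI: "l = m" if l: "l \<in> carrier C" and m: "m \<in> carrier C" and
    shared: "\<And>q p k. \<lbrakk>q \<in> Q; p \<in> P; k > 0; \<forall>x\<in>carrier A. q (u x) \<le> k * p x\<rbrakk> \<Longrightarrow>
      \<exists>z. cstar_seminormed.converges C q z l \<and> cstar_seminormed.converges C q z m" for l m
  proof -
    have "l \<ominus>\<^bsub>C\<^esub> m = \<zero>\<^bsub>C\<^esub>"
    proof (rule C.Hausdorff_separated[OF T2])
      show "l \<ominus>\<^bsub>C\<^esub> m \<in> carrier C" using l m by simp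
      fix q assume q: "q \<in> Q"
      interpret q: cstar_seminormed C q by (rule C.P_cstar_seminormed[OF q])
      obtain p k where "p \<in> P" "k > 0" "\<forall>x\<in>carrier A. q (u x) \<le> k * p x" using bd[OF q] by blast
      then obtain z where "q.converges z l" "q.converges z m" using shared[OF q] by blast
      then show "q (l \<ominus>\<^bsub>C\<^esub> m) = 0" by (rule q.converges_unique)
    qed
    then show ?thesis by (rule C.diff_eq_zeroD[OF l m])
  qed
  have emb: "w (emb a) = u a" if a: "a \<in> carrier A" for a
  proof (rule eqI)
    show "w (emb a) \<in> carrier C" "u a \<in> carrier C" using a wc emb_closed uD(1) by auto
    fix q p k assume q: "q \<in> Q" and p: "p \<in> P" and k: "k > 0" "\<forall>x\<in>carrier A. q (u x) \<le> k * p x"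
    interpret q: cstar_seminormed C q by (rule C.P_cstar_seminormed[OF q])
    show "\<exists>z. q.converges z (w (emb a)) \<and> q.converges z (u a)"
      using lim[OF q p k conv_emb[OF p a]] q.converges_const[OF uD(1)[OF a]] by blast
  qed
  have w_scale: "w (c \<odot>\<^bsub>K\<^esub> X) = c \<odot>\<^bsub>C\<^esub> w X" if X: "X \<in> carrier K" for c X
  proof (rule eqI)
    show "w (c \<odot>\<^bsub>K\<^esub> X) \<in> carrier C" "c \<odot>\<^bsub>C\<^esub> w X \<in> carrier C" using X wc by auto
    fix q p k assume q: "q \<in> Q" and p: "p \<in> P" and k: "k > 0" "\<forall>x\<in>carrier A. q (u x) \<le> k * p x"
    interpret q: cstar_seminormed C q by (rule C.P_cstar_seminormed[OF q])
    obtain x where x: "conv p x X" using exists_conv[OF X p] .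
    show "\<exists>z. q.converges z (w (c \<odot>\<^bsub>K\<^esub> X)) \<and> q.converges z (c \<odot>\<^bsub>C\<^esub> w X)"
      using lim[OF q p k conv_scale[OF p x, of c]] q.converges_scale[OF lim[OF q p k x], of c]
      by (auto simp: uD(5) conv_seq_carrier[OF x])
  qed
  have w_add: "w (X \<oplus>\<^bsub>K\<^esub> Y) = w X \<oplus>\<^bsub>C\<^esub> w Y" if X: "X \<in> carrier K" and Y: "Y \<in> carrier K" for X Y
  proof (rule eqI)
    show "w (X \<oplus>\<^bsub>K\<^esub> Y) \<in> carrier C" "w X \<oplus>\<^bsub>C\<^esub> w Y \<in> carrier C" using X Y wc by auto
    fix q p k assume q: "q \<in> Q" and p: "p \<in> P" and k: "k > 0" "\<forall>x\<in>carrier A. q (u x) \<le> k * p x"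
    interpret q: cstar_seminormed C q by (rule C.P_cstar_seminormed[OF q])
    obtain x y where x: "conv p x X" and y: "conv p y Y" using exists_conv2[OF X Y p] .
    show "\<exists>z. q.converges z (w (X \<oplus>\<^bsub>K\<^esub> Y)) \<and> q.converges z (w X \<oplus>\<^bsub>C\<^esub> w Y)"
      using lim[OF q p k conv_add[OF p x y]] q.converges_add[OF lim[OF q p k x] lim[OF q p k y]]
      by (auto simp: uD(2) conv_seq_carrier[OF x] conv_seq_carrier[OF y])
  qed
  have "w \<in> star_morphisms K C"
  proof (rule star_morphismsI)
    fix X assume X: "X \<in> carrier K"
    show "w X \<in> carrier C" by (rule wc[OF X])
    show "w (c \<odot>\<^bsub>K\<^esub> X) = c \<odot>\<^bsub>C\<^esub> w X" for c by (rule w_scale[OF X])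
    show "w (star K X) = star C (w X)"
    proof (rule eqI)
      show "w (star K X) \<in> carrier C" "star C (w X) \<in> carrier C" using X wc C.star_closed K.star_closed by auto
      fix q p k assume q: "q \<in> Q" and p: "p \<in> P" and k: "k > 0" "\<forall>x\<in>carrier A. q (u x) \<le> k * p x"
      interpret q: cstar_seminormed C q by (rule C.P_cstar_seminormed[OF q])
      obtain x where x: "conv p x X" using exists_conv[OF X p] .
      show "\<exists>z. q.converges z (w (star K X)) \<and> q.converges z (star C (w X))"
        using lim[OF q p k conv_star[OF p x]] q.converges_star[OF lim[OF q p k x]]
        by (auto simp: uD(6) conv_seq_carrier[OF x])
    qed
    fix Y assume Y: "Y \<in> carrier K"
    show "w (X \<oplus>\<^bsub>K\<^esub> Y) = w X \<oplus>\<^bsub>C\<^esub> w Y" by (rule w_add[OF X Y])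
    show "w (X \<otimes>\<^bsub>K\<^esub> Y) = w X \<otimes>\<^bsub>C\<^esub> w Y"
    proof (rule eqI)
      show "w (X \<otimes>\<^bsub>K\<^esub> Y) \<in> carrier C" "w X \<otimes>\<^bsub>C\<^esub> w Y \<in> carrier C" using X Y wc by auto
      fix q p k assume q: "q \<in> Q" and p: "p \<in> P" and k: "k > 0" "\<forall>x\<in>carrier A. q (u x) \<le> k * p x"
      interpret q: cstar_seminormed C q by (rule C.P_cstar_seminormed[OF q])
      obtain x y where x: "conv p x X" and y: "conv p y Y" using exists_conv2[OF X Y p] .
      show "\<exists>z. q.converges z (w (X \<otimes>\<^bsub>K\<^esub> Y)) \<and> q.converges z (w X \<otimes>\<^bsub>C\<^esub> w Y)"
        using lim[OF q p k conv_mult[OF p x y]] q.converges_mult[OF lim[OF q p k x] lim[OF q p k y]]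
        by (auto simp: uD(3) conv_seq_carrier[OF x] conv_seq_carrier[OF y])
    qed
  next
    show "w \<one>\<^bsub>K\<^esub> = \<one>\<^bsub>C\<^esub>" using emb[of "\<one>\<^bsub>A\<^esub>"] uD(4) by (simp add: K_one)
    show "continuous_map (topol K) (topol C) w"
    proof (rule cstar_linear_map.continuousI)
      show "cstar_linear_map K (hat ` P) C Q w"
        by unfold_locales (simp_all add: wc w_scale w_add)
      fix q assume q: "q \<in> Q"
      interpret q: cstar_seminormed C q by (rule C.P_cstar_seminormed[OF q])
      obtain p k where p: "p \<in> P" and k: "k > 0" "\<forall>x\<in>carrier A. q (u x) \<le> k * p x" using bd[OF q] by blast
      have "q (w X) \<le> k * hat p X" if X: "X \<in> carrier K" for X
      proof -
        obtain x where x: "conv p x X" using exists_conv[OF X p] .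
        from q.converges_norm[OF lim[OF q p k x]] tendsto_mult_left[OF hat_tendsto[OF p x], of k]
        show ?thesis by (rule LIMSEQ_le) (use k(2) conv_seq_carrier[OF x] in auto)
      qed
      then show "\<exists>p\<in>hat ` P. \<exists>k. \<forall>x\<in>carrier K. q (w x) \<le> k * p x" using p by blast
    qed
  qed
  then show thesis using emb by (rule that)
qed

section \<open>The algebraic tensor product\<close>

lemma poly_mapping_eq_sum_single:
  fixes f :: "'k \<Rightarrow>\<^sub>0 'c::comm_monoid_add"
  shows "f = (\<Sum>k\<in>Poly_Mapping.keys f. Poly_Mapping.single k (Poly_Mapping.lookup f k))"
proof (rule poly_mapping_eqI)
  fix k
  have "(\<Sum>j\<in>Poly_Mapping.keys f. Poly_Mapping.lookup (Poly_Mapping.single j (Poly_Mapping.lookup f j)) k)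
      = (\<Sum>j\<in>Poly_Mapping.keys f. if k = j then Poly_Mapping.lookup f j else 0)"
    by (intro sum.cong) (auto simp: lookup_single when_def)
  also have "\<dots> = Poly_Mapping.lookup f k" by (simp add: sum.delta in_keys_iff)
  finally show "Poly_Mapping.lookup f k =
      Poly_Mapping.lookup (\<Sum>k\<in>Poly_Mapping.keys f. Poly_Mapping.single k (Poly_Mapping.lookup f k)) k"
    by (simp add: lookup_sum)
qed

lemma keys_subset_induct [consumes 1, case_names zero single add]:
  fixes f :: "'k \<Rightarrow>\<^sub>0 'c::comm_monoid_add"
  assumes f: "Poly_Mapping.keys f \<subseteq> S" and zero: "P 0"
    and single: "\<And>k c. k \<in> S \<Longrightarrow> P (Poly_Mapping.single k c)"
    and add: "\<And>f g. Poly_Mapping.keys f \<subseteq> S \<Longrightarrow> Poly_Mapping.keys g \<subseteq> S \<Longrightarrow> P f \<Longrightarrow> P g \<Longrightarrow> P (f + g)"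
  shows "P f"
proof -
  have "Poly_Mapping.keys (\<Sum>k\<in>J. Poly_Mapping.single k (h k)) \<subseteq> S \<and> P (\<Sum>k\<in>J. Poly_Mapping.single k (h k))"
    if "finite J" "J \<subseteq> S" for J and h :: "'k \<Rightarrow> 'c"
    using that
  proof (induction J)
    case empty then show ?case using zero by simp
  next
    case (insert j J)
    have "Poly_Mapping.keys (Poly_Mapping.single j (h j)) \<subseteq> S" using insert.prems by simp
    then show ?case
      using insert add[of "Poly_Mapping.single j (h j)"] single
        keys_add[of "Poly_Mapping.single j (h j)" "\<Sum>k\<in>J. Poly_Mapping.single k (h k)"]
      by auto
  qed
  then show ?thesis using f finite_keys poly_mapping_eq_sum_single[of f] by metis
qed

lemma lookup_map_times [simp]:
  fixes f :: "'k \<Rightarrow>\<^sub>0 'c::semiring_0"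
  shows "Poly_Mapping.lookup (Poly_Mapping.map ((*) c) f) k = c * Poly_Mapping.lookup f k"
  by (simp add: map.rep_eq when_def)

lemma keys_map_times_subset:
  fixes f :: "'k \<Rightarrow>\<^sub>0 'c::semiring_0"
  shows "Poly_Mapping.keys (Poly_Mapping.map ((*) c) f) \<subseteq> Poly_Mapping.keys f"
  by (auto simp: in_keys_iff)

lemma map_times_add:
  fixes f g :: "'k \<Rightarrow>\<^sub>0 'c::semiring_0"
  shows "Poly_Mapping.map ((*) c) (f + g) = Poly_Mapping.map ((*) c) f + Poly_Mapping.map ((*) c) g"
  by (rule poly_mapping_eqI) (simp add: lookup_add distrib_left)

lemma map_times_single:
  fixes c d :: "'c::semiring_0"
  shows "Poly_Mapping.map ((*) c) (Poly_Mapping.single k d) = Poly_Mapping.single k (c * d)"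
  by (rule poly_mapping_eqI) (simp add: lookup_single when_def)

section \<open>The free star algebra on pairs\<close>

locale star_algebra_pair = A: star_algebra A + B: star_algebra B
  for A :: "('a, 'm) star_alg_scheme" (structure) and B :: "('b, 'n) star_alg_scheme" (structure)
begin

abbreviation F where "F \<equiv> free_algebra A B"
abbreviation N where "N \<equiv> tensor_kernel A B"
abbreviation T where "T \<equiv> tensor_algebra A B"

lemma carrier_F: "f \<in> carrier F \<longleftrightarrow> Poly_Mapping.keys f \<subseteq> carrier A \<times> carrier B"
  and add_F [simp]: "f \<oplus>\<^bsub>F\<^esub> g = f + g"
  and zero_F [simp]: "\<zero>\<^bsub>F\<^esub> = 0"
  and one_F: "\<one>\<^bsub>F\<^esub> = Poly_Mapping.single (\<one>\<^bsub>A\<^esub>, \<one>\<^bsub>B\<^esub>) 1"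
  and scale_F: "c \<odot>\<^bsub>F\<^esub> f = Poly_Mapping.map ((*) c) f"
  and mult_F: "f \<otimes>\<^bsub>F\<^esub> g = (\<Sum>u\<in>Poly_Mapping.keys f. \<Sum>v\<in>Poly_Mapping.keys g.
        Poly_Mapping.single (fst u \<otimes>\<^bsub>A\<^esub> fst v, snd u \<otimes>\<^bsub>B\<^esub> snd v)
          (Poly_Mapping.lookup f u * Poly_Mapping.lookup g v))"
  and star_F: "star F f = (\<Sum>u\<in>Poly_Mapping.keys f.
        Poly_Mapping.single (star A (fst u), star B (snd u)) (cnj (Poly_Mapping.lookup f u)))"
  by (simp_all add: free_algebra_def)

lemma F_induct [consumes 1, case_names zero single add]:
  assumes "f \<in> carrier F" and "P 0"
    and "\<And>a b c. a \<in> carrier A \<Longrightarrow> b \<in> carrier B \<Longrightarrow> P (Poly_Mapping.single (a, b) c)"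
    and "\<And>f g. f \<in> carrier F \<Longrightarrow> g \<in> carrier F \<Longrightarrow> P f \<Longrightarrow> P g \<Longrightarrow> P (f + g)"
  shows "P f"
  using assms(1)[unfolded carrier_F] by (rule keys_subset_induct) (use assms(2-) in \<open>auto simp: carrier_F\<close>)

lemma single_F: "a \<in> carrier A \<Longrightarrow> b \<in> carrier B \<Longrightarrow> Poly_Mapping.single (a, b) c \<in> carrier F"
  by (simp add: carrier_F)

lemma F_add_closed: "f \<in> carrier F \<Longrightarrow> g \<in> carrier F \<Longrightarrow> f + g \<in> carrier F"
  unfolding carrier_F using keys_add[of f g] by blast

lemma F_zero_closed: "0 \<in> carrier F"
  by (simp add: carrier_F)

lemma F_scale_closed: "f \<in> carrier F \<Longrightarrow> c \<odot>\<^bsub>F\<^esub> f \<in> carrier F"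
  using keys_map_times_subset[of c f] by (auto simp: carrier_F scale_F)

lemma F_scale_add: "c \<odot>\<^bsub>F\<^esub> (f + g) = c \<odot>\<^bsub>F\<^esub> f + c \<odot>\<^bsub>F\<^esub> g"
  by (simp add: scale_F map_times_add)

lemma F_scale_single: "c \<odot>\<^bsub>F\<^esub> Poly_Mapping.single k d = Poly_Mapping.single k (c * d)"
  by (simp add: scale_F map_times_single)

lemma F_scale_zero [simp]: "c \<odot>\<^bsub>F\<^esub> 0 = 0"
  by (rule poly_mapping_eqI) (simp add: scale_F)

lemma F_mult_zero [simp]: "0 \<otimes>\<^bsub>F\<^esub> g = 0" "f \<otimes>\<^bsub>F\<^esub> 0 = 0"
  by (simp_all add: mult_F)

text \<open>Zero coefficients are split off, because \<open>Poly_Mapping.single k 0\<close> has no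
  keys and the defining sums are then empty.\<close>

lemma F_mult_single: "Poly_Mapping.single (a, b) c \<otimes>\<^bsub>F\<^esub> Poly_Mapping.single (a', b') d
    = Poly_Mapping.single (a \<otimes>\<^bsub>A\<^esub> a', b \<otimes>\<^bsub>B\<^esub> b') (c * d)"
  by (cases "c = 0"; cases "d = 0") (simp_all add: mult_F)

text \<open>Keys of f and f' may cancel in the sum. Since the summands are additive in the
  coefficient and vanish at coefficient 0, the sum over the keys does not notice this.\<close>

lemma F_mult_add_left: "(f + f') \<otimes>\<^bsub>F\<^esub> g = f \<otimes>\<^bsub>F\<^esub> g + f' \<otimes>\<^bsub>F\<^esub> g"
  unfolding mult_F
  by (rule setsum_keys_plus_distrib) (simp_all add: distrib_right single_add sum.distrib)

lemma F_mult_add_right: "f \<otimes>\<^bsub>F\<^esub> (g + g') = f \<otimes>\<^bsub>F\<^esub> g + f \<otimes>\<^bsub>F\<^esub> g'"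
proof -
  have "(\<Sum>v\<in>Poly_Mapping.keys (g + g').
        Poly_Mapping.single (fst u \<otimes>\<^bsub>A\<^esub> fst v, snd u \<otimes>\<^bsub>B\<^esub> snd v)
          (Poly_Mapping.lookup f u * Poly_Mapping.lookup (g + g') v)) =
      (\<Sum>v\<in>Poly_Mapping.keys g. Poly_Mapping.single (fst u \<otimes>\<^bsub>A\<^esub> fst v, snd u \<otimes>\<^bsub>B\<^esub> snd v)
          (Poly_Mapping.lookup f u * Poly_Mapping.lookup g v)) +
      (\<Sum>v\<in>Poly_Mapping.keys g'. Poly_Mapping.single (fst u \<otimes>\<^bsub>A\<^esub> fst v, snd u \<otimes>\<^bsub>B\<^esub> snd v)
          (Poly_Mapping.lookup f u * Poly_Mapping.lookup g' v))" for u
    by (rule setsum_keys_plus_distrib) (simp_all add: distrib_left single_add)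
  then show ?thesis unfolding mult_F by (simp add: sum.distrib)
qed

lemma F_mult_closed: "f \<in> carrier F \<Longrightarrow> g \<in> carrier F \<Longrightarrow> f \<otimes>\<^bsub>F\<^esub> g \<in> carrier F"
proof (induction f rule: F_induct)
  case (single a b c)
  from single(3) show ?case
    by (induction g rule: F_induct)
      (use single in \<open>auto simp: F_zero_closed F_mult_single F_mult_add_right intro: single_F F_add_closed\<close>)
qed (auto simp: F_zero_closed F_mult_add_left intro: F_add_closed)

lemma F_mult_comm: "f \<in> carrier F \<Longrightarrow> g \<in> carrier F \<Longrightarrow> f \<otimes>\<^bsub>F\<^esub> g = g \<otimes>\<^bsub>F\<^esub> f"
proof (induction f rule: F_induct)
  case (single a b c)
  from single(3) show ?case
    by (induction g rule: F_induct)
      (use single in \<open>auto simp: F_mult_single F_mult_add_right F_mult_add_left A.m_comm B.m_comm mult.commute\<close>)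
qed (auto simp: F_mult_add_left F_mult_add_right)

lemma F_mult_assoc: "f \<in> carrier F \<Longrightarrow> g \<in> carrier F \<Longrightarrow> h \<in> carrier F \<Longrightarrow>
    f \<otimes>\<^bsub>F\<^esub> g \<otimes>\<^bsub>F\<^esub> h = f \<otimes>\<^bsub>F\<^esub> (g \<otimes>\<^bsub>F\<^esub> h)"
proof (induction f rule: F_induct)
  case (single a b c)
  note ab = single(1,2) and h = single(4)
  from single(3) show ?case
  proof (induction g rule: F_induct)
    case (single a' b' c')
    from h show ?case
      by (induction h rule: F_induct)
        (use ab single in \<open>auto simp: F_mult_single F_mult_add_right A.m_assoc B.m_assoc mult.assoc\<close>)
  qed (auto simp: F_mult_add_left F_mult_add_right)
qed (auto simp: F_mult_add_left)

lemma F_one_mult: "f \<in> carrier F \<Longrightarrow> \<one>\<^bsub>F\<^esub> \<otimes>\<^bsub>F\<^esub> f = f"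
  by (induction f rule: F_induct) (auto simp: one_F F_mult_single F_mult_add_right)

lemma F_scale_mult: "f \<in> carrier F \<Longrightarrow> g \<in> carrier F \<Longrightarrow> (c \<odot>\<^bsub>F\<^esub> f) \<otimes>\<^bsub>F\<^esub> g = c \<odot>\<^bsub>F\<^esub> (f \<otimes>\<^bsub>F\<^esub> g)"
proof (induction f rule: F_induct)
  case (single a b d)
  from single(3) show ?case
    by (induction g rule: F_induct)
      (auto simp: F_mult_single F_mult_add_right F_scale_add F_scale_single mult.assoc)
qed (auto simp: F_mult_add_left F_scale_add)

lemma F_star_zero [simp]: "star F 0 = 0"
  by (simp add: star_F)

lemma F_star_add: "star F (f + g) = star F f + star F g"
  unfolding star_F by (rule setsum_keys_plus_distrib) (simp_all add: single_add)

lemma F_star_single: "star F (Poly_Mapping.single (a, b) c) = Poly_Mapping.single (star A a, star B b) (cnj c)"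
  by (cases "c = 0") (simp_all add: star_F)

lemma F_star_closed: "f \<in> carrier F \<Longrightarrow> star F f \<in> carrier F"
  by (induction f rule: F_induct)
    (auto simp: F_zero_closed F_star_single F_star_add A.star_closed B.star_closed intro: single_F F_add_closed)

lemma F_star_star: "f \<in> carrier F \<Longrightarrow> star F (star F f) = f"
  by (induction f rule: F_induct) (auto simp: F_star_single F_star_add A.star_star B.star_star)

lemma F_star_scale: "f \<in> carrier F \<Longrightarrow> star F (c \<odot>\<^bsub>F\<^esub> f) = cnj c \<odot>\<^bsub>F\<^esub> star F f"
  by (induction f rule: F_induct) (auto simp: F_star_single F_star_add F_scale_single F_scale_add)

lemma F_star_mult: "f \<in> carrier F \<Longrightarrow> g \<in> carrier F \<Longrightarrow> star F (f \<otimes>\<^bsub>F\<^esub> g) = star F g \<otimes>\<^bsub>F\<^esub> star F f"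
proof (induction f rule: F_induct)
  case (single a b c)
  from single(3) show ?case
    by (induction g rule: F_induct)
      (use single in \<open>auto simp: F_mult_single F_mult_add_right F_mult_add_left F_star_single F_star_add
        A.star_mult B.star_mult mult.commute\<close>)
qed (auto simp: F_mult_add_left F_mult_add_right F_star_add)

lemma star_algebra_F: "star_algebra F"
proof -
  have "cring F"
  proof (rule cringI)
    show "abelian_group F"
    proof (rule abelian_groupI)
      fix f assume f: "f \<in> carrier F"
      then have "- f \<in> carrier F" by (auto simp: carrier_F in_keys_iff subset_iff)
      then show "\<exists>g\<in>carrier F. g \<oplus>\<^bsub>F\<^esub> f = \<zero>\<^bsub>F\<^esub>" by (intro bexI[of _ "- f"]) auto
    qed (auto simp: F_add_closed F_zero_closed add.assoc add.commute)
    show "comm_monoid F"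
      by (rule comm_monoidI)
        (auto simp: F_mult_closed F_mult_assoc F_one_mult one_F[symmetric] intro: F_mult_comm,
         auto simp: one_F intro!: single_F)
  qed (auto simp: F_mult_add_left)
  then have "algebra complex_ring F"
  proof (rule algebraI[OF A.R_cring])
    fix a b f assume f: "f \<in> carrier F"
    show "(a \<oplus>\<^bsub>complex_ring\<^esub> b) \<odot>\<^bsub>F\<^esub> f = a \<odot>\<^bsub>F\<^esub> f \<oplus>\<^bsub>F\<^esub> b \<odot>\<^bsub>F\<^esub> f"
      by (rule poly_mapping_eqI) (simp add: complex_ring_def scale_F lookup_add distrib_right)
    show "(a \<otimes>\<^bsub>complex_ring\<^esub> b) \<odot>\<^bsub>F\<^esub> f = a \<odot>\<^bsub>F\<^esub> (b \<odot>\<^bsub>F\<^esub> f)"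
      by (rule poly_mapping_eqI) (simp add: complex_ring_def scale_F mult.assoc)
    show "\<one>\<^bsub>complex_ring\<^esub> \<odot>\<^bsub>F\<^esub> f = f"
      by (rule poly_mapping_eqI) (simp add: complex_ring_def scale_F)
  qed (auto simp: F_scale_closed F_scale_add F_scale_mult)
  then show ?thesis
    by (intro star_algebra.intro star_algebra_axioms.intro)
      (auto simp: F_star_closed F_star_add F_star_scale F_star_star F_star_mult)
qed

sublocale F: star_algebra F by (rule star_algebra_F)

lemma a_inv_F: "f \<in> carrier F \<Longrightarrow> \<ominus>\<^bsub>F\<^esub> f = - f"
proof -
  assume f: "f \<in> carrier F"
  then have "- f \<in> carrier F" by (auto simp: carrier_F in_keys_iff subset_iff)
  then show ?thesis using f by (intro F.M.minus_equality) auto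
qed

lemma a_minus_F: "f \<in> carrier F \<Longrightarrow> g \<in> carrier F \<Longrightarrow> f \<ominus>\<^bsub>F\<^esub> g = f - g"
  by (simp add: F.M.minus_eq a_inv_F)

lemma F_diff_closed: "f \<in> carrier F \<Longrightarrow> g \<in> carrier F \<Longrightarrow> f - g \<in> carrier F"
  using F.M.minus_closed[of f g] by (simp add: a_minus_F)

section \<open>The ideal spanned by the bilinear relations\<close>

lemma relations_closed: "bilinear_relations A B \<subseteq> carrier F"
  unfolding bilinear_relations_def by (auto intro!: F_diff_closed single_F)

lemma kernel_subset: "N \<subseteq> carrier F"
  unfolding tensor_kernel_def by (intro hull_minimal relations_closed F.carrier_is_submodule)

lemma kernel_mem_iff: "f \<in> N \<longleftrightarrow>
    (\<forall>H. submodule H complex_ring F \<and> bilinear_relations A B \<subseteq> H \<longrightarrow> f \<in> H)"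
  unfolding tensor_kernel_def hull_def by auto

text \<open>The hull is by definition an intersection of submodules; that it is a submodule itself
  has to be checked operation by operation.\<close>

lemma submodule_kernel: "submodule N complex_ring F"
proof (rule F.submoduleI)
  show "N \<subseteq> carrier F" by (rule kernel_subset)
  show "\<zero>\<^bsub>F\<^esub> \<in> N"
    unfolding kernel_mem_iff using subgroup.one_closed[OF submodule.axioms(1)] by fastforce
  show "\<ominus>\<^bsub>F\<^esub> f \<in> N" if "f \<in> N" for f
    using that F.submoduleE(3) unfolding kernel_mem_iff by blast
  show "f \<oplus>\<^bsub>F\<^esub> g \<in> N" if "f \<in> N" "g \<in> N" for f g
    using that F.submoduleE(5) unfolding kernel_mem_iff by blast
  show "c \<odot>\<^bsub>F\<^esub> f \<in> N" if "f \<in> N" for c f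
  proof -
    have "c \<odot>\<^bsub>F\<^esub> f \<in> H" if H: "submodule H complex_ring F" "bilinear_relations A B \<subseteq> H" for H
      using submodule.smult_closed[OF H(1), of c f] H \<open>f \<in> N\<close> unfolding kernel_mem_iff
      by (simp add: complex_ring_def)
    then show ?thesis unfolding kernel_mem_iff by blast
  qed
qed

lemma kernel_zero: "0 \<in> N"
  using subgroup.one_closed[OF submodule.axioms(1)[OF submodule_kernel]] by simp

lemma kernel_add: "f \<in> N \<Longrightarrow> g \<in> N \<Longrightarrow> f + g \<in> N"
  using F.submoduleE(5)[OF submodule_kernel, of f g] by simp

lemma kernel_scale: "f \<in> N \<Longrightarrow> c \<odot>\<^bsub>F\<^esub> f \<in> N"
  using submodule.smult_closed[OF submodule_kernel] by (simp add: complex_ring_def)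

lemma kernel_relation:
  "\<lbrakk>a \<in> carrier A; a' \<in> carrier A; b \<in> carrier B\<rbrakk> \<Longrightarrow> Poly_Mapping.single (a \<oplus>\<^bsub>A\<^esub> a', b) 1
    - Poly_Mapping.single (a, b) 1 - Poly_Mapping.single (a', b) 1 \<in> N"
  "\<lbrakk>a \<in> carrier A; b \<in> carrier B; b' \<in> carrier B\<rbrakk> \<Longrightarrow> Poly_Mapping.single (a, b \<oplus>\<^bsub>B\<^esub> b') 1
    - Poly_Mapping.single (a, b) 1 - Poly_Mapping.single (a, b') 1 \<in> N"
  "\<lbrakk>a \<in> carrier A; b \<in> carrier B\<rbrakk> \<Longrightarrow> Poly_Mapping.single (c \<odot>\<^bsub>A\<^esub> a, b) 1 - Poly_Mapping.single (a, b) c \<in> N"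
  "\<lbrakk>a \<in> carrier A; b \<in> carrier B\<rbrakk> \<Longrightarrow> Poly_Mapping.single (a, c \<odot>\<^bsub>B\<^esub> b) 1 - Poly_Mapping.single (a, b) c \<in> N"
  unfolding tensor_kernel_def by (rule hull_inc; force simp: bilinear_relations_def)+

text \<open>The elements of the free algebra with property P form a submodule that contains the
  relations, hence it contains their hull.\<close>

lemma kernel_induct [consumes 1, case_names zero add scale left_add right_add left_scale right_scale]:
  assumes "f \<in> N" and "P 0"
    and add: "\<And>f g. f \<in> carrier F \<Longrightarrow> g \<in> carrier F \<Longrightarrow> P f \<Longrightarrow> P g \<Longrightarrow> P (f + g)"
    and scale: "\<And>c f. f \<in> carrier F \<Longrightarrow> P f \<Longrightarrow> P (c \<odot>\<^bsub>F\<^esub> f)"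
    and "\<And>a a' b. \<lbrakk>a \<in> carrier A; a' \<in> carrier A; b \<in> carrier B\<rbrakk> \<Longrightarrow> P (Poly_Mapping.single (a \<oplus>\<^bsub>A\<^esub> a', b) 1
      - Poly_Mapping.single (a, b) 1 - Poly_Mapping.single (a', b) 1)"
    and "\<And>a b b'. \<lbrakk>a \<in> carrier A; b \<in> carrier B; b' \<in> carrier B\<rbrakk> \<Longrightarrow> P (Poly_Mapping.single (a, b \<oplus>\<^bsub>B\<^esub> b') 1
      - Poly_Mapping.single (a, b) 1 - Poly_Mapping.single (a, b') 1)"
    and "\<And>c a b. \<lbrakk>a \<in> carrier A; b \<in> carrier B\<rbrakk> \<Longrightarrow>
      P (Poly_Mapping.single (c \<odot>\<^bsub>A\<^esub> a, b) 1 - Poly_Mapping.single (a, b) c)"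
    and "\<And>c a b. \<lbrakk>a \<in> carrier A; b \<in> carrier B\<rbrakk> \<Longrightarrow>
      P (Poly_Mapping.single (a, c \<odot>\<^bsub>B\<^esub> b) 1 - Poly_Mapping.single (a, b) c)"
  shows "P f"
proof -
  have "submodule {f \<in> carrier F. P f} complex_ring F"
  proof (rule F.submoduleI)
    fix f assume f: "f \<in> {f \<in> carrier F. P f}"
    then show "\<ominus>\<^bsub>F\<^esub> f \<in> {f \<in> carrier F. P f}"
      using scale[of f "- 1"] by (simp add: F.minus_eq_scale)
  qed (use assms(2) add scale in \<open>auto simp: F_zero_closed F_add_closed F_scale_closed\<close>)
  moreover have "P f" if "f \<in> bilinear_relations A B" for f
    using that unfolding bilinear_relations_def Un_iff mem_Collect_eq
    by (elim disjE exE conjE) (simp_all only: assms(5-8))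
  then have "bilinear_relations A B \<subseteq> {f \<in> carrier F. P f}" using relations_closed by blast
  ultimately show ?thesis using assms(1) unfolding kernel_mem_iff by blast
qed

lemma F_diff_mult: "f \<in> carrier F \<Longrightarrow> g \<in> carrier F \<Longrightarrow> h \<in> carrier F \<Longrightarrow>
    (f - g) \<otimes>\<^bsub>F\<^esub> h = f \<otimes>\<^bsub>F\<^esub> h - g \<otimes>\<^bsub>F\<^esub> h"
  using F_mult_add_left[of "f - g" g h] by (simp add: algebra_simps)

lemma F_scale_diff: "c \<odot>\<^bsub>F\<^esub> (f - g) = c \<odot>\<^bsub>F\<^esub> f - c \<odot>\<^bsub>F\<^esub> g"
  using F_scale_add[of c "f - g" g] by (simp add: algebra_simps)

lemma F_star_diff: "star F (f - g) = star F f - star F g"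
  using F_star_add[of "f - g" g] by (simp add: algebra_simps)

text \<open>A bilinear relation times a single pair is a multiple of the same kind of relation with
  multiplied entries. Additivity in both factors reduces the general case to this one.\<close>

lemma kernel_mult:
  assumes "f \<in> N" "g \<in> carrier F" shows "f \<otimes>\<^bsub>F\<^esub> g \<in> N"
  using assms(2)
proof (induction g rule: F_induct)
  case zero then show ?case by (simp add: kernel_zero)
next
  case (add g h) then show ?case by (simp add: F_mult_add_right kernel_add)
next
  case (single x y d)
  from assms(1) show ?case
  proof (induction f rule: kernel_induct)
    case zero then show ?case by (simp add: kernel_zero)
  next
    case (add f g) then show ?case by (simp add: F_mult_add_left kernel_add)
  next
    case (scale c f) then show ?case using single by (simp add: F_scale_mult single_F kernel_scale)
  next
    case (left_add a a' b)
    then show ?case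
      using single kernel_scale[OF kernel_relation(1)[of "a \<otimes>\<^bsub>A\<^esub> x" "a' \<otimes>\<^bsub>A\<^esub> x" "b \<otimes>\<^bsub>B\<^esub> y"], of d]
      by (simp add: F_diff_mult F_diff_closed single_F F_mult_single A.l_distr F_scale_diff F_scale_single)
  next
    case (right_add a b b')
    then show ?case
      using single kernel_scale[OF kernel_relation(2)[of "a \<otimes>\<^bsub>A\<^esub> x" "b \<otimes>\<^bsub>B\<^esub> y" "b' \<otimes>\<^bsub>B\<^esub> y"], of d]
      by (simp add: F_diff_mult F_diff_closed single_F F_mult_single B.l_distr F_scale_diff F_scale_single)
  next
    case (left_scale c a b)
    then show ?case
      using single kernel_scale[OF kernel_relation(3)[of "a \<otimes>\<^bsub>A\<^esub> x" "b \<otimes>\<^bsub>B\<^esub> y" c], of d]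
      by (simp add: F_diff_mult single_F F_mult_single A.scale_mult_left F_scale_diff F_scale_single mult.commute)
  next
    case (right_scale c a b)
    then show ?case
      using single kernel_scale[OF kernel_relation(4)[of "a \<otimes>\<^bsub>A\<^esub> x" "b \<otimes>\<^bsub>B\<^esub> y" c], of d]
      by (simp add: F_diff_mult single_F F_mult_single B.scale_mult_left F_scale_diff F_scale_single mult.commute)
  qed
qed

lemma kernel_star: "f \<in> N \<Longrightarrow> star F f \<in> N"
proof (induction f rule: kernel_induct)
  case (scale c f) then show ?case by (simp add: F_star_scale kernel_scale)
qed (auto simp: kernel_zero F_star_add kernel_add F_star_diff F_star_single A.star_add B.star_add
  A.star_smult B.star_smult A.star_closed B.star_closed intro!: kernel_relation)

lemma ideal_kernel: "ideal N F"
proof (rule idealI)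
  show "ring F" by (rule F.ring_axioms)
  show "subgroup N (add_monoid F)" by (rule submodule.axioms(1)[OF submodule_kernel])
  show "f \<otimes>\<^bsub>F\<^esub> g \<in> N" if "f \<in> N" "g \<in> carrier F" for f g by (rule kernel_mult[OF that])
  show "g \<otimes>\<^bsub>F\<^esub> f \<in> N" if "f \<in> N" "g \<in> carrier F" for f g
    using kernel_mult[OF that] F_mult_comm[of f g] that kernel_subset by auto
qed

interpretation N: ideal N F by (rule ideal_kernel)

section \<open>Cosets and pure tensors\<close>

definition cls where "cls f = N +>\<^bsub>F\<^esub> f"

lemma cls_memI: "f \<in> carrier F \<Longrightarrow> f \<in> cls f"
  unfolding cls_def by (rule N.a_rcos_self)

lemma cls_mem_iff: "f \<in> carrier F \<Longrightarrow> g \<in> carrier F \<Longrightarrow> g \<in> cls f \<longleftrightarrow> g - f \<in> N"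
  unfolding cls_def using N.a_rcos_module_minus[OF F.ring_axioms] by (simp add: a_minus_F)

lemma cls_eqI: "f \<in> carrier F \<Longrightarrow> g \<in> cls f \<Longrightarrow> cls g = cls f"
  unfolding cls_def using N.a_repr_independence' by metis

lemma cls_subset: "f \<in> carrier F \<Longrightarrow> cls f \<subseteq> carrier F"
  unfolding cls_def by (rule F.a_r_coset_subset_G[OF kernel_subset])

lemma carrier_T: "carrier T = cls ` carrier F"
  by (auto simp: tensor_algebra_def Let_def FactRing_def A_RCOSETS_defs cls_def a_r_coset_def[symmetric])

lemma cls_closed [simp, intro]: "f \<in> carrier F \<Longrightarrow> cls f \<in> carrier T"
  by (simp add: carrier_T)

lemma T_cases:
  assumes "X \<in> carrier T" obtains f where "f \<in> carrier F" "X = cls f"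
  using assms by (auto simp: carrier_T)

lemma T_mult: "f \<in> carrier F \<Longrightarrow> g \<in> carrier F \<Longrightarrow> cls f \<otimes>\<^bsub>T\<^esub> cls g = cls (f \<otimes>\<^bsub>F\<^esub> g)"
  using N.rcoset_mult_add by (simp add: tensor_algebra_def Let_def FactRing_def cls_def)

lemma T_add: "f \<in> carrier F \<Longrightarrow> g \<in> carrier F \<Longrightarrow> cls f \<oplus>\<^bsub>T\<^esub> cls g = cls (f + g)"
  using N.a_rcos_sum by (simp add: tensor_algebra_def Let_def FactRing_def cls_def)

lemma T_one: "\<one>\<^bsub>T\<^esub> = cls \<one>\<^bsub>F\<^esub>"
  by (simp add: tensor_algebra_def Let_def FactRing_def cls_def)

lemma T_zero: "\<zero>\<^bsub>T\<^esub> = cls 0"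
  using F.a_coset_add_zero[OF N.a_subset] by (simp add: tensor_algebra_def Let_def FactRing_def cls_def)

text \<open>In the definition the union runs over all representatives; its members coincide because
  N is invariant under scaling, and it is not empty because f represents its own class.\<close>

lemma T_scale:
  assumes f: "f \<in> carrier F" shows "c \<odot>\<^bsub>T\<^esub> cls f = cls (c \<odot>\<^bsub>F\<^esub> f)"
proof -
  have "cls (c \<odot>\<^bsub>F\<^esub> g) = cls (c \<odot>\<^bsub>F\<^esub> f)" if g: "g \<in> cls f" for g
  proof -
    have gc: "g \<in> carrier F" using cls_subset[OF f] g by auto
    have "g - f \<in> N" using g cls_mem_iff[OF f gc] by simp
    then have "c \<odot>\<^bsub>F\<^esub> (g - f) \<in> N" by (rule kernel_scale)
    then show ?thesis using f gc by (intro cls_eqI) (simp_all add: cls_mem_iff F_scale_closed F_scale_diff)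
  qed
  then have "(\<Union>g\<in>cls f. cls (c \<odot>\<^bsub>F\<^esub> g)) = (\<Union>g\<in>cls f. cls (c \<odot>\<^bsub>F\<^esub> f))" by (intro SUP_cong refl)
  also have "\<dots> = cls (c \<odot>\<^bsub>F\<^esub> f)" using cls_memI[OF f] by blast
  finally show ?thesis by (simp add: tensor_algebra_def Let_def cls_def)
qed

lemma T_star:
  assumes f: "f \<in> carrier F" shows "star T (cls f) = cls (star F f)"
proof -
  have "cls (star F g) = cls (star F f)" if g: "g \<in> cls f" for g
  proof -
    have gc: "g \<in> carrier F" using cls_subset[OF f] g by auto
    have "g - f \<in> N" using g cls_mem_iff[OF f gc] by simp
    then have "star F (g - f) \<in> N" by (rule kernel_star)
    then show ?thesis using f gc by (intro cls_eqI) (simp_all add: cls_mem_iff F_star_closed F_star_diff)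
  qed
  then have "(\<Union>g\<in>cls f. cls (star F g)) = (\<Union>g\<in>cls f. cls (star F f))" by (intro SUP_cong refl)
  also have "\<dots> = cls (star F f)" using cls_memI[OF f] by blast
  finally show ?thesis by (simp add: tensor_algebra_def Let_def cls_def)
qed

lemma star_algebra_T: "star_algebra T"
proof -
  note closed = F_add_closed F_mult_closed F_scale_closed F_star_closed F_zero_closed
  note ops = T_add T_mult T_scale T_star T_one T_zero closed
  have "cring T"
  proof (rule cringI)
    show "abelian_group T"
    proof (rule abelian_groupI)
      fix X assume "X \<in> carrier T"
      then obtain f where f: "f \<in> carrier F" "X = cls f" by (rule T_cases)
      then have "cls (- f) \<oplus>\<^bsub>T\<^esub> X = \<zero>\<^bsub>T\<^esub>" "- f \<in> carrier F"
        using F.M.a_inv_closed[of f] by (auto simp: ops a_inv_F)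
      then show "\<exists>Y\<in>carrier T. Y \<oplus>\<^bsub>T\<^esub> X = \<zero>\<^bsub>T\<^esub>" by blast
    qed (auto elim!: T_cases simp: ops add_ac)
    show "comm_monoid T"
    proof (rule comm_monoidI)
      fix X Y assume "X \<in> carrier T" "Y \<in> carrier T"
      then obtain f g where "f \<in> carrier F" "X = cls f" "g \<in> carrier F" "Y = cls g" by (metis T_cases)
      then show "X \<otimes>\<^bsub>T\<^esub> Y = Y \<otimes>\<^bsub>T\<^esub> X" using F_mult_comm[of f g] by (simp add: ops)
    qed (auto elim!: T_cases simp: ops F_mult_assoc F_one_mult)
  qed (auto elim!: T_cases simp: ops F_mult_add_left)
  then have "algebra complex_ring T"
  proof (rule algebraI[OF A.R_cring])
    fix a b X assume "X \<in> carrier T"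
    then obtain f where f: "f \<in> carrier F" "X = cls f" by (rule T_cases)
    show "(a \<oplus>\<^bsub>complex_ring\<^esub> b) \<odot>\<^bsub>T\<^esub> X = a \<odot>\<^bsub>T\<^esub> X \<oplus>\<^bsub>T\<^esub> b \<odot>\<^bsub>T\<^esub> X"
      using f F.scale_add_left[of f a b] by (simp add: ops complex_ring_def)
    show "(a \<otimes>\<^bsub>complex_ring\<^esub> b) \<odot>\<^bsub>T\<^esub> X = a \<odot>\<^bsub>T\<^esub> (b \<odot>\<^bsub>T\<^esub> X)"
      using f F.scale_scale[of f a b] by (simp add: ops complex_ring_def)
    show "\<one>\<^bsub>complex_ring\<^esub> \<odot>\<^bsub>T\<^esub> X = X"
      using f F.scale_one[of f] by (simp add: ops complex_ring_def)
  qed (auto elim!: T_cases simp: ops F_scale_add F_scale_mult)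
  then show ?thesis
    by (intro star_algebra.intro star_algebra_axioms.intro)
      (auto elim!: T_cases simp: ops F_star_add F_star_scale F_star_star F_star_mult)
qed

sublocale T: star_algebra T by (rule star_algebra_T)

abbreviation tens where "tens \<equiv> pure_tensor A B"

lemma tens_cls: "tens a b = cls (Poly_Mapping.single (a, b) 1)"
  by (simp add: pure_tensor_def cls_def)

lemma tens_closed: "a \<in> carrier A \<Longrightarrow> b \<in> carrier B \<Longrightarrow> tens a b \<in> carrier T"
  by (simp add: tens_cls single_F)

lemma cls_single: "a \<in> carrier A \<Longrightarrow> b \<in> carrier B \<Longrightarrow> cls (Poly_Mapping.single (a, b) c) = c \<odot>\<^bsub>T\<^esub> tens a b"
  by (simp add: tens_cls T_scale single_F F_scale_single)

lemma T_induct [consumes 1, case_names zero tens add]: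
  assumes "X \<in> carrier T" and "P \<zero>\<^bsub>T\<^esub>"
    and "\<And>a b c. a \<in> carrier A \<Longrightarrow> b \<in> carrier B \<Longrightarrow> P (c \<odot>\<^bsub>T\<^esub> tens a b)"
    and "\<And>X Y. X \<in> carrier T \<Longrightarrow> Y \<in> carrier T \<Longrightarrow> P X \<Longrightarrow> P Y \<Longrightarrow> P (X \<oplus>\<^bsub>T\<^esub> Y)"
  shows "P X"
proof -
  obtain f where f: "f \<in> carrier F" "X = cls f" using assms(1) by (rule T_cases)
  have "P (cls f)"
    using f(1)
  proof (induction f rule: F_induct)
    case (add f g)
    then show ?case using assms(4)[of "cls f" "cls g"] by (simp add: T_add)
  qed (use assms in \<open>auto simp: cls_single T_zero\<close>)
  then show ?thesis using f(2) by simp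
qed

lemma tens_mult: "\<lbrakk>a \<in> carrier A; a' \<in> carrier A; b \<in> carrier B; b' \<in> carrier B\<rbrakk> \<Longrightarrow>
    tens a b \<otimes>\<^bsub>T\<^esub> tens a' b' = tens (a \<otimes>\<^bsub>A\<^esub> a') (b \<otimes>\<^bsub>B\<^esub> b')"
  by (simp add: tens_cls T_mult single_F F_mult_single)

lemma tens_one: "tens \<one>\<^bsub>A\<^esub> \<one>\<^bsub>B\<^esub> = \<one>\<^bsub>T\<^esub>"
  by (simp add: tens_cls T_one one_F)

lemma tens_star: "a \<in> carrier A \<Longrightarrow> b \<in> carrier B \<Longrightarrow> star T (tens a b) = tens (star A a) (star B b)"
  by (simp add: tens_cls T_star single_F F_star_single)

lemma cls_eq_iff_diff: "f \<in> carrier F \<Longrightarrow> g \<in> carrier F \<Longrightarrow> f - g \<in> N \<Longrightarrow> cls f = cls g"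
  by (rule cls_eqI) (simp_all add: cls_mem_iff)

lemma tens_add_left: "\<lbrakk>a \<in> carrier A; a' \<in> carrier A; b \<in> carrier B\<rbrakk> \<Longrightarrow>
    tens (a \<oplus>\<^bsub>A\<^esub> a') b = tens a b \<oplus>\<^bsub>T\<^esub> tens a' b"
  using kernel_relation(1)[of a a' b]
  by (simp add: tens_cls T_add single_F, intro cls_eq_iff_diff)
    (simp_all add: single_F F_add_closed flip: diff_diff_eq)

lemma tens_add_right: "\<lbrakk>a \<in> carrier A; b \<in> carrier B; b' \<in> carrier B\<rbrakk> \<Longrightarrow>
    tens a (b \<oplus>\<^bsub>B\<^esub> b') = tens a b \<oplus>\<^bsub>T\<^esub> tens a b'"
  using kernel_relation(2)[of a b b']
  by (simp add: tens_cls T_add single_F, intro cls_eq_iff_diff)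
    (simp_all add: single_F F_add_closed flip: diff_diff_eq)

lemma tens_scale_left: "a \<in> carrier A \<Longrightarrow> b \<in> carrier B \<Longrightarrow> tens (c \<odot>\<^bsub>A\<^esub> a) b = c \<odot>\<^bsub>T\<^esub> tens a b"
  using kernel_relation(3)[of a b c]
  by (simp add: tens_cls T_scale single_F F_scale_single, intro cls_eq_iff_diff) (simp_all add: single_F)

lemma tens_scale_right: "a \<in> carrier A \<Longrightarrow> b \<in> carrier B \<Longrightarrow> tens a (c \<odot>\<^bsub>B\<^esub> b) = c \<odot>\<^bsub>T\<^esub> tens a b"
  using kernel_relation(4)[of a b c]
  by (simp add: tens_cls T_scale single_F F_scale_single, intro cls_eq_iff_diff) (simp_all add: single_F)

text \<open>Makes multiplicative maps on the tensor product depend only on their values on the two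
  embedded factors.\<close>

lemma tens_split: "a \<in> carrier A \<Longrightarrow> b \<in> carrier B \<Longrightarrow> tens a b = tens a \<one>\<^bsub>B\<^esub> \<otimes>\<^bsub>T\<^esub> tens \<one>\<^bsub>A\<^esub> b"
  by (simp add: tens_mult)

end

section \<open>Linear extension from a basis\<close>

context star_algebra begin

text \<open>The linear extension of g from the basis to the free vector space. It serves both to
  contract tensors along a functional and to construct maps out of the tensor product.\<close>

definition lin :: "('k \<Rightarrow> 'a) \<Rightarrow> ('k \<Rightarrow>\<^sub>0 complex) \<Rightarrow> 'a" where
  "lin g f = (\<Oplus>k\<in>Poly_Mapping.keys f. Poly_Mapping.lookup f k \<odot> g k)"

lemma lin_superset:
  assumes "finite S" "Poly_Mapping.keys f \<subseteq> S" "\<And>k. k \<in> S \<Longrightarrow> g k \<in> carrier A"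
  shows "lin g f = (\<Oplus>k\<in>S. Poly_Mapping.lookup f k \<odot> g k)"
  unfolding lin_def
  by (rule M.add.finprod_mono_neutral_cong_left)
    (use assms in \<open>auto simp: in_keys_iff\<close>)

lemma lin_closed:
  assumes "\<And>k. k \<in> Poly_Mapping.keys f \<Longrightarrow> g k \<in> carrier A" shows "lin g f \<in> carrier A"
  unfolding lin_def using assms by (intro M.finsum_closed) auto

lemma lin_zero [simp]: "lin g 0 = \<zero>"
  by (simp add: lin_def)

lemma lin_single: "g k \<in> carrier A \<Longrightarrow> lin g (Poly_Mapping.single k c) = c \<odot> g k"
  by (cases "c = 0") (simp_all add: lin_def)

lemma lin_add:
  assumes "\<And>k. k \<in> Poly_Mapping.keys f \<union> Poly_Mapping.keys h \<Longrightarrow> g k \<in> carrier A"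
  shows "lin g (f + h) = lin g f \<oplus> lin g h"
proof -
  let ?S = "Poly_Mapping.keys f \<union> Poly_Mapping.keys h"
  have "lin g (f + h) = (\<Oplus>k\<in>?S. Poly_Mapping.lookup (f + h) k \<odot> g k)"
    using assms keys_add[of f h] by (intro lin_superset) auto
  also have "\<dots> = (\<Oplus>k\<in>?S. Poly_Mapping.lookup f k \<odot> g k \<oplus> Poly_Mapping.lookup h k \<odot> g k)"
    using assms by (intro M.finsum_cong') (auto simp: lookup_add scale_add_left)
  also have "\<dots> = (\<Oplus>k\<in>?S. Poly_Mapping.lookup f k \<odot> g k) \<oplus> (\<Oplus>k\<in>?S. Poly_Mapping.lookup h k \<odot> g k)"
    using assms by (intro M.finsum_addf) auto
  also have "\<dots> = lin g f \<oplus> lin g h"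
    using assms by (subst (1 2) lin_superset[of ?S]) auto
  finally show ?thesis .
qed

end

section \<open>Injective \<open>C\<^sup>*\<close>-seminorms\<close>

definition functionals :: "('a, 'm) star_alg_scheme \<Rightarrow> ('a \<Rightarrow> complex) set" where
  "functionals A = {w. (\<forall>x\<in>carrier A. \<forall>y\<in>carrier A. w (x \<oplus>\<^bsub>A\<^esub> y) = w x + w y) \<and>
     (\<forall>c. \<forall>x\<in>carrier A. w (c \<odot>\<^bsub>A\<^esub> x) = c * w x)}"

lemma bounded_functionals_iff:
  "w \<in> bounded_functionals A p \<longleftrightarrow> w \<in> functionals A \<and> (\<forall>x\<in>carrier A. cmod (w x) \<le> p x)"
  by (auto simp: bounded_functionals_def functionals_def)

lemma functionalsD:
  assumes "w \<in> functionals A"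
  shows "x \<in> carrier A \<Longrightarrow> y \<in> carrier A \<Longrightarrow> w (x \<oplus>\<^bsub>A\<^esub> y) = w x + w y"
    and "x \<in> carrier A \<Longrightarrow> w (c \<odot>\<^bsub>A\<^esub> x) = c * w x"
  using assms by (auto simp: functionals_def)

lemma charactersD:
  assumes "w \<in> characters A p"
  shows "w \<in> functionals A" "w \<in> bounded_functionals A p"
    and "x \<in> carrier A \<Longrightarrow> cmod (w x) \<le> p x"
    and "x \<in> carrier A \<Longrightarrow> y \<in> carrier A \<Longrightarrow> w (x \<otimes>\<^bsub>A\<^esub> y) = w x * w y"
    and "x \<in> carrier A \<Longrightarrow> w (star A x) = cnj (w x)"
  using assms by (auto simp: characters_def bounded_functionals_iff)

lemma (in star_algebra) functional_zero: "w \<in> functionals A \<Longrightarrow> w \<zero> = 0"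
  using functionalsD(2)[of w A \<zero> 0] by simp

context star_algebra_pair begin

text \<open>The functional usually written \<open>w1 \<otimes> w2\<close>, evaluated on a
  representative in the free algebra.\<close>

definition pairing :: "('a \<Rightarrow> complex) \<Rightarrow> ('b \<Rightarrow> complex) \<Rightarrow> ('a \<times> 'b \<Rightarrow>\<^sub>0 complex) \<Rightarrow> complex" where
  "pairing w1 w2 f = (\<Sum>k\<in>Poly_Mapping.keys f. Poly_Mapping.lookup f k * (w1 (fst k) * w2 (snd k)))"

lemma pairing_zero [simp]: "pairing w1 w2 0 = 0"
  by (simp add: pairing_def)

lemma pairing_single: "pairing w1 w2 (Poly_Mapping.single (a, b) c) = c * (w1 a * w2 b)"
  by (cases "c = 0") (simp_all add: pairing_def)

lemma pairing_add: "pairing w1 w2 (f + g) = pairing w1 w2 f + pairing w1 w2 g"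
  unfolding pairing_def by (rule setsum_keys_plus_distrib) (simp_all add: distrib_right)

lemma pairing_diff: "pairing w1 w2 (f - g) = pairing w1 w2 f - pairing w1 w2 g"
  using pairing_add[of w1 w2 "f - g" g] by simp

lemma pairing_scale: "f \<in> carrier F \<Longrightarrow> pairing w1 w2 (c \<odot>\<^bsub>F\<^esub> f) = c * pairing w1 w2 f"
  by (induction f rule: F_induct)
    (simp_all add: F_scale_single F_scale_add pairing_single pairing_add distrib_left)

lemma pairing_kernel:
  assumes "w1 \<in> functionals A" "w2 \<in> functionals B" "f \<in> N"
  shows "pairing w1 w2 f = 0"
  using assms(3)
  by (induction f rule: kernel_induct)
    (simp_all add: pairing_add pairing_scale pairing_diff pairing_single functionalsD[OF assms(1)]
      functionalsD[OF assms(2)] algebra_simps)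

lemma pairing_cls:
  assumes "w1 \<in> functionals A" "w2 \<in> functionals B" "f \<in> carrier F" "g \<in> cls f"
  shows "pairing w1 w2 g = pairing w1 w2 f"
proof -
  have "g \<in> carrier F" using cls_subset assms(3,4) by blast
  then have "g - f \<in> N" using assms(3,4) cls_mem_iff by blast
  then show ?thesis using pairing_kernel[OF assms(1,2)] pairing_diff[of w1 w2 g f] by simp
qed

text \<open>The slice map: contracting the second factor with \<open>w2\<close> leaves an element of
  A. For fixed \<open>w2\<close>, a value of the pairing is thus the value of \<open>w1\<close> at
  one element.\<close>

lemma pairing_left:
  assumes w: "w1 \<in> functionals A" and f: "f \<in> carrier F"
  shows "w1 (A.lin (\<lambda>k. w2 (snd k) \<odot>\<^bsub>A\<^esub> fst k) f) = pairing w1 w2 f"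
  using f
proof (induction f rule: F_induct)
  case zero then show ?case using A.functional_zero[OF w] by simp
next
  case (single a b c)
  then show ?case by (simp add: A.lin_single functionalsD[OF w] pairing_single)
next
  case (add f g)
  have "w2 (snd k) \<odot>\<^bsub>A\<^esub> fst k \<in> carrier A" if "k \<in> Poly_Mapping.keys f \<union> Poly_Mapping.keys g" for k
    using that add(1,2) unfolding carrier_F by (intro A.scale_closed) auto
  then show ?case using add
    by (subst A.lin_add) (auto simp: functionalsD[OF w] A.lin_closed pairing_add)
qed

lemma pairing_right:
  assumes w: "w2 \<in> functionals B" and f: "f \<in> carrier F"
  shows "w2 (B.lin (\<lambda>k. w1 (fst k) \<odot>\<^bsub>B\<^esub> snd k) f) = pairing w1 w2 f"
  using f
proof (induction f rule: F_induct)
  case zero then show ?case using B.functional_zero[OF w] by simp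
next
  case (single a b c)
  then show ?case by (simp add: B.lin_single functionalsD[OF w] pairing_single)
next
  case (add f g)
  have "w1 (fst k) \<odot>\<^bsub>B\<^esub> snd k \<in> carrier B" if "k \<in> Poly_Mapping.keys f \<union> Poly_Mapping.keys g" for k
    using that add(1,2) unfolding carrier_F by (intro B.scale_closed) auto
  then show ?case using add
    by (subst B.lin_add) (auto simp: functionalsD[OF w] B.lin_closed pairing_add)
qed

lemma pairing_mult:
  assumes x: "x \<in> characters A p" and y: "y \<in> characters B q" and f: "f \<in> carrier F" and g: "g \<in> carrier F"
  shows "pairing x y (f \<otimes>\<^bsub>F\<^esub> g) = pairing x y f * pairing x y g"
  using f
proof (induction f rule: F_induct)
  case (single a b c)
  from g show ?case
    by (induction g rule: F_induct)
      (use single in \<open>simp_all add: F_mult_single F_mult_add_right pairing_single pairing_add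
        charactersD(4)[OF x] charactersD(4)[OF y] distrib_left\<close>)
qed (simp_all add: F_mult_add_left pairing_add distrib_right)

lemma pairing_star:
  assumes x: "x \<in> characters A p" and y: "y \<in> characters B q" and f: "f \<in> carrier F"
  shows "pairing x y (star F f) = cnj (pairing x y f)"
  using f
  by (induction f rule: F_induct)
    (simp_all add: F_star_single F_star_add pairing_single pairing_add charactersD(5)[OF x] charactersD(5)[OF y])

end

section \<open>Injective seminorms and characters\<close>

locale tensor_seminorms = star_algebra_pair A B + p: cstar_seminormed A p + q: cstar_seminormed B q
  for A :: "('a, 'm) star_alg_scheme" (structure) and B :: "('b, 'n) star_alg_scheme" (structure) and p q
begin

abbreviation inj where "inj \<equiv> injective_seminorm A B p q"

lemma zero_functional: "(\<lambda>_. 0) \<in> bounded_functionals A p" "(\<lambda>_. 0) \<in> bounded_functionals B q"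
  by (auto simp: bounded_functionals_def)

text \<open>The bound may depend on the representative f but not on the functionals; it makes the
  supremum in the injective seminorm finite.\<close>

lemma pairing_bounded:
  assumes "f \<in> carrier F"
  shows "\<exists>M. \<forall>w1\<in>bounded_functionals A p. \<forall>w2\<in>bounded_functionals B q. cmod (pairing w1 w2 f) \<le> M"
  using assms
proof (induction f rule: F_induct)
  case zero then show ?case by auto
next
  case (single a b c)
  have "cmod (pairing w1 w2 (Poly_Mapping.single (a, b) c)) \<le> cmod c * (p a * q b)"
    if "w1 \<in> bounded_functionals A p" "w2 \<in> bounded_functionals B q" for w1 w2
    using that single unfolding pairing_single norm_mult bounded_functionals_iff
    by (intro mult_left_mono mult_mono) auto
  then show ?case by blast
next
  case (add f g)
  then obtain M M' where
    "\<forall>w1\<in>bounded_functionals A p. \<forall>w2\<in>bounded_functionals B q. cmod (pairing w1 w2 f) \<le> M"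
    "\<forall>w1\<in>bounded_functionals A p. \<forall>w2\<in>bounded_functionals B q. cmod (pairing w1 w2 g) \<le> M'" by blast
  then show ?case unfolding pairing_add
    by (intro exI[of _ "M + M'"]) (auto intro!: norm_triangle_le add_mono)
qed

text \<open>The pairing with linear functionals is constant on each class, so the supremum over all
  representatives may be taken over a single one.\<close>

lemma inj_eq:
  assumes f: "f \<in> carrier F"
  shows "inj (cls f) = Sup {cmod (pairing w1 w2 f) | w1 w2.
    w1 \<in> bounded_functionals A p \<and> w2 \<in> bounded_functionals B q}"
proof -
  have eq: "(\<Sum>(a, b)\<in>Poly_Mapping.keys g. Poly_Mapping.lookup g (a, b) * (w1 a * w2 b)) = pairing w1 w2 f"
    if "g \<in> cls f" "w1 \<in> bounded_functionals A p" "w2 \<in> bounded_functionals B q" for g w1 w2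
  proof -
    have "pairing w1 w2 g = pairing w1 w2 f"
      using that f by (intro pairing_cls) (auto simp: bounded_functionals_iff)
    then show ?thesis by (simp add: pairing_def case_prod_unfold)
  qed
  have "{cmod (\<Sum>(a, b)\<in>Poly_Mapping.keys g. Poly_Mapping.lookup g (a, b) * (w1 a * w2 b)) | g w1 w2.
      g \<in> cls f \<and> w1 \<in> bounded_functionals A p \<and> w2 \<in> bounded_functionals B q} =
    {cmod (pairing w1 w2 f) | w1 w2. w1 \<in> bounded_functionals A p \<and> w2 \<in> bounded_functionals B q}"
    (is "?L = ?R")
  proof (intro equalityI subsetI)
    fix x assume "x \<in> ?L"
    then obtain g w1 w2 where
      x: "x = cmod (\<Sum>(a, b)\<in>Poly_Mapping.keys g. Poly_Mapping.lookup g (a, b) * (w1 a * w2 b))"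
      and m: "g \<in> cls f" "w1 \<in> bounded_functionals A p" "w2 \<in> bounded_functionals B q" by blast
    show "x \<in> ?R" unfolding x eq[OF m] using m by blast
  next
    fix x assume "x \<in> ?R"
    then obtain w1 w2 where x: "x = cmod (pairing w1 w2 f)"
      and m: "w1 \<in> bounded_functionals A p" "w2 \<in> bounded_functionals B q" by blast
    show "x \<in> ?L" unfolding x eq[OF cls_memI[OF f] m, symmetric] using m cls_memI[OF f] by blast
  qed
  then show ?thesis by (simp add: injective_seminorm_def)
qed

lemma inj_upper:
  assumes f: "f \<in> carrier F" and w: "w1 \<in> bounded_functionals A p" "w2 \<in> bounded_functionals B q"
  shows "cmod (pairing w1 w2 f) \<le> inj (cls f)"
  unfolding inj_eq[OF f]
proof (rule cSup_upper)
  obtain M where "\<forall>w1\<in>bounded_functionals A p. \<forall>w2\<in>bounded_functionals B q. cmod (pairing w1 w2 f) \<le> M"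
    using pairing_bounded[OF f] by blast
  then show "bdd_above {cmod (pairing w1 w2 f) | w1 w2.
      w1 \<in> bounded_functionals A p \<and> w2 \<in> bounded_functionals B q}"
    by (intro bdd_aboveI[of _ M]) blast
qed (use w in blast)

lemma inj_least:
  assumes f: "f \<in> carrier F" and M: "\<And>w1 w2. w1 \<in> bounded_functionals A p \<Longrightarrow> w2 \<in> bounded_functionals B q \<Longrightarrow>
      cmod (pairing w1 w2 f) \<le> M"
  shows "inj (cls f) \<le> M"
  unfolding inj_eq[OF f] by (rule cSup_least) (use zero_functional M in blast)+

text \<open>Characters attain the seminorm of an element, so the two functionals may be replaced by
  characters one after the other, without decreasing the value on a given tensor.\<close>

lemma pairing_le_characters:
  assumes f: "f \<in> carrier F" and w1: "w1 \<in> bounded_functionals A p" and w2: "w2 \<in> bounded_functionals B q"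
  obtains x y where "x \<in> characters A p" "y \<in> characters B q"
    "cmod (pairing w1 w2 f) \<le> cmod (pairing x y f)"
proof -
  have fk: "fst k \<in> carrier A" "snd k \<in> carrier B" if "k \<in> Poly_Mapping.keys f" for k
    using that f by (auto simp: carrier_F)
  define a where "a = A.lin (\<lambda>k. w2 (snd k) \<odot>\<^bsub>A\<^esub> fst k) f"
  have a: "a \<in> carrier A" unfolding a_def using fk by (intro A.lin_closed) auto
  obtain x where x: "x \<in> characters A p" "cmod (x a) = p a" using p.character_attains[OF a] .
  have "cmod (pairing w1 w2 f) \<le> p a"
    using w1 a pairing_left[OF _ f, of w1 w2] by (auto simp: bounded_functionals_iff a_def)
  also have "p a = cmod (pairing x w2 f)"
    using x(2) pairing_left[OF charactersD(1)[OF x(1)] f, of w2] by (simp add: a_def)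
  finally have 1: "cmod (pairing w1 w2 f) \<le> cmod (pairing x w2 f)" .
  define b where "b = B.lin (\<lambda>k. x (fst k) \<odot>\<^bsub>B\<^esub> snd k) f"
  have b: "b \<in> carrier B" unfolding b_def using fk by (intro B.lin_closed) auto
  obtain y where y: "y \<in> characters B q" "cmod (y b) = q b" using q.character_attains[OF b] .
  have "cmod (pairing x w2 f) \<le> q b"
    using w2 b pairing_right[OF _ f, of w2 x] by (auto simp: bounded_functionals_iff b_def)
  also have "q b = cmod (pairing x y f)"
    using y(2) pairing_right[OF charactersD(1)[OF y(1)] f, of x] by (simp add: b_def)
  finally show thesis using 1 by (intro that[OF x(1) y(1)]) simp
qed

lemma inj_cstar_seminorm: "cstar_seminorm T inj"
  unfolding cstar_seminorm_def seminorm_def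
proof (intro conjI ballI allI)
  fix X assume "X \<in> carrier T"
  then obtain f where f: "f \<in> carrier F" and X: "X = cls f" by (rule T_cases)
  show nn: "0 \<le> inj X" using inj_upper[OF f zero_functional] X by (meson norm_ge_zero order_trans)
  have le: "inj (c \<odot>\<^bsub>T\<^esub> cls g) \<le> cmod c * inj (cls g)" if g: "g \<in> carrier F" for c g
    unfolding T_scale[OF g]
    by (rule inj_least)
      (auto simp: F_scale_closed g pairing_scale norm_mult intro!: mult_left_mono inj_upper)
  show "inj (c \<odot>\<^bsub>T\<^esub> X) = cmod c * inj X" for c
  proof (cases "c = 0")
    case True
    have "inj (c \<odot>\<^bsub>T\<^esub> X) \<le> 0" using le[OF f, of c] X True by simp
    moreover have "0 \<le> inj (c \<odot>\<^bsub>T\<^esub> X)"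
      using inj_upper[OF F_scale_closed[OF f] zero_functional, of c] unfolding X T_scale[OF f]
      by (meson norm_ge_zero order_trans)
    ultimately show ?thesis using True by simp
  next
    case False
    \<comment> \<open>The reverse inequality follows from the proved one, applied to the inverse
      scalar.\<close>
    have "inj X = inj ((1 / c) \<odot>\<^bsub>T\<^esub> (c \<odot>\<^bsub>T\<^esub> X))"
      using False X f by (simp add: T.scale_scale)
    also have "\<dots> \<le> cmod (1 / c) * inj (c \<odot>\<^bsub>T\<^esub> X)"
      using le[OF F_scale_closed[OF f], of "1 / c" c] by (simp add: X T_scale f)
    finally have "cmod c * inj X \<le> inj (c \<odot>\<^bsub>T\<^esub> X)" using False by (simp add: norm_divide field_simps)
    then show ?thesis using le[OF f, of c] X by simp
  qed
  show "inj (X \<otimes>\<^bsub>T\<^esub> star T X) = (inj X)\<^sup>2"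
  proof -
    define h where "h = f \<otimes>\<^bsub>F\<^esub> star F f"
    have h: "h \<in> carrier F" using f by (simp add: h_def F_mult_closed F_star_closed)
    have Xh: "X \<otimes>\<^bsub>T\<^esub> star T X = cls h" using f by (simp add: X h_def T_star T_mult F_star_closed)
    \<comment> \<open>For characters the pairing respects products and the involution, so its value
      at the product of f with its adjoint is a squared modulus. By
      \<open>pairing_le_characters\<close>, such values control both suprema.\<close>
    have ph: "cmod (pairing x y h) = (cmod (pairing x y f))\<^sup>2"
      if "x \<in> characters A p" "y \<in> characters B q" for x y
      using f by (simp add: h_def pairing_mult[OF that] pairing_star[OF that] F_star_closed norm_mult power2_eq_square)
    show ?thesis unfolding Xh
    proof (rule antisym)
      show "inj (cls h) \<le> (inj X)\<^sup>2"
      proof (rule inj_least[OF h])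
        fix w1 w2 assume "w1 \<in> bounded_functionals A p" "w2 \<in> bounded_functionals B q"
        then obtain x y where xy: "x \<in> characters A p" "y \<in> characters B q"
          "cmod (pairing w1 w2 h) \<le> cmod (pairing x y h)" using pairing_le_characters[OF h] by metis
        have "cmod (pairing x y h) \<le> (inj X)\<^sup>2"
          unfolding ph[OF xy(1,2)] X using inj_upper[OF f charactersD(2)[OF xy(1)] charactersD(2)[OF xy(2)]]
          by (intro power_mono) auto
        with xy(3) show "cmod (pairing w1 w2 h) \<le> (inj X)\<^sup>2" by simp
      qed
      have "inj X \<le> sqrt (inj (cls h))"
        unfolding X
      proof (rule inj_least[OF f])
        fix w1 w2 assume "w1 \<in> bounded_functionals A p" "w2 \<in> bounded_functionals B q"
        then obtain x y where xy: "x \<in> characters A p" "y \<in> characters B q"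
          "cmod (pairing w1 w2 f) \<le> cmod (pairing x y f)" using pairing_le_characters[OF f] by metis
        have "(cmod (pairing x y f))\<^sup>2 \<le> inj (cls h)"
          using inj_upper[OF h charactersD(2)[OF xy(1)] charactersD(2)[OF xy(2)]] unfolding ph[OF xy(1,2)] .
        with xy(3) show "cmod (pairing w1 w2 f) \<le> sqrt (inj (cls h))" by (meson order_trans real_le_rsqrt)
      qed
      moreover have "0 \<le> inj (cls h)" using inj_upper[OF h zero_functional] by (meson norm_ge_zero order_trans)
      ultimately show "(inj X)\<^sup>2 \<le> inj (cls h)" using power_mono[OF _ nn, of "sqrt (inj (cls h))" 2] by simp
    qed
  qed
  fix Y assume "Y \<in> carrier T"
  then obtain g where g: "g \<in> carrier F" and Y: "Y = cls g" by (rule T_cases)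
  show "inj (X \<oplus>\<^bsub>T\<^esub> Y) \<le> inj X + inj Y"
    unfolding X Y T_add[OF f g]
    by (rule inj_least)
      (auto simp: F_add_closed f g pairing_add intro!: norm_triangle_le add_mono inj_upper)
qed

sublocale I: cstar_seminormed T inj
  by unfold_locales (rule inj_cstar_seminorm)

lemma inj_tens_le:
  assumes "a \<in> carrier A" "b \<in> carrier B" shows "inj (tens a b) \<le> p a * q b"
  unfolding tens_cls
  by (rule inj_least)
    (use assms in \<open>auto simp: single_F pairing_single norm_mult bounded_functionals_iff intro!: mult_mono\<close>)

text \<open>A character of \<open>D\<close> attaining \<open>r (h X)\<close>, composed with \<open>h\<close>, restricts to bounded functionals on
  both factors.\<close>

lemma inj_dominates:
  assumes D: "star_algebra D" and r: "cstar_seminorm D r"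
    and hc: "\<And>X. X \<in> carrier T \<Longrightarrow> h X \<in> carrier D"
    and hadd: "\<And>X Y. X \<in> carrier T \<Longrightarrow> Y \<in> carrier T \<Longrightarrow> h (X \<oplus>\<^bsub>T\<^esub> Y) = h X \<oplus>\<^bsub>D\<^esub> h Y"
    and hmult: "\<And>X Y. X \<in> carrier T \<Longrightarrow> Y \<in> carrier T \<Longrightarrow> h (X \<otimes>\<^bsub>T\<^esub> Y) = h X \<otimes>\<^bsub>D\<^esub> h Y"
    and hscale: "\<And>c X. X \<in> carrier T \<Longrightarrow> h (c \<odot>\<^bsub>T\<^esub> X) = c \<odot>\<^bsub>D\<^esub> h X"
    and k: "k1 > 0" "k2 > 0"
    and b1: "\<And>a. a \<in> carrier A \<Longrightarrow> r (h (tens a \<one>\<^bsub>B\<^esub>)) \<le> k1 * p a"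
    and b2: "\<And>b. b \<in> carrier B \<Longrightarrow> r (h (tens \<one>\<^bsub>A\<^esub> b)) \<le> k2 * q b"
    and X: "X \<in> carrier T"
  shows "r (h X) \<le> k1 * k2 * inj X"
proof -
  interpret D: star_algebra D by fact
  interpret r: cstar_seminormed D r by (rule D.cstar_seminormedI[OF r])
  obtain f where f: "f \<in> carrier F" and Xf: "X = cls f" using X by (rule T_cases)
  obtain w where w: "w \<in> characters D r" "cmod (w (h X)) = r (h X)" using r.character_attains[OF hc[OF X]] .
  note wf = functionalsD[OF charactersD(1)[OF w(1)]]
  \<comment> \<open>Division by \<open>k1\<close> and \<open>k2\<close> turns the two domination
    hypotheses into bounds by p and q.\<close>
  define w1 where "w1 a = w (h (tens a \<one>\<^bsub>B\<^esub>)) / complex_of_real k1" for a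
  define w2 where "w2 b = w (h (tens \<one>\<^bsub>A\<^esub> b)) / complex_of_real k2" for b
  have w1: "w1 \<in> bounded_functionals A p"
    unfolding bounded_functionals_iff functionals_def
  proof (intro conjI CollectI ballI allI)
    fix a assume a: "a \<in> carrier A"
    have "cmod (w (h (tens a \<one>\<^bsub>B\<^esub>))) \<le> k1 * p a"
      using charactersD(3)[OF w(1) hc[OF tens_closed[OF a B.one_closed]]] b1[OF a] by simp
    then show "cmod (w1 a) \<le> p a" using k by (simp add: w1_def norm_divide field_simps)
    show "w1 (c \<odot>\<^bsub>A\<^esub> a) = c * w1 a" for c
      using a by (simp add: w1_def tens_scale_left hscale tens_closed hc wf)
    fix a' assume a': "a' \<in> carrier A"
    show "w1 (a \<oplus>\<^bsub>A\<^esub> a') = w1 a + w1 a'"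
      using a a' by (simp add: w1_def tens_add_left hadd tens_closed hc wf add_divide_distrib)
  qed
  have w2: "w2 \<in> bounded_functionals B q"
    unfolding bounded_functionals_iff functionals_def
  proof (intro conjI CollectI ballI allI)
    fix b assume b: "b \<in> carrier B"
    have "cmod (w (h (tens \<one>\<^bsub>A\<^esub> b))) \<le> k2 * q b"
      using charactersD(3)[OF w(1) hc[OF tens_closed[OF A.one_closed b]]] b2[OF b] by simp
    then show "cmod (w2 b) \<le> q b" using k by (simp add: w2_def norm_divide field_simps)
    show "w2 (c \<odot>\<^bsub>B\<^esub> b) = c * w2 b" for c
      using b by (simp add: w2_def tens_scale_right hscale tens_closed hc wf)
    fix b' assume b': "b' \<in> carrier B"
    show "w2 (b \<oplus>\<^bsub>B\<^esub> b') = w2 b + w2 b'"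
      using b b' by (simp add: w2_def tens_add_right hadd tens_closed hc wf add_divide_distrib)
  qed
  \<comment> \<open>A pure tensor is the product of its two embedded entries and
    \<open>w \<circ> h\<close> is multiplicative, so it is the product functional up to the two
    normalizing constants.\<close>
  have "pairing w1 w2 f = w (h (cls f)) / complex_of_real (k1 * k2)"
    using f
  proof (induction f rule: F_induct)
    case zero
    have "h (cls 0) = 0 \<odot>\<^bsub>D\<^esub> h (cls 0)" using hscale[of "cls 0" 0] F_zero_closed by (simp add: T_zero)
    then have "w (h (cls 0)) = 0" using wf(2)[OF hc[OF cls_closed[OF F_zero_closed]], of 0] by simp
    then show ?case by simp
  next
    case (single a b c)
    have "h (cls (Poly_Mapping.single (a, b) c)) = c \<odot>\<^bsub>D\<^esub> (h (tens a \<one>\<^bsub>B\<^esub>) \<otimes>\<^bsub>D\<^esub> h (tens \<one>\<^bsub>A\<^esub> b))"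
      using single by (simp add: cls_single hscale tens_closed tens_split[of a b] hmult)
    then show ?case
      using single by (simp add: pairing_single wf charactersD(4)[OF w(1)] hc tens_closed w1_def w2_def)
  next
    case (add f g)
    then show ?case by (simp add: pairing_add hadd hc wf add_divide_distrib flip: T_add)
  qed
  then have "cmod (pairing w1 w2 f) = r (h X) / (k1 * k2)"
    using k w(2) by (simp add: norm_divide norm_mult Xf)
  then have "r (h X) / (k1 * k2) \<le> inj X" using inj_upper[OF f w1 w2] by (simp add: Xf)
  then show ?thesis using k by (simp add: field_simps)
qed

end

section \<open>Comparison of the topologies and the coproduct\<close>

lemma with_topology_simps [simp]:
  "carrier (with_topology A X) = carrier A" "mult (with_topology A X) = mult A"
  "one (with_topology A X) = one A" "zero (with_topology A X) = zero A" "add (with_topology A X) = add A"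
  "smult (with_topology A X) = smult A" "star (with_topology A X) = star A" "topol (with_topology A X) = X"
  by (simp_all add: with_topology_def)

text \<open>Negation is not a record field but described through carrier, addition and zero, all of
  which \<open>with_topology\<close> retains.\<close>

lemma a_minus_with_topology [simp]: "a_minus (with_topology A X) = a_minus A"
  by (simp add: fun_eq_iff a_minus_def a_inv_def m_inv_def)

lemma seminorm_with_topology [simp]: "seminorm (with_topology A X) = seminorm A"
  and cstar_seminorm_with_topology [simp]: "cstar_seminorm (with_topology A X) = cstar_seminorm A"
  and directed_upward_with_topology [simp]: "directed_upward (with_topology A X) = directed_upward A"
  and seminorm_topology_with_topology [simp]: "seminorm_topology (with_topology A X) = seminorm_topology A"
  by (simp_all add: fun_eq_iff seminorm_def cstar_seminorm_def directed_upward_def seminorm_topology_def)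

lemma star_algebra_with_topology:
  assumes "star_algebra A" shows "star_algebra (with_topology A X)"
proof -
  interpret star_algebra A by fact
  have "cring (with_topology A X)"
  proof (rule cringI)
    show "abelian_group (with_topology A X)"
    proof (rule abelian_groupI)
      fix x assume "x \<in> carrier (with_topology A X)"
      then show "\<exists>y\<in>carrier (with_topology A X). y \<oplus>\<^bsub>with_topology A X\<^esub> x = \<zero>\<^bsub>with_topology A X\<^esub>"
        using M.l_neg[of x] M.a_inv_closed[of x] by auto
    qed (auto simp: M.a_ac)
    show "comm_monoid (with_topology A X)"
      by (rule comm_monoidI) (auto simp: m_ac)
  qed (auto simp: l_distr)
  then have "algebra complex_ring (with_topology A X)"
    by (rule algebraI[OF R_cring])
      (auto simp: complex_ring_def scale_add_left scale_add_right scale_scale scale_mult_left)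
  then show ?thesis
    by (intro star_algebra.intro star_algebra_axioms.intro)
      (auto simp: star_closed star_add star_smult star_star star_mult)
qed

lemma star_morphisms_comp:
  assumes "u \<in> star_morphisms A B" "v \<in> star_morphisms B C"
  shows "(\<lambda>x. v (u x)) \<in> star_morphisms A C"
proof (rule star_morphismsI)
  show "continuous_map (topol A) (topol C) (\<lambda>x. v (u x))"
    using continuous_map_compose[OF star_morphismsD(7)[OF assms(1)] star_morphismsD(7)[OF assms(2)]]
    by (simp add: o_def)
qed (simp_all add: star_morphismsD[OF assms(1)] star_morphismsD[OF assms(2)])

lemma topologically_star_isomorphic_refl: "topologically_star_isomorphic A A"
  unfolding topologically_star_isomorphic_def
proof (intro bexI conjI)
  show "bij_betw (\<lambda>x. x) (carrier A) (carrier A)" by (simp add: bij_betw_def)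
  show "homeomorphic_map (topol A) (topol A) (\<lambda>x. x)" using homeomorphic_map_id[of "topol A"] by (simp add: id_def)
  show "(\<lambda>x. x) \<in> star_morphisms A A" by (rule star_morphismsI) auto
qed

locale tensor_topologies = A: cstar_topology A P + B: cstar_topology B Q
  for A :: "('a, 'm) top_star_alg_scheme" (structure) and P
    and B :: "('b, 'n) top_star_alg_scheme" (structure) and Q
begin

sublocale star_algebra_pair A B ..

abbreviation injs where "injs \<equiv> {injective_seminorm A B p q | p q. p \<in> P \<and> q \<in> Q}"
abbreviation T\<epsilon> where "T\<epsilon> \<equiv> tensor_injective A B P Q"

lemma tensor_seminormsI: "p \<in> P \<Longrightarrow> q \<in> Q \<Longrightarrow> tensor_seminorms A B p q"
  by (intro tensor_seminorms.intro star_algebra_pair_axioms A.P_cstar_seminormed B.P_cstar_seminormed)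

lemma injs_cstar: "s \<in> injs \<Longrightarrow> cstar_seminorm T s"
  using tensor_seminorms.inj_cstar_seminorm[OF tensor_seminormsI] by blast

lemma injs_seminorm: "s \<in> injs \<Longrightarrow> seminorm T s"
  using injs_cstar by (simp add: cstar_seminorm_def)

text \<open>Larger seminorms admit more functionals, so the injective seminorm is monotone in both
  arguments and inherits directedness from P and Q.\<close>

lemma injs_directed: "directed_upward T injs"
  unfolding directed_upward_def
proof (intro conjI ballI)
  show "injs \<noteq> {}" using A.P_nonempty B.P_nonempty by blast
  have mono: "injective_seminorm A B p q X \<le> injective_seminorm A B r s X"
    if m: "p \<in> P" "q \<in> Q" "r \<in> P" "s \<in> Q" and pr: "\<And>x. x \<in> carrier A \<Longrightarrow> p x \<le> r x"
      and qs: "\<And>x. x \<in> carrier B \<Longrightarrow> q x \<le> s x" and X: "X \<in> carrier T" for p q r s X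
  proof -
    interpret pq: tensor_seminorms A B p q by (rule tensor_seminormsI[OF m(1,2)])
    interpret rs: tensor_seminorms A B r s by (rule tensor_seminormsI[OF m(3,4)])
    obtain f where f: "f \<in> carrier F" and Xf: "X = cls f" using X by (rule T_cases)
    show ?thesis unfolding Xf
      by (rule pq.inj_least[OF f], rule rs.inj_upper[OF f])
        (use pr qs in \<open>auto simp: bounded_functionals_iff intro: order_trans\<close>)
  qed
  fix s t assume "s \<in> injs" "t \<in> injs"
  then obtain p q p' q' where s: "s = injective_seminorm A B p q" "p \<in> P" "q \<in> Q"
    and t: "t = injective_seminorm A B p' q'" "p' \<in> P" "q' \<in> Q" by blast
  obtain r where r: "r \<in> P" "\<And>x. x \<in> carrier A \<Longrightarrow> p x \<le> r x" "\<And>x. x \<in> carrier A \<Longrightarrow> p' x \<le> r x"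
    using A.P_dominates[OF s(2) t(2)] by metis
  obtain r' where r': "r' \<in> Q" "\<And>x. x \<in> carrier B \<Longrightarrow> q x \<le> r' x" "\<And>x. x \<in> carrier B \<Longrightarrow> q' x \<le> r' x"
    using B.P_dominates[OF s(3) t(3)] by metis
  show "\<exists>r\<in>injs. \<forall>x\<in>carrier T. s x \<le> r x \<and> t x \<le> r x"
    using mono[OF s(2,3) r(1) r'(1) r(2) r'(2)] mono[OF t(2,3) r(1) r'(1) r(3) r'(3)] r(1) r'(1) s(1) t(1)
    by (intro bexI[of _ "injective_seminorm A B r r'"]) auto
qed

lemma cstar_topology_injective: "cstar_topology T\<epsilon> injs"
  by (intro cstar_topology.intro cstar_topology_axioms.intro)
    (use injs_cstar injs_directed in
      \<open>auto simp: tensor_injective_def injective_topology_def star_algebra_with_topology star_algebra_T\<close>)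

section \<open>The projective topology and its comparison with the injective one\<close>

definition admissible :: "('a \<times> 'b \<Rightarrow>\<^sub>0 complex) set topology \<Rightarrow> bool" where
  "admissible X \<longleftrightarrow> locally_convex_topology T X \<and>
     continuous_map (prod_topology (topol A) (topol B)) X (\<lambda>(a, b). tens a b)"

text \<open>Continuity is tested on the subbase, so the lemma also serves for the family of all
  seminorms that defines the projective topology.\<close>

lemma continuous_seminorm_topologyI:
  assumes "\<And>p x e. p \<in> S \<Longrightarrow> x \<in> carrier T \<Longrightarrow> 0 < e \<Longrightarrow>
    openin (prod_topology (topol A) (topol B))
      {(a, b). a \<in> carrier A \<and> b \<in> carrier B \<and> p (tens a b \<ominus>\<^bsub>T\<^esub> x) < e}"
  shows "continuous_map (prod_topology (topol A) (topol B)) (seminorm_topology T S) (\<lambda>(a, b). tens a b)"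
  unfolding seminorm_topology_def continuous_on_generated_topo_iff
proof (intro conjI allI impI)
  let ?X = "prod_topology (topol A) (topol B)"
  show "(\<lambda>(a, b). tens a b) ` topspace ?X \<subseteq>
      \<Union> (insert (carrier T) {{y \<in> carrier T. p (y \<ominus>\<^bsub>T\<^esub> x) < e} |p x e. p \<in> S \<and> x \<in> carrier T \<and> 0 < e})"
    using tens_closed by auto
  fix U assume "U \<in> insert (carrier T) {{y \<in> carrier T. p (y \<ominus>\<^bsub>T\<^esub> x) < e} |p x e. p \<in> S \<and> x \<in> carrier T \<and> 0 < e}"
  then consider "U = carrier T"
    | p x e where "U = {y \<in> carrier T. p (y \<ominus>\<^bsub>T\<^esub> x) < e}" "p \<in> S" "x \<in> carrier T" "0 < e" by blast
  then show "openin ?X ((\<lambda>(a, b). tens a b) -` U \<inter> topspace ?X)"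
  proof cases
    case 1
    have "(\<lambda>(a, b). tens a b) -` U \<inter> topspace ?X = topspace ?X" using tens_closed 1 by auto
    then show ?thesis by (metis openin_topspace)
  next
    case 2
    have "(\<lambda>(a, b). tens a b) -` U \<inter> topspace ?X
        = {(a, b). a \<in> carrier A \<and> b \<in> carrier B \<and> p (tens a b \<ominus>\<^bsub>T\<^esub> x) < e}"
      using tens_closed 2(1) by auto
    then show ?thesis using assms[OF 2(2-4)] by simp
  qed
qed

lemma admissible_open:
  assumes "continuous_map (prod_topology (topol A) (topol B)) (seminorm_topology T S) (\<lambda>(a, b). tens a b)"
    and "p \<in> S" "x \<in> carrier T" "0 < e"
  shows "openin (prod_topology (topol A) (topol B))
      {(a, b). a \<in> carrier A \<and> b \<in> carrier B \<and> p (tens a b \<ominus>\<^bsub>T\<^esub> x) < e}"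
proof -
  have "{z \<in> topspace (prod_topology (topol A) (topol B)).
      (\<lambda>(a, b). tens a b) z \<in> {y \<in> carrier T. p (y \<ominus>\<^bsub>T\<^esub> x) < e}}
    = {(a, b). a \<in> carrier A \<and> b \<in> carrier B \<and> p (tens a b \<ominus>\<^bsub>T\<^esub> x) < e}"
    using tens_closed by auto
  then show ?thesis
    using openin_continuous_map_preimage[OF assms(1) T.openin_seminorm_ball[OF assms(2-4)]] by simp
qed

text \<open>The seminorms whose balls pull back to open sets of the product define an admissible
  topology, and they include every family that defines an admissible topology. So a strongest one
  exists; it is unique by antisymmetry, which gives meaning to the description operator in the
  definition.\<close>

lemma projective_topology_strongest:
  shows "admissible (projective_topology A B)"
    and "\<And>Y W. admissible Y \<Longrightarrow> openin Y W \<Longrightarrow> openin (projective_topology A B) W"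
proof -
  define S where "S = {p. seminorm T p \<and> (\<forall>x\<in>carrier T. \<forall>e>0. openin (prod_topology (topol A) (topol B))
      {(a, b). a \<in> carrier A \<and> b \<in> carrier B \<and> p (tens a b \<ominus>\<^bsub>T\<^esub> x) < e})}"
  define X where "X = seminorm_topology T S"
  have admX: "admissible X"
    unfolding admissible_def
  proof
    show "locally_convex_topology T X" unfolding locally_convex_topology_def X_def by (rule exI[of _ S]) (simp add: S_def)
    show "continuous_map (prod_topology (topol A) (topol B)) X (\<lambda>(a, b). tens a b)"
      unfolding X_def by (rule continuous_seminorm_topologyI) (simp add: S_def)
  qed
  have finest: "openin X W" if Y: "admissible Y" and W: "openin Y W" for Y W
  proof -
    obtain R where R: "\<forall>p\<in>R. seminorm T p" "Y = seminorm_topology T R"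
      using Y by (auto simp: admissible_def locally_convex_topology_def)
    have "R \<subseteq> S"
      using R Y admissible_open unfolding admissible_def S_def by blast
    then show ?thesis
      unfolding X_def by (rule T.seminorm_topology_subset[OF _ _ W[unfolded R(2)], rotated]) (simp add: S_def)
  qed
  have "projective_topology A B = X"
    unfolding projective_topology_def Let_def admissible_def[symmetric]
  proof (rule the_equality)
    show "admissible X \<and> (\<forall>Y. admissible Y \<longrightarrow> (\<forall>W. openin Y W \<longrightarrow> openin X W))"
      using admX finest by blast
    show "Z = X" if "admissible Z \<and> (\<forall>Y. admissible Y \<longrightarrow> (\<forall>W. openin Y W \<longrightarrow> openin Z W))" for Z
      using that admX finest unfolding topology_eq by blast
  qed
  then show "admissible (projective_topology A B)"
    "\<And>Y W. admissible Y \<Longrightarrow> openin Y W \<Longrightarrow> openin (projective_topology A B) W"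
    using admX finest by simp_all
qed

lemma topspace_projective: "topspace (projective_topology A B) = carrier T"
  using projective_topology_strongest(1) by (auto simp: admissible_def locally_convex_topology_def)

text \<open>The cross estimate \<open>inj_tens_le\<close> makes the tensor map jointly continuous
  for the injective topology, which is therefore weaker than the projective one.\<close>

lemma admissible_injective: "admissible (injective_topology A B P Q)"
  unfolding admissible_def
proof
  show "locally_convex_topology T (injective_topology A B P Q)"
    unfolding locally_convex_topology_def injective_topology_def using injs_seminorm by blast
  show "continuous_map (prod_topology (topol A) (topol B)) (injective_topology A B P Q) (\<lambda>(a, b). tens a b)"
    unfolding injective_topology_def
  proof (rule continuous_seminorm_topologyI)
    fix s x and e :: real assume s: "s \<in> injs" and x: "x \<in> carrier T" and e: "0 < e"
    then obtain p q where pq: "p \<in> P" "q \<in> Q" and s': "s = injective_seminorm A B p q" by blast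
    interpret tensor_seminorms A B p q by (rule tensor_seminormsI[OF pq])
    show "openin (prod_topology (topol A) (topol B))
        {(a, b). a \<in> carrier A \<and> b \<in> carrier B \<and> s (tens a b \<ominus>\<^bsub>T\<^esub> x) < e}"
      unfolding openin_prod_topology_alt
    proof (intro allI impI)
      fix a b assume "(a, b) \<in> {(a, b). a \<in> carrier A \<and> b \<in> carrier B \<and> s (tens a b \<ominus>\<^bsub>T\<^esub> x) < e}"
      then have a: "a \<in> carrier A" and b: "b \<in> carrier B" and ab: "s (tens a b \<ominus>\<^bsub>T\<^esub> x) < e" by auto
      define d where "d = e - s (tens a b \<ominus>\<^bsub>T\<^esub> x)"
      have d: "d > 0" using ab by (simp add: d_def)
      \<comment> \<open>With \<open>t \<le> 1\<close>, each \<open>b'\<close> in the neighbourhood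
        has \<open>q b' \<le> q b + 1\<close>, so the tensor moves by at most
        \<open>t * (q b + 1) + p a * t = t * M\<close>; t is chosen to bring this below d.\<close>
      define M where "M = p a + q b + 1"
      have M: "M > 0" using a b p.nonneg[OF a] q.nonneg[OF b] unfolding M_def by linarith
      define t where "t = min 1 (d / (2 * M))"
      have t: "t > 0" "t \<le> 1" "t * M < d"
      proof -
        show "t > 0" "t \<le> 1" using d M by (auto simp: t_def)
        have "t * M \<le> d / (2 * M) * M" unfolding t_def using M by (intro mult_right_mono) auto
        also have "\<dots> < d" using M d by simp
        finally show "t * M < d" .
      qed
      let ?U = "{y \<in> carrier A. p (y \<ominus>\<^bsub>A\<^esub> a) < t}" and ?V = "{y \<in> carrier B. q (y \<ominus>\<^bsub>B\<^esub> b) < t}"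
      have "s (tens a' b' \<ominus>\<^bsub>T\<^esub> x) < e" if a': "a' \<in> ?U" and b': "b' \<in> ?V" for a' b'
      proof -
        have c: "a' \<in> carrier A" "b' \<in> carrier B" using a' b' by auto
        have da: "a' = (a' \<ominus>\<^bsub>A\<^esub> a) \<oplus>\<^bsub>A\<^esub> a" and db: "b' = (b' \<ominus>\<^bsub>B\<^esub> b) \<oplus>\<^bsub>B\<^esub> b"
          using a b c by (simp_all add: A.diff_add_cancel B.diff_add_cancel)
        note tc = tens_closed
        \<comment> \<open>One entry is changed at a time, so that each error term has a small
          factor.\<close>
        have "tens a' b' = tens (a' \<ominus>\<^bsub>A\<^esub> a) b' \<oplus>\<^bsub>T\<^esub> (tens a (b' \<ominus>\<^bsub>B\<^esub> b) \<oplus>\<^bsub>T\<^esub> tens a b)"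
          using tens_add_left[of "a' \<ominus>\<^bsub>A\<^esub> a" a b'] tens_add_right[of a "b' \<ominus>\<^bsub>B\<^esub> b" b] a b c da db
          by simp
        then have "tens a' b' \<ominus>\<^bsub>T\<^esub> tens a b = tens (a' \<ominus>\<^bsub>A\<^esub> a) b' \<oplus>\<^bsub>T\<^esub> tens a (b' \<ominus>\<^bsub>B\<^esub> b)"
          using a b c by (simp add: T.M.minus_eq T.M.a_assoc tc T.M.r_neg)
        then have "s (tens a' b' \<ominus>\<^bsub>T\<^esub> tens a b) \<le> s (tens (a' \<ominus>\<^bsub>A\<^esub> a) b') + s (tens a (b' \<ominus>\<^bsub>B\<^esub> b))"
          using a b c I.triangle by (simp add: tc s')
        also have "\<dots> \<le> p (a' \<ominus>\<^bsub>A\<^esub> a) * q b' + p a * q (b' \<ominus>\<^bsub>B\<^esub> b)"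
          unfolding s' using a b c by (intro add_mono inj_tens_le) auto
        also have "\<dots> \<le> t * (q b + 1) + p a * t"
        proof (intro add_mono mult_mono)
          have "q b' \<le> q (b' \<ominus>\<^bsub>B\<^esub> b) + q b" using q.triangle[of "b' \<ominus>\<^bsub>B\<^esub> b" b] b c db by simp
          then show "q b' \<le> q b + 1" using b' t(2) by simp
        qed (use a' b' a b c t(1) in auto)
        also have "\<dots> = t * M" by (simp add: M_def algebra_simps)
        finally have "s (tens a' b' \<ominus>\<^bsub>T\<^esub> tens a b) < d" using t(3) by simp
        moreover have "s (tens a' b' \<ominus>\<^bsub>T\<^esub> x) \<le> s (tens a' b' \<ominus>\<^bsub>T\<^esub> tens a b) + s (tens a b \<ominus>\<^bsub>T\<^esub> x)"
          unfolding s' using a b c x by (intro I.diff_triangle tc)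
        ultimately show ?thesis by (simp add: d_def)
      qed
      moreover have "a \<in> ?U" "b \<in> ?V" using a b t(1) by (simp_all add: A.diff_self B.diff_self)
      ultimately show "\<exists>U V. openin (topol A) U \<and> openin (topol B) V \<and> a \<in> U \<and> b \<in> V \<and>
          U \<times> V \<subseteq> {(a, b). a \<in> carrier A \<and> b \<in> carrier B \<and> s (tens a b \<ominus>\<^bsub>T\<^esub> x) < e}"
        using A.openin_ball[OF pq(1) a t(1)] B.openin_ball[OF pq(2) b t(1)]
        by (intro exI[of _ ?U] exI[of _ ?V]) auto
    qed
  qed
qed

text \<open>Restricted to the two embedded factors, r is a continuous seminorm and hence dominated
  by members of P and Q. The domination on the whole tensor product is \<open>inj_dominates\<close>
  for the identity map.\<close>

lemma pi_continuous_dominated: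
  assumes r: "cstar_seminorm T r" and cont: "continuous_map (projective_topology A B) euclideanreal r"
  shows "\<exists>s\<in>injs. \<exists>k. \<forall>X\<in>carrier T. r X \<le> k * s X"
proof -
  interpret r: cstar_seminormed T r by (rule T.cstar_seminormedI[OF r])
  have ct: "continuous_map (prod_topology (topol A) (topol B)) euclideanreal (r \<circ> (\<lambda>(a, b). tens a b))"
    using projective_topology_strongest(1) cont by (auto simp: admissible_def intro: continuous_map_compose)
  have cl: "continuous_map (topol A) (prod_topology (topol A) (topol B)) (\<lambda>a. (a, \<one>\<^bsub>B\<^esub>))"
    and cr: "continuous_map (topol B) (prod_topology (topol A) (topol B)) (\<lambda>b. (\<one>\<^bsub>A\<^esub>, b))"
    by (auto simp: continuous_map_pairwise o_def)
  have "seminorm A (\<lambda>a. r (tens a \<one>\<^bsub>B\<^esub>))"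
    by (auto simp: seminorm_def tens_closed tens_add_left tens_scale_left r.triangle r.scale)
  moreover have "continuous_map (topol A) euclideanreal (\<lambda>a. r (tens a \<one>\<^bsub>B\<^esub>))"
    using continuous_map_compose[OF cl ct] by (simp add: o_def)
  ultimately obtain p k1 where p: "p \<in> P" "k1 > 0" "\<And>a. a \<in> carrier A \<Longrightarrow> r (tens a \<one>\<^bsub>B\<^esub>) \<le> k1 * p a"
    using A.continuous_seminorm_bounded by metis
  have "seminorm B (\<lambda>b. r (tens \<one>\<^bsub>A\<^esub> b))"
    by (auto simp: seminorm_def tens_closed tens_add_right tens_scale_right r.triangle r.scale)
  moreover have "continuous_map (topol B) euclideanreal (\<lambda>b. r (tens \<one>\<^bsub>A\<^esub> b))"
    using continuous_map_compose[OF cr ct] by (simp add: o_def)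
  ultimately obtain q k2 where q: "q \<in> Q" "k2 > 0" "\<And>b. b \<in> carrier B \<Longrightarrow> r (tens \<one>\<^bsub>A\<^esub> b) \<le> k2 * q b"
    using B.continuous_seminorm_bounded by metis
  interpret tensor_seminorms A B p q by (rule tensor_seminormsI[OF p(1) q(1)])
  have "r X \<le> k1 * k2 * inj X" if "X \<in> carrier T" for X
    using inj_dominates[OF star_algebra_T r, of "\<lambda>X. X" k1 k2 X] p q that by simp
  then show ?thesis using p(1) q(1) by blast
qed

text \<open>In one direction, \<open>\<pi>\<close>-continuous C*-seminorms are dominated by
  injective ones. In the other, the injective seminorms are themselves
  \<open>\<pi>\<close>-continuous C*-seminorms, as the injective topology is admissible.\<close>

lemma pi_star_eq_injective: "pi_star_topology A B = injective_topology A B P Q"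
proof (rule topology_eq[THEN iffD2], intro allI iffI)
  let ?S = "{p. cstar_seminorm T p \<and> continuous_map (projective_topology A B) euclideanreal p}"
  have S: "seminorm T p" if "p \<in> ?S" for p using that by (simp add: cstar_seminorm_def)
  fix U
  show "openin (injective_topology A B P Q) U" if "openin (pi_star_topology A B) U"
    unfolding injective_topology_def
    by (rule T.seminorm_topology_mono[OF S injs_seminorm _ that[unfolded pi_star_topology_def]])
      (use pi_continuous_dominated in blast)+
  have "s \<in> ?S" if s: "s \<in> injs" for s
  proof -
    have "continuous_map (injective_topology A B P Q) euclideanreal s"
      unfolding injective_topology_def by (rule T.continuous_map_seminorm[OF injs_seminorm[OF s] s])
    then have "continuous_map (projective_topology A B) euclideanreal s"
      using projective_topology_strongest(2)[OF admissible_injective] topspace_projective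
      by (auto simp: continuous_map_def injective_topology_def)
    then show ?thesis using injs_cstar[OF s] by simp
  qed
  then have sub: "injs \<subseteq> ?S" by blast
  show "openin (pi_star_topology A B) U" if "openin (injective_topology A B P Q) U"
    unfolding pi_star_topology_def
    by (rule T.seminorm_topology_subset[OF S sub that[unfolded injective_topology_def]])
qed

section \<open>The coproduct property\<close>

lemma tens_left_morphism: "(\<lambda>a. tens a \<one>\<^bsub>B\<^esub>) \<in> star_morphisms A T\<epsilon>"
proof (rule star_morphismsI)
  have pair: "cstar_linear_map A P T\<epsilon> injs (\<lambda>a. tens a \<one>\<^bsub>B\<^esub>)"
    by (intro cstar_linear_map.intro A.cstar_topology_axioms cstar_topology_injective
        cstar_linear_map_axioms.intro)
      (auto simp: tensor_injective_def tens_closed tens_add_left tens_scale_left)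
  show "continuous_map (topol A) (topol T\<epsilon>) (\<lambda>a. tens a \<one>\<^bsub>B\<^esub>)"
  proof (rule cstar_linear_map.continuousI[OF pair])
    fix s assume "s \<in> injs"
    then obtain p q where pq: "p \<in> P" "q \<in> Q" and s: "s = injective_seminorm A B p q" by blast
    interpret tensor_seminorms A B p q by (rule tensor_seminormsI[OF pq])
    show "\<exists>p\<in>P. \<exists>k. \<forall>a\<in>carrier A. s (tens a \<one>\<^bsub>B\<^esub>) \<le> k * p a"
      using inj_tens_le[OF _ B.one_closed] pq(1) by (auto simp: s mult.commute intro!: bexI[of _ p] exI[of _ "q \<one>\<^bsub>B\<^esub>"])
  qed
qed (auto simp: tensor_injective_def tens_closed tens_add_left tens_scale_left tens_mult tens_one tens_star)

lemma tens_right_morphism: "(\<lambda>b. tens \<one>\<^bsub>A\<^esub> b) \<in> star_morphisms B T\<epsilon>"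
proof (rule star_morphismsI)
  have pair: "cstar_linear_map B Q T\<epsilon> injs (\<lambda>b. tens \<one>\<^bsub>A\<^esub> b)"
    by (intro cstar_linear_map.intro B.cstar_topology_axioms cstar_topology_injective
        cstar_linear_map_axioms.intro)
      (auto simp: tensor_injective_def tens_closed tens_add_right tens_scale_right)
  show "continuous_map (topol B) (topol T\<epsilon>) (\<lambda>b. tens \<one>\<^bsub>A\<^esub> b)"
  proof (rule cstar_linear_map.continuousI[OF pair])
    fix s assume "s \<in> injs"
    then obtain p q where pq: "p \<in> P" "q \<in> Q" and s: "s = injective_seminorm A B p q" by blast
    interpret tensor_seminorms A B p q by (rule tensor_seminormsI[OF pq])
    show "\<exists>q\<in>Q. \<exists>k. \<forall>b\<in>carrier B. s (tens \<one>\<^bsub>A\<^esub> b) \<le> k * q b"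
      using inj_tens_le[OF A.one_closed] pq(2) by (auto simp: s intro!: bexI[of _ q] exI[of _ "p \<one>\<^bsub>A\<^esub>"])
  qed
qed (auto simp: tensor_injective_def tens_closed tens_add_right tens_scale_right tens_mult tens_one tens_star)

text \<open>Commutativity of C makes the product of the two morphisms respect multiplication and the
  involution. Continuity for the injective topology is the domination of every seminorm of C, pulled
  back along h.\<close>

lemma tensor_universal:
  assumes C: "cstar_topology C R" and u: "u \<in> star_morphisms A C" and v: "v \<in> star_morphisms B C"
  obtains h where "h \<in> star_morphisms T\<epsilon> C"
    "\<And>a. a \<in> carrier A \<Longrightarrow> h (tens a \<one>\<^bsub>B\<^esub>) = u a" "\<And>b. b \<in> carrier B \<Longrightarrow> h (tens \<one>\<^bsub>A\<^esub> b) = v b"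
proof -
  interpret C: cstar_topology C R by fact
  interpret u: cstar_linear_map A P C R u
    by (rule star_morphism_linear_map[OF A.cstar_topology_axioms C u])
  interpret v: cstar_linear_map B Q C R v
    by (rule star_morphism_linear_map[OF B.cstar_topology_axioms C v])
  note uD = star_morphismsD[OF u] and vD = star_morphismsD[OF v]
  \<comment> \<open>The only possible value on a pure tensor, as it splits into its two embedded
    entries.\<close>
  define g where "g k = u (fst k) \<otimes>\<^bsub>C\<^esub> v (snd k)" for k
  define L where "L = C.lin g"
  have gc: "g k \<in> carrier C" if "k \<in> Poly_Mapping.keys f" "f \<in> carrier F" for k f
    using that by (auto simp: carrier_F g_def uD(1) vD(1))
  have L_closed: "L f \<in> carrier C" if "f \<in> carrier F" for f
    unfolding L_def using gc that by (intro C.lin_closed) auto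
  have L_zero: "L 0 = \<zero>\<^bsub>C\<^esub>" by (simp add: L_def)
  have L_single: "L (Poly_Mapping.single (a, b) c) = c \<odot>\<^bsub>C\<^esub> (u a \<otimes>\<^bsub>C\<^esub> v b)"
    if "a \<in> carrier A" "b \<in> carrier B" for a b c
    using that unfolding L_def by (subst C.lin_single) (auto simp: g_def uD(1) vD(1))
  have L_add: "L (f + f') = L f \<oplus>\<^bsub>C\<^esub> L f'" if "f \<in> carrier F" "f' \<in> carrier F" for f f'
    unfolding L_def using gc that by (intro C.lin_add) auto
  have L_diff: "L (f - f') = L f \<ominus>\<^bsub>C\<^esub> L f'" if "f \<in> carrier F" "f' \<in> carrier F" for f f'
  proof -
    have "L f = L (f - f') \<oplus>\<^bsub>C\<^esub> L f'" using L_add[OF F_diff_closed[OF that] that(2)] by simp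
    then show ?thesis using that
      by (simp add: L_closed F_diff_closed C.M.minus_eq C.M.a_assoc C.M.r_neg)
  qed
  have L_scale: "L (c \<odot>\<^bsub>F\<^esub> f) = c \<odot>\<^bsub>C\<^esub> L f" if "f \<in> carrier F" for c f
    using that
  proof (induction f rule: F_induct)
    case (single a b d)
    then show ?case by (simp add: F_scale_single L_single C.scale_scale uD(1) vD(1))
  qed (simp_all add: L_zero L_add F_scale_add F_scale_closed L_closed C.scale_add_right)
  have L_mult: "L (f \<otimes>\<^bsub>F\<^esub> f') = L f \<otimes>\<^bsub>C\<^esub> L f'" if f: "f \<in> carrier F" and f': "f' \<in> carrier F" for f f'
    using f
  proof (induction f rule: F_induct)
    case zero
    then show ?case using f' by (simp add: L_zero L_closed)
  next
    case (add f1 f2)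
    then show ?case using f' by (simp add: F_mult_add_left L_add F_mult_closed L_closed C.l_distr)
  next
    case (single a b c)
    from f' show ?case
    proof (induction f' rule: F_induct)
      case zero
      then show ?case using single by (simp add: L_zero L_closed single_F)
    next
      case (add f1 f2)
      then show ?case using single
        by (simp add: F_mult_add_right L_add F_mult_closed L_closed C.r_distr single_F)
    next
      case (single a' b' c')
      have "(u a \<otimes>\<^bsub>C\<^esub> u a') \<otimes>\<^bsub>C\<^esub> (v b \<otimes>\<^bsub>C\<^esub> v b') = (u a \<otimes>\<^bsub>C\<^esub> v b) \<otimes>\<^bsub>C\<^esub> (u a' \<otimes>\<^bsub>C\<^esub> v b')"
        using single \<open>a \<in> carrier A\<close> \<open>b \<in> carrier B\<close> by (simp add: uD(1) vD(1) C.m_ac)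
      then show ?case
        using single \<open>a \<in> carrier A\<close> \<open>b \<in> carrier B\<close>
        by (simp add: F_mult_single L_single uD vD C.scale_mult_left C.scale_mult_right C.scale_scale mult.commute)
    qed
  qed
  have L_star: "L (star F f) = star C (L f)" if "f \<in> carrier F" for f
    using that
  proof (induction f rule: F_induct)
    case (single a b c)
    then show ?case
      by (simp add: F_star_single L_single A.star_closed B.star_closed uD vD C.star_smult C.star_mult C.m_comm
          C.star_closed)
  qed (simp_all add: L_zero L_add F_star_add F_star_closed L_closed C.star_add)
  have L_kernel: "L f = \<zero>\<^bsub>C\<^esub>" if "f \<in> N" for f
    using that
  proof (induction f rule: kernel_induct)
    case (left_add a a' b)
    then show ?case
      by (simp add: L_diff F_diff_closed single_F L_single uD vD C.l_distr C.M.minus_eq C.M.a_ac C.M.minus_add C.M.r_neg1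
          C.M.r_neg)
  next
    case (right_add a b b')
    then show ?case
      by (simp add: L_diff F_diff_closed single_F L_single uD vD C.r_distr C.M.minus_eq C.M.a_ac C.M.minus_add C.M.r_neg1
          C.M.r_neg)
  next
    case (left_scale c a b)
    then show ?case
      by (simp add: L_diff single_F L_single uD vD C.scale_mult_left C.diff_self)
  next
    case (right_scale c a b)
    then show ?case
      by (simp add: L_diff single_F L_single uD vD C.scale_mult_right C.diff_self)
  qed (simp_all add: L_zero L_add L_scale)
  \<comment> \<open>The chosen representative is immaterial, because L vanishes on the
    kernel.\<close>
  define h where "h X = L (SOME f. f \<in> carrier F \<and> X = cls f)" for X
  have h: "h (cls f) = L f" if f: "f \<in> carrier F" for f
  proof -
    define f' where "f' = (SOME f'. f' \<in> carrier F \<and> cls f = cls f')"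
    have f': "f' \<in> carrier F \<and> cls f = cls f'"
      unfolding f'_def by (rule someI[of _ f]) (use f in simp)
    then have "f' - f \<in> N" using cls_memI[of f'] cls_mem_iff[of f f'] f by simp
    then have "L f' \<ominus>\<^bsub>C\<^esub> L f = \<zero>\<^bsub>C\<^esub>" using L_kernel L_diff f f' by metis
    then have "L f' = L f" using C.diff_eq_zeroD L_closed f f' by blast
    then show ?thesis by (simp add: h_def f'_def)
  qed
  have h_closed: "h X \<in> carrier C" if "X \<in> carrier T" for X
    using that by (auto elim!: T_cases simp: h L_closed)
  have h_add: "h (X \<oplus>\<^bsub>T\<^esub> Y) = h X \<oplus>\<^bsub>C\<^esub> h Y" if "X \<in> carrier T" "Y \<in> carrier T" for X Y
    using that by (auto elim!: T_cases simp: T_add h F_add_closed L_add)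
  have h_mult: "h (X \<otimes>\<^bsub>T\<^esub> Y) = h X \<otimes>\<^bsub>C\<^esub> h Y" if "X \<in> carrier T" "Y \<in> carrier T" for X Y
    using that by (auto elim!: T_cases simp: T_mult h F_mult_closed L_mult)
  have h_scale: "h (c \<odot>\<^bsub>T\<^esub> X) = c \<odot>\<^bsub>C\<^esub> h X" if "X \<in> carrier T" for c X
    using that by (auto elim!: T_cases simp: T_scale h F_scale_closed L_scale)
  have h_star: "h (star T X) = star C (h X)" if "X \<in> carrier T" for X
    using that by (auto elim!: T_cases simp: T_star h F_star_closed L_star)
  have h_tens: "h (tens a b) = u a \<otimes>\<^bsub>C\<^esub> v b" if "a \<in> carrier A" "b \<in> carrier B" for a b
    using that by (simp add: tens_cls h single_F L_single uD(1) vD(1))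
  have h_left: "h (tens a \<one>\<^bsub>B\<^esub>) = u a" if "a \<in> carrier A" for a
    using that by (simp add: h_tens vD(4) uD(1))
  have h_right: "h (tens \<one>\<^bsub>A\<^esub> b) = v b" if "b \<in> carrier B" for b
    using that by (simp add: h_tens uD(4) vD(1))
  have pair: "cstar_linear_map T\<epsilon> injs C R h"
    by (intro cstar_linear_map.intro C cstar_topology_injective cstar_linear_map_axioms.intro)
      (auto simp: tensor_injective_def h_closed h_add h_scale)
  have "h \<in> star_morphisms T\<epsilon> C"
  proof (rule star_morphismsI)
    show "continuous_map (topol T\<epsilon>) (topol C) h"
    proof (rule cstar_linear_map.continuousI[OF pair])
      fix r assume r: "r \<in> R"
      obtain p k1 where p: "p \<in> P" "k1 > 0" "\<And>a. a \<in> carrier A \<Longrightarrow> r (u a) \<le> k1 * p a"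
        using u.continuousD[OF uD(7) r] by metis
      obtain q k2 where q: "q \<in> Q" "k2 > 0" "\<And>b. b \<in> carrier B \<Longrightarrow> r (v b) \<le> k2 * q b"
        using v.continuousD[OF vD(7) r] by metis
      interpret tensor_seminorms A B p q by (rule tensor_seminormsI[OF p(1) q(1)])
      have "r (h X) \<le> k1 * k2 * inj X" if "X \<in> carrier T" for X
        by (rule inj_dominates[OF C.star_algebra_axioms C.P_cstar[OF r]])
          (use that p q in \<open>simp_all add: h_closed h_add h_mult h_scale h_left h_right\<close>)
      then show "\<exists>s\<in>injs. \<exists>k. \<forall>X\<in>carrier T\<epsilon>. r (h X) \<le> k * s X"
        using p(1) q(1) unfolding tensor_injective_def by auto
    qed
  next
    show "h \<one>\<^bsub>T\<epsilon>\<^esub> = \<one>\<^bsub>C\<^esub>"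
      using h_left[of "\<one>\<^bsub>A\<^esub>"] by (simp add: tensor_injective_def tens_one uD(4))
  qed (simp_all add: tensor_injective_def h_closed h_add h_mult h_scale h_star)
  then show thesis using h_left h_right by (rule that)
qed

text \<open>Existence is the universal map on the tensor product followed by its extension to the
  completion. For uniqueness, two morphisms that agree on the factors agree on pure tensors, hence
  on all tensors, and then everywhere by \<open>completion_unique\<close>.\<close>

lemma coproduct: "is_coproduct TYPE('c) A B (hausdorff_completion T\<epsilon>)
    (\<lambda>a. completion_map T\<epsilon> (tens a \<one>\<^bsub>B\<^esub>)) (\<lambda>b. completion_map T\<epsilon> (tens \<one>\<^bsub>A\<^esub> b))"
proof -
  interpret E: cstar_topology T\<epsilon> injs by (rule cstar_topology_injective)
  have carrier_E: "carrier T\<epsilon> = carrier T" by (simp add: tensor_injective_def)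
  note i = star_morphisms_comp[OF tens_left_morphism E.emb_morphism]
    and j = star_morphisms_comp[OF tens_right_morphism E.emb_morphism]
  show ?thesis
    unfolding is_coproduct_def
  proof (intro conjI allI impI ballI i j E.K_star_algebra_K)
    fix C :: "'c top_star_alg" and u v
    assume C: "K_star_algebra C" and u: "u \<in> star_morphisms A C" and v: "v \<in> star_morphisms B C"
    obtain R where R: "cstar_topology C R"
      using C LC_star_algebra_cstar_topology unfolding K_star_algebra_def by blast
    obtain h where h: "h \<in> star_morphisms T\<epsilon> C" "\<And>a. a \<in> carrier A \<Longrightarrow> h (tens a \<one>\<^bsub>B\<^esub>) = u a"
      "\<And>b. b \<in> carrier B \<Longrightarrow> h (tens \<one>\<^bsub>A\<^esub> b) = v b" using tensor_universal[OF R u v] by metis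
    obtain w where w: "w \<in> star_morphisms E.K C" "\<And>X. X \<in> carrier T\<epsilon> \<Longrightarrow> w (E.emb X) = h X"
      using completion_extension[OF cstar_topology_injective C h(1)] by metis
    have wi: "w (E.emb (tens a \<one>\<^bsub>B\<^esub>)) = u a" if "a \<in> carrier A" for a
      using that w(2) h(2) by (simp add: carrier_E tens_closed)
    have wj: "w (E.emb (tens \<one>\<^bsub>A\<^esub> b)) = v b" if "b \<in> carrier B" for b
      using that w(2) h(3) by (simp add: carrier_E tens_closed)
    have uniq: "w' X = w X" if w': "w' \<in> star_morphisms E.K C"
      and ag: "\<forall>a\<in>carrier A. w' (E.emb (tens a \<one>\<^bsub>B\<^esub>)) = u a" "\<forall>b\<in>carrier B. w' (E.emb (tens \<one>\<^bsub>A\<^esub> b)) = v b"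
      and X: "X \<in> carrier E.K" for w' X
    proof (rule completion_unique[OF cstar_topology_injective C w' w(1) _ X])
      fix X assume "X \<in> carrier T\<epsilon>"
      then have "X \<in> carrier T" by (simp add: carrier_E)
      then show "w' (E.emb X) = w (E.emb X)"
      proof (induction X rule: T_induct)
        note m' = star_morphisms_comp[OF E.emb_morphism w', THEN star_morphismsD(2)]
          star_morphisms_comp[OF E.emb_morphism w', THEN star_morphismsD(3)]
          star_morphisms_comp[OF E.emb_morphism w', THEN star_morphismsD(5)]
        note m = star_morphisms_comp[OF E.emb_morphism w(1), THEN star_morphismsD(2)]
          star_morphisms_comp[OF E.emb_morphism w(1), THEN star_morphismsD(3)]
          star_morphisms_comp[OF E.emb_morphism w(1), THEN star_morphismsD(5)]
        \<comment> \<open>The injective tensor algebra differs from T only in its topology; the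
          rewriting states the morphism laws with the operations of T, as the induction
          requires.\<close>
        note mm = m[unfolded tensor_injective_def with_topology_simps, folded tensor_injective_def]
          m'[unfolded tensor_injective_def with_topology_simps, folded tensor_injective_def]
        {
          case (tens a b c)
          have "w' (E.emb (tens a b)) = w (E.emb (tens a b))"
            using tens ag wi wj by (simp add: tens_split[of a b] mm tens_closed)
          then show ?case using tens by (simp add: mm tens_closed)
        next
          case (add X Y)
          then show ?case by (simp add: mm)
        next
          case zero
          \<comment> \<open>Zero is written as 0 times the unit tensor, so that the law for scalars
            applies.\<close>
          have "w' (E.emb (tens \<one>\<^bsub>A\<^esub> \<one>\<^bsub>B\<^esub>)) = w (E.emb (tens \<one>\<^bsub>A\<^esub> \<one>\<^bsub>B\<^esub>))" using ag wi by simp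
          then show ?case
            using mm(3)[of "tens \<one>\<^bsub>A\<^esub> \<one>\<^bsub>B\<^esub>" 0] mm(6)[of "tens \<one>\<^bsub>A\<^esub> \<one>\<^bsub>B\<^esub>" 0]
            by (simp add: tens_closed)
        }
      qed
    qed
    show "\<exists>w\<in>star_morphisms E.K C.
        (\<forall>a\<in>carrier A. w (E.emb (tens a \<one>\<^bsub>B\<^esub>)) = u a) \<and> (\<forall>b\<in>carrier B. w (E.emb (tens \<one>\<^bsub>A\<^esub> b)) = v b) \<and>
        (\<forall>w'\<in>star_morphisms E.K C.
          (\<forall>a\<in>carrier A. w' (E.emb (tens a \<one>\<^bsub>B\<^esub>)) = u a) \<and> (\<forall>b\<in>carrier B. w' (E.emb (tens \<one>\<^bsub>A\<^esub> b)) = v b) \<longrightarrow>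
          (\<forall>x\<in>carrier E.K. w' x = w x))"
      using w(1) wi wj uniq by (intro bexI[of _ w]) blast+
  qed
qed

end

theorem corollary2p6:
  fixes A\<^sub>1 :: "'a top_star_alg" and A\<^sub>2 :: "'b top_star_alg"
    and P\<^sub>1 :: "('a \<Rightarrow> real) set" and P\<^sub>2 :: "('b \<Rightarrow> real) set"
  assumes "K_star_algebra A\<^sub>1" and "K_star_algebra A\<^sub>2"
    and "\<forall>p\<in>P\<^sub>1. cstar_seminorm A\<^sub>1 p" and "directed_upward A\<^sub>1 P\<^sub>1"
    and "topol A\<^sub>1 = seminorm_topology A\<^sub>1 P\<^sub>1"
    and "\<forall>p\<in>P\<^sub>2. cstar_seminorm A\<^sub>2 p" and "directed_upward A\<^sub>2 P\<^sub>2"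
    and "topol A\<^sub>2 = seminorm_topology A\<^sub>2 P\<^sub>2"
  defines "T \<equiv> tensor_injective A\<^sub>1 A\<^sub>2 P\<^sub>1 P\<^sub>2"
  shows "is_coproduct TYPE('c) A\<^sub>1 A\<^sub>2 (hausdorff_completion T)
           (\<lambda>a. completion_map T (pure_tensor A\<^sub>1 A\<^sub>2 a \<one>\<^bsub>A\<^sub>2\<^esub>))
           (\<lambda>b. completion_map T (pure_tensor A\<^sub>1 A\<^sub>2 \<one>\<^bsub>A\<^sub>1\<^esub> b))
       \<and> topologically_star_isomorphic
           (hausdorff_completion (tensor_pi_star A\<^sub>1 A\<^sub>2)) (hausdorff_completion T)"
proof -
  have "star_algebra A\<^sub>1" "star_algebra A\<^sub>2"
    using assms(1,2) by (auto simp: K_star_algebra_def LC_star_algebra_def)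
  then interpret tensor_topologies A\<^sub>1 P\<^sub>1 A\<^sub>2 P\<^sub>2
    by (intro tensor_topologies.intro cstar_topology.intro cstar_topology_axioms.intro)
      (use assms in auto)
  \<comment> \<open>The two algebras are equal before completion, so the identity is the required
    isomorphism of their completions.\<close>
  have "tensor_pi_star A\<^sub>1 A\<^sub>2 = T"
    by (simp add: T_def tensor_pi_star_def tensor_injective_def pi_star_eq_injective)
  then show ?thesis
    using coproduct topologically_star_isomorphic_refl unfolding T_def by metis
qed

end
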